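(* There is an absolute constant $c>0$ such that the following holds. Let $\alpha\in(0,1)$ and $a\in\mathbb{R}$ with $|a\alpha|<c$. Then there exist a function $W(\cdot;a)\in C^\alpha(\mathbb{R})$ and a number $\lambda(a)\in\mathbb{R}$ such that \[ w(x,t)=\frac{1}{1-t}\,W\!\left(\frac{x}{(1-t)^{1+\lambda(a)}};a\right) \] is a (self-similar) solution, for $t<1$, of the generalized De Gregorio equation \[ w_t+a\,u\,w_x=u_x\,w,\qquad u_x=Hw . \] Moreover, $W(\cdot;a)$ and $\lambda(a)$ depend analytically on $a$.
   Context: $H$ denotes the Hilbert transform on $\mathbb{R}$, $Hf(x)=\frac{1}{\pi}\,\mathrm{p.v.}\int_{-\infty}^{\infty}\frac{f(y)}{x-y}\,dy$. The velocity $u$ is determined from $w$ through $u_x=Hw$. $C^\alpha$ denotes the space of $\alpha$-Hölder continuous functions. *)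

theory Defs
  imports "HOL-Analysis.Analysis"
begin

definition has_hilbert :: "(real \<Rightarrow> real) \<Rightarrow> real \<Rightarrow> real \<Rightarrow> bool" where
  "has_hilbert f x L \<longleftrightarrow>
     (\<forall>e R. 0 < e \<and> e < R \<longrightarrow>
        (\<lambda>y. f y / (x - y)) integrable_on {y. e < \<bar>x - y\<bar> \<and> \<bar>x - y\<bar> < R}) \<and>
     ((\<lambda>(e, R). (1 / pi) * integral {y. e < \<bar>x - y\<bar> \<and> \<bar>x - y\<bar> < R} (\<lambda>y. f y / (x - y)))
        \<longlongrightarrow> L) (at_right 0 \<times>\<^sub>F at_top)"

definition holder :: "real \<Rightarrow> (real \<Rightarrow> real) \<Rightarrow> bool" where
  "holder \<alpha> f \<longleftrightarrow> bounded (range f) \<and>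
     (\<exists>C. \<forall>x y. \<bar>f x - f y\<bar> \<le> C * \<bar>x - y\<bar> powr \<alpha>)"

definition holder_norm :: "real \<Rightarrow> (real \<Rightarrow> real) \<Rightarrow> real" where
  "holder_norm \<alpha> f = (SUP x. \<bar>f x\<bar>) +
     (SUP p \<in> {(x, y). x \<noteq> y}. \<bar>f (fst p) - f (snd p)\<bar> / \<bar>fst p - snd p\<bar> powr \<alpha>)"

definition real_analytic_on :: "(real \<Rightarrow> real) \<Rightarrow> real set \<Rightarrow> bool" where
  "real_analytic_on f S \<longleftrightarrow>
     (\<forall>a0 \<in> S. \<exists>r > 0. \<exists>c :: nat \<Rightarrow> real.
        \<forall>a. \<bar>a - a0\<bar> < r \<longrightarrow> (\<lambda>n. c n * (a - a0) ^ n) sums f a)"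

definition holder_analytic_on :: "real \<Rightarrow> (real \<Rightarrow> real \<Rightarrow> real) \<Rightarrow> real set \<Rightarrow> bool" where
  "holder_analytic_on \<alpha> F S \<longleftrightarrow>
     (\<forall>a0 \<in> S. \<exists>r > 0. \<exists>G :: nat \<Rightarrow> real \<Rightarrow> real.
        (\<forall>n. holder \<alpha> (G n)) \<and>
        (\<forall>a. \<bar>a - a0\<bar> < r \<longrightarrow>
           (\<lambda>N. holder_norm \<alpha> (\<lambda>x. F a x - (\<Sum>n<N. G n x * (a - a0) ^ n))) \<longlonglongrightarrow> 0))"

definition test_fun :: "real \<Rightarrow> (real \<Rightarrow> real \<Rightarrow> real) \<Rightarrow> (real \<Rightarrow> real \<Rightarrow> real)
                        \<Rightarrow> (real \<Rightarrow> real \<Rightarrow> real) \<Rightarrow> bool" where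
  "test_fun T \<phi> \<phi>x \<phi>t \<longleftrightarrow>
     (\<forall>x t. ((\<lambda>y. \<phi> y t) has_real_derivative \<phi>x x t) (at x)) \<and>
     (\<forall>x t. ((\<lambda>s. \<phi> x s) has_real_derivative \<phi>t x t) (at t)) \<and>
     continuous_on UNIV (\<lambda>(x, t). \<phi> x t) \<and>
     continuous_on UNIV (\<lambda>(x, t). \<phi>x x t) \<and>
     continuous_on UNIV (\<lambda>(x, t). \<phi>t x t) \<and>
     (\<exists>K. compact K \<and> K \<subseteq> {p. snd p < T} \<and> (\<forall>x t. (x, t) \<notin> K \<longrightarrow> \<phi> x t = 0))"

text \<open>w solves the generalized De Gregorio equation  w_t + a u w_x = u_x w, u_x = H w,
  for t < T (with the normalisation u(0,t) = 0), in the weak/distributional sense: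
  for every test function phi,
    int int ( w phi_t + a u w phi_x + (1+a) u_x w phi ) dx dt = 0,
  which is obtained from the equation by writing u w_x = (u w)_x - u_x w.\<close>
definition gDG_solution :: "real \<Rightarrow> real \<Rightarrow> (real \<Rightarrow> real \<Rightarrow> real) \<Rightarrow> bool" where
  "gDG_solution a T w \<longleftrightarrow>
     (\<exists>h u :: real \<Rightarrow> real \<Rightarrow> real.
        (\<forall>t < T. \<forall>x. has_hilbert (\<lambda>y. w y t) x (h x t)) \<and>
        (\<forall>t < T. u 0 t = 0 \<and> (\<forall>x. ((\<lambda>y. u y t) has_real_derivative h x t) (at x))) \<and>
        (\<forall>\<phi> \<phi>x \<phi>t. test_fun T \<phi> \<phi>x \<phi>t \<longrightarrow>
           ((\<lambda>(x, t). w x t * \<phi>t x t + a * u x t * w x t * \<phi>x x t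
                       + (1 + a) * h x t * w x t * \<phi> x t) has_integral 0) UNIV))"

end

theory Submission
  imports Defs "HOL-Complex_Analysis.Complex_Analysis"
begin

text \<open>
  For \<open>a = 0\<close> the function \<open>F = Hw - iw\<close> is the boundary value of a holomorphic function on the upper
  half plane and the profile equation becomes \<open>F + F' - F\<^sup>2/2 = 0\<close> in the variable \<open>s = \<beta> log (x/i)\<close>, with
  \<open>1 + \<lambda> = 1/\<beta>\<close>; it is solved by \<open>2 / (1 + exp s)\<close>. Keeping \<open>\<lambda>\<close> fixed, the profile for \<open>a \<noteq> 0\<close> is sought as a
  power series in \<open>a\<close> about this solution. The linearisation \<open>f' + tanh (s/2) f\<close> is inverted explicitly.
  The transport term enters through a function \<open>N\<close> whose jump across the strip \<open>|Im s| < \<pi>\<beta>/2\<close> is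
  prescribed. In spaces of holomorphic functions on a slightly wider strip it is bounded by moving
  contours, without any theory of singular integrals, and its norm is \<open>O(\<beta>)\<close> because differences across
  a strip of width \<open>O(\<beta>)\<close> gain a factor \<open>\<beta>\<close>. Hence the series converges for \<open>|a\<alpha>| < c\<close>, uniformly in \<open>\<alpha>\<close>,
  and \<open>\<beta> = 4\<alpha>/3\<close> leaves enough room for the profiles to be \<open>C\<^sup>\<alpha>\<close>.
\<close>

section \<open>Line integrals in a strip\<close>

text \<open>The exponent \<lambda> can stay fixed because the linearisation has no solvability
  condition. Its coefficient tanh (s/2) tends to 1 on the right and to -1 on the left, so the
  homogeneous solution \<open>kap\<close> decays at both ends and every source in the weighted
  classes is reached. This solution is a multiple of the s-derivative of \<open>Z0\<close>, the
  infinitesimal dilation of x; the normalisation f(0) = 0 removes it. The obstacle is a loss of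
  derivatives in the transport term. One comes from w_x, another is spent on estimating a difference
  across the strip by its width, so bounds for g = \<open>gop F G\<close> and g' cost two
  derivatives of G. \<open>Nop\<close> bounds N and N' by g and g', and the linearised equation
  returns one derivative more than its source has (\<open>bnd1\<close> to \<open>bnd2\<close>),
  which closes the loop. In powers of \<beta>: g is of order 2, g' of order 1, and the kernel costs
  one power on g only, so N is of order 1. The decay rate 3/4 stays strictly below the rate 1 of
  \<open>kap\<close>, so that integrating against its reciprocal loses no factor |Re s|.\<close>

lemma parametric_integral_has_field_derivative:
  fixes \<phi> :: "complex \<Rightarrow> 'b \<Rightarrow> complex"
  assumes S: "open S" "z \<in> S"
    and hol: "\<And>r. r \<in> space M \<Longrightarrow> (\<lambda>z. \<phi> z r) holomorphic_on S"
    and meas: "\<And>z. z \<in> S \<Longrightarrow> \<phi> z \<in> borel_measurable M"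
    and bd: "\<And>z r. z \<in> S \<Longrightarrow> r \<in> space M \<Longrightarrow> norm (\<phi> z r) \<le> B r"
    and B: "integrable M B"
  shows "((\<lambda>z. \<integral>r. \<phi> z r \<partial>M) has_field_derivative (\<integral>r. deriv (\<lambda>z. \<phi> z r) z \<partial>M)) (at z)"
proof -
  obtain e where e: "e > 0" "cball z e \<subseteq> S"
    using S open_contains_cball by blast
  define d where "d = e / 2"
  have d: "d > 0" using e by (simp add: d_def)
  have sub: "cball x d \<subseteq> S" if "x \<in> ball z d" for x
  proof
    fix y assume "y \<in> cball x d"
    then have "dist z y \<le> dist z x + dist x y" "dist x y \<le> d" "dist z x < d"
      using that by (auto intro: dist_triangle)
    then have "dist z y \<le> e" by (simp add: d_def)
    then show "y \<in> S" using e(2) by auto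
  qed
  have bsub: "ball z d \<subseteq> S"
    using sub by (meson centre_in_cball d dual_order.refl order_less_imp_le subset_iff)
  \<comment> \<open>Only \<phi> itself is dominated. Cauchy's inequality on discs of radius
    \<open>d\<close>, which stay in \<open>S\<close> because \<open>d\<close> is half of
    \<open>e\<close>, converts the dominating function into one for the derivative and hence for the
    difference quotients.\<close>
  have derb: "norm (deriv (\<lambda>z. \<phi> z r) x) \<le> B r / d" if x: "x \<in> ball z d" and r: "r \<in> space M" for x r
  proof -
    have h: "(\<lambda>z. \<phi> z r) holomorphic_on cball x d"
      using hol[OF r] sub[OF x] holomorphic_on_subset by blast
    have "norm ((deriv ^^ 1) (\<lambda>z. \<phi> z r) x) \<le> fact 1 * B r / d ^ 1"
    proof (rule Cauchy_inequality)
      show "(\<lambda>z. \<phi> z r) holomorphic_on ball x d"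
        using h ball_subset_cball holomorphic_on_subset by blast
      show "continuous_on (cball x d) (\<lambda>z. \<phi> z r)"
        by (rule holomorphic_on_imp_continuous_on[OF h])
      fix y assume "norm (x - y) = d"
      then have "y \<in> cball x d" by (simp add: dist_norm)
      then show "norm (\<phi> y r) \<le> B r" using sub[OF x] bd r by blast
    qed (use d in auto)
    then show ?thesis by simp
  qed
  have quot: "norm ((\<phi> w r - \<phi> z r) / (w - z)) \<le> B r / d"
    if w: "w \<in> ball z d" "w \<noteq> z" and r: "r \<in> space M" for w r
  proof -
    have "norm (\<phi> w r - \<phi> z r) \<le> B r / d * norm (w - z)"
    proof (rule field_differentiable_bound[where S="ball z d" and f' = "deriv (\<lambda>z. \<phi> z r)"])
      fix x assume x: "x \<in> ball z d"
      have "((\<lambda>z. \<phi> z r) has_field_derivative deriv (\<lambda>z. \<phi> z r) x) (at x)"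
        using holomorphic_derivI[OF hol[OF r] S(1)] x bsub by blast
      then show "((\<lambda>z. \<phi> z r) has_field_derivative deriv (\<lambda>z. \<phi> z r) x) (at x within ball z d)"
        by (rule has_field_derivative_at_within)
      show "norm (deriv (\<lambda>z. \<phi> z r) x) \<le> B r / d" by (rule derb[OF x r])
    qed (use w d in auto)
    then show ?thesis using w by (simp add: norm_divide field_simps)
  qed
  have lim: "((\<lambda>w. (\<phi> w r - \<phi> z r) / (w - z)) \<longlongrightarrow> deriv (\<lambda>z. \<phi> z r) z) (at z)"
    if r: "r \<in> space M" for r
    using holomorphic_derivI[OF hol[OF r] S(1) S(2)] by (simp add: has_field_derivative_iff)
  have Bd: "integrable M (\<lambda>r. B r / d)" using B by simp
  have phii: "integrable M (\<phi> x)" if "x \<in> S" for x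
  proof (rule Bochner_Integration.integrable_bound[OF B meas[OF that]])
    show "AE r in M. norm (\<phi> x r) \<le> norm (B r)"
      using bd[OF that] by (intro AE_I2) (force intro: order_trans[OF _ abs_ge_self])
  qed
  have seq: "(\<lambda>n. \<integral>r. (\<phi> (X n) r - \<phi> z r) / (X n - z) \<partial>M) \<longlonglongrightarrow> (\<integral>r. deriv (\<lambda>z. \<phi> z r) z \<partial>M)"
    if X: "\<And>n. X n \<in> ball z d" "\<And>n. X n \<noteq> z" "X \<longlonglongrightarrow> z" for X
  proof -
    have at: "filterlim X (at z) sequentially"
      using X by (simp add: filterlim_at)
    have m1: "(\<lambda>r. (\<phi> (X n) r - \<phi> z r) / (X n - z)) \<in> borel_measurable M" for n
      using meas[of "X n"] meas[OF S(2)] X(1)[of n] bsub by (intro measurable) auto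
    have l1: "(\<lambda>n. (\<phi> (X n) r - \<phi> z r) / (X n - z)) \<longlonglongrightarrow> deriv (\<lambda>z. \<phi> z r) z"
      if "r \<in> space M" for r
      using filterlim_compose[OF lim[OF that] at] .
    have m2: "(\<lambda>r. deriv (\<lambda>z. \<phi> z r) z) \<in> borel_measurable M"
      by (rule borel_measurable_LIMSEQ_metric[OF m1 l1])
    show ?thesis
      by (rule integral_dominated_convergence[OF m2 m1 Bd]) (auto intro!: l1 quot X)
  qed
  show "((\<lambda>z. \<integral>r. \<phi> z r \<partial>M) has_field_derivative (\<integral>r. deriv (\<lambda>z. \<phi> z r) z \<partial>M)) (at z)"
    unfolding has_field_derivative_iff tendsto_at_iff_sequentially
  proof (intro allI impI)
    fix X assume X: "\<forall>i. X i \<in> UNIV - {z}" "X \<longlonglongrightarrow> z"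
    have "eventually (\<lambda>n. X n \<in> ball z d) sequentially"
      using X(2) d by (simp add: tendsto_iff dist_commute)
    then obtain N where N: "\<And>n. n \<ge> N \<Longrightarrow> X n \<in> ball z d" by (auto simp: eventually_sequentially)
    have "(\<lambda>n. \<integral>r. (\<phi> (X (n + N)) r - \<phi> z r) / (X (n + N) - z) \<partial>M) \<longlonglongrightarrow> (\<integral>r. deriv (\<lambda>z. \<phi> z r) z \<partial>M)"
      using seq[of "\<lambda>n. X (n + N)"] N X by (auto intro: LIMSEQ_ignore_initial_segment)
    moreover have "(\<integral>r. (\<phi> (X (n + N)) r - \<phi> z r) / (X (n + N) - z) \<partial>M)
        = ((\<integral>r. \<phi> (X (n + N)) r \<partial>M) - (\<integral>r. \<phi> z r \<partial>M)) / (X (n + N) - z)" for n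
      using phii[of "X (n+N)"] phii[OF S(2)] N[of "n+N"] bsub
      by (simp add: Bochner_Integration.integral_diff subset_iff)
    ultimately show "((\<lambda>w. ((\<integral>r. \<phi> w r \<partial>M) - (\<integral>r. \<phi> z r \<partial>M)) / (w - z)) \<circ> X) \<longlonglongrightarrow> (\<integral>r. deriv (\<lambda>z. \<phi> z r) z \<partial>M)"
      by - (rule LIMSEQ_offset[where k=N], simp only: o_def)
  qed
qed

definition cstrip :: "real \<Rightarrow> real \<Rightarrow> complex set" where
  "cstrip a b = {z. a < Im z \<and> Im z < b}"

lemma open_cstrip [simp]: "open (cstrip a b)"
proof -
  have "cstrip a b = {z. a < Im z} \<inter> {z. Im z < b}" by (auto simp: cstrip_def)
  then show ?thesis by (simp add: open_halfspace_Im_gt open_halfspace_Im_lt open_Int)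
qed

lemma convex_cstrip [simp]: "convex (cstrip a b)"
proof -
  have "cstrip a b = {z. a < Im z} \<inter> {z. Im z < b}" by (auto simp: cstrip_def)
  then show ?thesis by (simp add: convex_halfspace_Im_gt convex_halfspace_Im_lt convex_Int)
qed

lemma has_bochner_integral_exp_neg_abs:
  fixes k x :: real assumes "k > 0"
  shows "has_bochner_integral lborel (\<lambda>r. exp (- k * \<bar>r - x\<bar>)) (2 / k)"
proof -
  define f where "f = (\<lambda>r::real. indicator {0..} r * exp (- k * r))"
  have f: "has_bochner_integral lborel f (1/k)"
  proof -
    have hi: "((\<lambda>r. exp (-k*r)) has_integral (1/k)) {0..}"
      using has_integral_exp_minus_to_infinity[OF assms, of 0] by simp
    have fm: "f \<in> borel_measurable lborel" unfolding f_def by measurable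
    have hf: "(f has_integral (1/k)) UNIV"
    proof -
      have "f = (\<lambda>x. if x \<in> {0..} then exp (- k * x) else 0)" by (auto simp: f_def fun_eq_iff)
      then show ?thesis using hi has_integral_restrict_UNIV[of "{0..}" "\<lambda>r. exp (-k*r)"] by simp
    qed
    have "f absolutely_integrable_on UNIV"
      by (rule nonnegative_absolutely_integrable_1) (use hf in \<open>auto simp: f_def\<close>)
    then have "integrable lebesgue f" by (simp add: set_integrable_def)
    then have i: "integrable lborel f" using integrable_completion[OF fm] by simp
    have "(\<integral>r. f r \<partial>lborel) = 1/k"
      using has_integral_integral_lborel[OF i] hf has_integral_unique by blast
    with i show ?thesis by (simp add: has_bochner_integral_iff)
  qed
  have g: "has_bochner_integral lborel (\<lambda>r. f (0 + (-1) * r)) (1/k)"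
    using f lborel_has_bochner_integral_real_affine_iff[of "-1" f "1/k" 0] by simp
  have s: "has_bochner_integral lborel (\<lambda>r. f r + f (- r)) (2/k)"
    using has_bochner_integral_add[OF f g] by (simp add: field_simps)
  have "has_bochner_integral lborel (\<lambda>r. exp (- k * \<bar>r\<bar>)) (2 / k)"
  proof (subst has_bochner_integral_cong_AE)
    show "AE r in lborel. exp (- k * \<bar>r\<bar>) = f r + f (- r)"
      using AE_lborel_singleton[of "0::real"] by eventually_elim (auto simp: f_def indicator_def)
  qed (use s in \<open>auto simp: f_def\<close>)
  then show ?thesis
    using lborel_has_bochner_integral_real_affine_iff[of 1 "\<lambda>r. exp (- k * \<bar>r\<bar>)" "2/k" "-x"]
    by simp
qed

lemmas integrable_exp_neg_abs = has_bochner_integral_exp_neg_abs[THEN has_bochner_integral_iff[THEN iffD1], THEN conjunct1]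

text \<open>Instead of Cauchy's theorem: the integral over the line through \<open>z\<close> is holomorphic in \<open>z\<close>
  and invariant under real translations, so its derivative vanishes.\<close>

lemma line_integral_shift:
  fixes G :: "complex \<Rightarrow> complex"
  assumes hol: "G holomorphic_on cstrip a b" and k: "k > 0"
    and bd: "\<And>a' b'. a < a' \<Longrightarrow> b' < b \<Longrightarrow>
               \<exists>C R. \<forall>w. a' \<le> Im w \<and> Im w \<le> b' \<and> R \<le> \<bar>Re w\<bar> \<longrightarrow> norm (G w) \<le> C * exp (- k * \<bar>Re w\<bar>)"
    and t: "a < t1" "t1 < b" "a < t2" "t2 < b"
  shows "(\<integral>r. G (Complex r t1) \<partial>lborel) = (\<integral>r. G (Complex r t2) \<partial>lborel)"
proof -
  have cont: "continuous_on (cstrip a b) G" by (rule holomorphic_on_imp_continuous_on[OF hol])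
  \<comment> \<open>The hypothesis controls \<open>G\<close> only far out; a compact box covers the
    rest, at the price of a factor exp (k |R|) in the constant.\<close>
  have bd': "\<exists>C. C \<ge> 0 \<and> (\<forall>w. a' \<le> Im w \<and> Im w \<le> b' \<longrightarrow> norm (G w) \<le> C * exp (- k * \<bar>Re w\<bar>))"
    if ab: "a < a'" "b' < b" for a' b'
  proof -
    obtain C R where CR: "\<And>w. a' \<le> Im w \<Longrightarrow> Im w \<le> b' \<Longrightarrow> R \<le> \<bar>Re w\<bar> \<Longrightarrow> norm (G w) \<le> C * exp (- k * \<bar>Re w\<bar>)"
      using bd[OF ab] by blast
    have "compact (cbox (Complex (-R) a') (Complex R b'))" by simp
    moreover have sub: "cbox (Complex (-R) a') (Complex R b') \<subseteq> cstrip a b"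
      using ab by (auto simp: in_cbox_complex_iff cstrip_def)
    ultimately have "bounded (G ` cbox (Complex (-R) a') (Complex R b'))"
      by (meson compact_continuous_image compact_imp_bounded cont continuous_on_subset)
    then obtain D where D: "\<And>w. w \<in> cbox (Complex (-R) a') (Complex R b') \<Longrightarrow> norm (G w) \<le> D"
      by (auto simp: bounded_iff)
    define C' where "C' = max \<bar>C\<bar> (\<bar>D\<bar> * exp (k * \<bar>R\<bar>))"
    have "norm (G w) \<le> C' * exp (- k * \<bar>Re w\<bar>)" if w: "a' \<le> Im w" "Im w \<le> b'" for w
    proof (cases "R \<le> \<bar>Re w\<bar>")
      case True
      have "norm (G w) \<le> C * exp (- k * \<bar>Re w\<bar>)" using CR w True by blast
      also have "\<dots> \<le> C' * exp (- k * \<bar>Re w\<bar>)" by (intro mult_right_mono) (auto simp: C'_def)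
      finally show ?thesis .
    next
      case False
      then have "w \<in> cbox (Complex (-R) a') (Complex R b')" using w by (auto simp: in_cbox_complex_iff)
      then have "norm (G w) \<le> \<bar>D\<bar>" using D by force
      also have "\<dots> \<le> \<bar>D\<bar> * exp (k * \<bar>R\<bar>) * exp (- k * \<bar>Re w\<bar>)"
      proof -
        have "k * \<bar>R\<bar> - k * \<bar>Re w\<bar> \<ge> 0" using False k by (simp add: mult_left_mono)
        then have "1 \<le> exp (k * \<bar>R\<bar> - k * \<bar>Re w\<bar>)" by simp
        then have "1 \<le> exp (k * \<bar>R\<bar>) * exp (- k * \<bar>Re w\<bar>)" by (simp add: exp_diff exp_minus field_simps)
        then show ?thesis by (metis abs_ge_zero mult.assoc mult.right_neutral mult_left_mono)
      qed
      also have "\<dots> \<le> C' * exp (- k * \<bar>Re w\<bar>)" by (intro mult_right_mono) (auto simp: C'_def)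
      finally show ?thesis .
    qed
    moreover have "C' \<ge> 0" by (simp add: C'_def)
    ultimately show ?thesis by blast
  qed
  define J where "J = (\<lambda>z. \<integral>r. G (z + of_real r) \<partial>lborel)"
  have J0: "J (z + of_real c) = J z" for z c
    using lborel_integral_real_affine[of 1 "\<lambda>r. G (z + of_real r)" c]
    by (simp add: J_def algebra_simps)
  have der: "\<exists>D. (J has_field_derivative D) (at z)" if z: "z \<in> cstrip a b" for z
  proof -
    have "a < Im z" "Im z < b" using z by (auto simp: cstrip_def)
    then obtain a' b' where ab: "a < a'" "a' < Im z" "Im z < b'" "b' < b"
      using dense[of a "Im z"] dense[of "Im z" b] by auto
    obtain C where C: "C \<ge> 0" "\<And>w. a' \<le> Im w \<Longrightarrow> Im w \<le> b' \<Longrightarrow> norm (G w) \<le> C * exp (- k * \<bar>Re w\<bar>)"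
      using bd'[OF ab(1,4)] by blast
    define S where "S = cstrip a' b' \<inter> {w. Re z - 1 < Re w} \<inter> {w. Re w < Re z + 1}"
    have "(J has_field_derivative (\<integral>r. deriv (\<lambda>z. G (z + of_real r)) z \<partial>lborel)) (at z)"
      unfolding J_def
    proof (rule parametric_integral_has_field_derivative[where S = S and B="\<lambda>r. C * exp k * exp (- k * \<bar>r - (- Re z)\<bar>)"])
      show "open S" unfolding S_def
        by (intro open_Int open_cstrip open_halfspace_Re_gt open_halfspace_Re_lt)
      show "z \<in> S" using ab by (auto simp: S_def cstrip_def)
      have inS: "w + of_real r \<in> cstrip a b" if "w \<in> S" for w r
        using that ab by (auto simp: S_def cstrip_def)
      show "(\<lambda>w. G (w + of_real r)) holomorphic_on S" for r
        by (intro holomorphic_on_compose_gen[OF _ hol, unfolded o_def] holomorphic_intros) (use inS in auto)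
      show "(\<lambda>r. G (w + of_real r)) \<in> borel_measurable lborel" if "w \<in> S" for w
      proof -
        have "continuous_on UNIV (\<lambda>r. G (w + complex_of_real r))"
          by (rule continuous_on_compose2[OF cont]) (use inS[OF that] in \<open>auto intro!: continuous_intros\<close>)
        then show ?thesis by (simp add: borel_measurable_continuous_onI)
      qed
      show "norm (G (w + of_real r)) \<le> C * exp k * exp (- k * \<bar>r - (- Re z)\<bar>)" if w: "w \<in> S" for w r
      proof -
        have "norm (G (w + of_real r)) \<le> C * exp (- k * \<bar>Re (w + of_real r)\<bar>)"
          using w by (intro C) (auto simp: S_def cstrip_def)
        also have "\<dots> \<le> C * exp (k - k * \<bar>r - (- Re z)\<bar>)"
        proof (intro mult_left_mono C)
          have "\<bar>r - (- Re z)\<bar> \<le> 1 + \<bar>Re (w + of_real r)\<bar>" using w by (auto simp: S_def)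
          then have "k * \<bar>r - (- Re z)\<bar> \<le> k * (1 + \<bar>Re (w + of_real r)\<bar>)" using k by (intro mult_left_mono) auto
          then show "exp (- k * \<bar>Re (w + of_real r)\<bar>) \<le> exp (k - k * \<bar>r - (- Re z)\<bar>)" by (simp add: algebra_simps)
        qed
        finally show ?thesis by (simp add: exp_diff exp_minus field_simps)
      qed
      show "integrable lborel (\<lambda>r. C * exp k * exp (- k * \<bar>r - (- Re z)\<bar>))"
        by (intro integrable_mult_right integrable_exp_neg_abs[OF k])
    qed
    then show ?thesis by blast
  qed
  have der0: "(J has_field_derivative 0) (at z)" if z: "z \<in> cstrip a b" for z
  proof -
    obtain D where D: "(J has_field_derivative D) (at z)" using der[OF z] by blast
    have "filterlim (\<lambda>n. z + of_real (1 / real (Suc n))) (at z) sequentially"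
    proof -
      have "(\<lambda>n. z + of_real (1 / real (Suc n))) \<longlonglongrightarrow> z + of_real 0"
        using LIMSEQ_inverse_real_of_nat by (intro tendsto_intros) (simp add: inverse_eq_divide)
      then show ?thesis by (simp add: filterlim_at del: of_nat_Suc)
    qed
    from filterlim_compose[OF D[unfolded has_field_derivative_iff] this]
    have "(\<lambda>n. 0) \<longlonglongrightarrow> D" by (simp add: J0 del: of_real_divide)
    then have "D = 0" by (simp add: LIMSEQ_const_iff)
    with D show ?thesis by simp
  qed
  have "\<exists>c. \<forall>z\<in>cstrip a b. J z = c"
    by (rule has_field_derivative_zero_constant[OF convex_cstrip]) (use der0 in \<open>auto intro: has_field_derivative_at_within\<close>)
  then have "J (Complex 0 t1) = J (Complex 0 t2)" using t by (auto simp: cstrip_def)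
  moreover have "J (Complex 0 t) = (\<integral>r. G (Complex r t) \<partial>lborel)" for t
    by (simp add: J_def complex_eq_iff Complex_eq add.commute)
  ultimately show ?thesis by simp
qed

lemma integrable_exp_decay:
  fixes f :: "real \<Rightarrow> complex"
  assumes c: "continuous_on UNIV f" and k: "k > 0"
    and bd: "\<And>r. R \<le> \<bar>r\<bar> \<Longrightarrow> norm (f r) \<le> C * exp (- k * \<bar>r\<bar>)"
  shows "integrable lborel f"
proof -
  have "bounded (f ` {-R..R})"
    by (intro compact_imp_bounded compact_continuous_image continuous_on_subset[OF c]) auto
  then obtain D where "\<forall>x\<in>f ` {-R..R}. norm x \<le> D" unfolding bounded_iff by blast
  then have D: "\<And>r. r \<in> {-R..R} \<Longrightarrow> norm (f r) \<le> D" by blast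
  show ?thesis
  proof (rule Bochner_Integration.integrable_bound)
    show "integrable lborel (\<lambda>r. \<bar>C\<bar> * exp (- k * \<bar>r - 0\<bar>) + \<bar>D\<bar> * exp (k * \<bar>R\<bar>) * exp (- k * \<bar>r - 0\<bar>))"
      by (intro Bochner_Integration.integrable_add integrable_mult_right integrable_exp_neg_abs k)
    show "f \<in> borel_measurable lborel" using c by (simp add: borel_measurable_continuous_onI)
    have "norm (f r) \<le> \<bar>C\<bar> * exp (- k * \<bar>r - 0\<bar>) + \<bar>D\<bar> * exp (k * \<bar>R\<bar>) * exp (- k * \<bar>r - 0\<bar>)" for r
    proof (cases "R \<le> \<bar>r\<bar>")
      case True
      have "norm (f r) \<le> C * exp (- k * \<bar>r\<bar>)" using bd True by blast
      also have "\<dots> \<le> \<bar>C\<bar> * exp (- k * \<bar>r\<bar>)" by (intro mult_right_mono) auto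
      finally show ?thesis by (simp add: add_increasing2)
    next
      case False
      then have "r \<in> {-R..R}" by auto
      then have "norm (f r) \<le> \<bar>D\<bar>" using D[of r] by linarith
      also have "\<dots> \<le> \<bar>D\<bar> * exp (k * \<bar>R\<bar>) * exp (- k * \<bar>r\<bar>)"
      proof -
        have "k * \<bar>R\<bar> - k * \<bar>r\<bar> \<ge> 0" using False k by (simp add: mult_left_mono)
        then have "1 \<le> exp (k * \<bar>R\<bar> - k * \<bar>r\<bar>)" by simp
        then have "1 \<le> exp (k * \<bar>R\<bar>) * exp (- k * \<bar>r\<bar>)" by (simp add: exp_diff exp_minus field_simps)
        then show ?thesis by (metis abs_ge_zero mult.assoc mult.right_neutral mult_left_mono)
      qed
      finally show ?thesis by (simp add: add_increasing)
    qed
    then show "AE r in lborel. norm (f r) \<le> norm (\<bar>C\<bar> * exp (- k * \<bar>r - 0\<bar>) + \<bar>D\<bar> * exp (k * \<bar>R\<bar>) * exp (- k * \<bar>r - 0\<bar>))"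
      by (intro AE_I2) (metis abs_ge_self order_trans real_norm_def)
  qed
qed

section \<open>Integrals of 1/sinh on horizontal lines and the residue formula in a strip\<close>

lemma has_bochner_integral_inverse_cosh:
  "has_bochner_integral lborel (\<lambda>r::real. 1 / cosh r) pi"
proof -
  have d: "DERIV (\<lambda>r. 2 * arctan (exp r)) x :> 1 / cosh x" for x :: real
  proof -
    have "exp x + inverse (exp x) = (1 + (exp x)\<^sup>2) * inverse (exp x)"
      by (simp add: field_simps power2_eq_square)
    then have "2 * (inverse (1 + (exp x)\<^sup>2) * exp x) = 1 / cosh x"
      by (simp add: cosh_def exp_minus field_simps)
    then show ?thesis by (auto intro!: derivative_eq_intros)
  qed
  have c: "isCont (\<lambda>r. 1 / cosh r) x" for x :: real by (intro continuous_intros) auto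
  have l1: "(((\<lambda>r. 2 * arctan (exp r)) \<circ> real_of_ereal) \<longlongrightarrow> 0) (at_right (- \<infinity>))"
    unfolding ereal_tendsto_simps by real_asymp
  have l2: "(((\<lambda>r. 2 * arctan (exp r)) \<circ> real_of_ereal) \<longlongrightarrow> pi) (at_left \<infinity>)"
    unfolding ereal_tendsto_simps by real_asymp
  note FTC = interval_integral_FTC_nonneg[OF _ d c _ l1 l2]
  have "set_integrable lborel (einterval (-\<infinity>) \<infinity>) (\<lambda>r::real. 1 / cosh r)"
    "(LBINT x=-\<infinity>..\<infinity>. 1 / cosh x) = pi"
    using FTC by auto
  then show ?thesis
    by (simp add: has_bochner_integral_iff set_integrable_def interval_lebesgue_integral_def set_lebesgue_integral_def einterval_def)
qed

lemma cmod_sinh_ge: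
  assumes "1 \<le> \<bar>Re v\<bar>"
  shows "norm (sinh v) \<ge> exp \<bar>Re v\<bar> / 4"
proof -
  have e: "\<bar>exp (Re v) - exp (- Re v)\<bar> \<le> 2 * norm (sinh v)"
  proof -
    have "2 * sinh v = exp v - exp (- v)" by (simp add: sinh_def scaleR_conv_of_real)
    then have "2 * norm (sinh v) = norm (exp v - exp (-v))" by (metis norm_mult norm_numeral)
    then show ?thesis using norm_triangle_ineq3[of "exp v" "exp (-v)"] by simp
  qed
  have "exp \<bar>Re v\<bar> / 2 \<le> \<bar>exp (Re v) - exp (- Re v)\<bar>"
  proof -
    define x where "x = \<bar>Re v\<bar>"
    have x: "1 \<le> x" using assms by (simp add: x_def)
    have "2 \<le> exp x" using exp_ge_add_one_self[of x] x by linarith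
    moreover have "exp (- x) \<le> 1" using x by simp
    ultimately have "exp x / 2 \<le> exp x - exp (- x)" by linarith
    then show ?thesis unfolding x_def by (cases "Re v \<ge> 0") auto
  qed
  with e show ?thesis by simp
qed

lemma sinh_complex_nonzero:
  assumes "0 < \<bar>Im v\<bar>" "\<bar>Im v\<bar> < pi" shows "sinh v \<noteq> 0"
proof
  assume "sinh v = 0"
  then have "exp v = exp (- v)" by (simp add: sinh_def)
  then have "exp (2 * v) = 1" by (metis exp_add exp_minus_inverse mult_2)
  then obtain n :: int where "Im (2 * v) = of_int (2 * n) * pi" by (auto simp: exp_eq_1)
  then have "Im v = of_int n * pi" by simp
  with assms have "n \<noteq> 0" "\<bar>real_of_int n\<bar> * pi < pi" by (auto simp: abs_mult)
  then have "1 \<le> \<bar>real_of_int n\<bar>" by linarith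
  then have "1 * pi \<le> \<bar>real_of_int n\<bar> * pi" by (intro mult_right_mono) auto
  with \<open>\<bar>real_of_int n\<bar> * pi < pi\<close> show False by simp
qed

text \<open>The zeros of sinh (2 w / \<beta>) lie at heights that are multiples of pi \<beta> / 2,
  so a line strictly between the first two may be moved to the middle, where sinh (x + i pi / 2) = i
  cosh x reduces the integral to that of 1/cosh.\<close>

lemma integral_inverse_sinh_line:
  assumes b: "\<beta> > 0" and c: "0 < c" "c < pi * \<beta> / 2"
  shows "(\<integral>r. 1 / sinh (2 * Complex r c / of_real \<beta>) \<partial>lborel) = - \<i> * pi * \<beta> / 2"
proof -
  have "(\<integral>r. 1 / sinh (2 * Complex r c / of_real \<beta>) \<partial>lborel) = (\<integral>r. 1 / sinh (2 * Complex r (pi * \<beta> / 4) / of_real \<beta>) \<partial>lborel)"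
  proof (rule line_integral_shift[where a = 0 and b = "pi * \<beta> / 2" and k = "2 / \<beta>"])
    show "(\<lambda>w. 1 / sinh (2 * w / of_real \<beta>)) holomorphic_on cstrip 0 (pi * \<beta> / 2)"
    proof (intro holomorphic_intros)
      fix z assume z: "z \<in> cstrip 0 (pi * \<beta> / 2)"
      show "sinh (2 * z / complex_of_real \<beta>) \<noteq> 0"
        by (rule sinh_complex_nonzero) (use z b in \<open>auto simp: cstrip_def field_simps\<close>)
    qed (use b in \<open>auto simp: sinh_def[abs_def] intro!: holomorphic_intros\<close>)
    have "norm (1 / sinh (2 * w / of_real \<beta>)) \<le> 4 * exp (- (2 / \<beta>) * \<bar>Re w\<bar>)" if "\<beta> \<le> \<bar>Re w\<bar>" for w
    proof -
      have r: "\<bar>Re (2 * w / of_real \<beta>)\<bar> = 2 / \<beta> * \<bar>Re w\<bar>" using b by (simp add: abs_mult)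
      have "1 \<le> \<bar>Re (2 * w / of_real \<beta>)\<bar>" unfolding r using that b by (simp add: field_simps)
      from cmod_sinh_ge[OF this] have "exp (2 / \<beta> * \<bar>Re w\<bar>) / 4 \<le> norm (sinh (2 * w / of_real \<beta>))" unfolding r .
      then have "1 / norm (sinh (2 * w / of_real \<beta>)) \<le> 1 / (exp (2 / \<beta> * \<bar>Re w\<bar>) / 4)"
        by (intro divide_left_mono mult_pos_pos) (auto intro: less_le_trans[rotated])
      then show ?thesis by (simp add: norm_divide exp_minus field_simps)
    qed
    then show "\<exists>C R. \<forall>w. a' \<le> Im w \<and> Im w \<le> b' \<and> R \<le> \<bar>Re w\<bar> \<longrightarrow> norm (1 / sinh (2 * w / of_real \<beta>)) \<le> C * exp (- (2 / \<beta>) * \<bar>Re w\<bar>)" for a' b'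
      by blast
  qed (use b c in auto)
  also have "\<dots> = (\<integral>r. - \<i> * complex_of_real (1 / cosh (0 + (2 / \<beta>) * r)) \<partial>lborel)"
  proof (rule Bochner_Integration.integral_cong[OF refl])
    fix r
    have eq: "2 * Complex r (pi * \<beta> / 4) / of_real \<beta> = of_real (2 / \<beta> * r) + \<i> * (pi / 2)"
      using b by (simp add: complex_eq_iff)
    have "sinh (2 * Complex r (pi * \<beta> / 4) / of_real \<beta>) = \<i> * of_real (cosh (2 / \<beta> * r))"
    proof -
      have i: "exp (\<i> * (pi / 2)) = \<i>" using cis_conv_exp[of "pi/2"] by simp
      have "exp (of_real (2 / \<beta> * r) + \<i> * (pi / 2)) = of_real (exp (2 / \<beta> * r)) * \<i>"
        unfolding exp_add i by (simp only: exp_of_real)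
      moreover have "exp (- (of_real (2 / \<beta> * r) + \<i> * (pi / 2))) = - (of_real (exp (- (2 / \<beta> * r))) * \<i>)"
        unfolding exp_minus calculation by (simp add: field_simps)
      ultimately show ?thesis unfolding eq sinh_def cosh_def
        by (simp add: scaleR_conv_of_real algebra_simps)
    qed
    then show "1 / sinh (2 * Complex r (pi * \<beta> / 4) / of_real \<beta>) = - \<i> * complex_of_real (1 / cosh (0 + (2 / \<beta>) * r))"
      by (simp add: field_simps)
  qed
  also have "\<dots> = - \<i> * complex_of_real (\<integral>r. 1 / cosh (0 + (2 / \<beta>) * r) \<partial>lborel)"
    by (simp only: integral_mult_right_zero integral_complex_of_real)
  also have "(\<integral>r. 1 / cosh (0 + (2 / \<beta>) * r) \<partial>lborel) = pi * \<beta> / 2"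
    using has_bochner_integral_inverse_cosh lborel_has_bochner_integral_real_affine_iff[of "2/\<beta>" "\<lambda>r. 1 / cosh r" pi 0] b
    by (auto simp: has_bochner_integral_iff)
  finally show ?thesis by simp
qed

lemma integral_inverse_sinh_line_neg:
  assumes b: "\<beta> > 0" and c: "- (pi * \<beta> / 2) < c" "c < 0"
  shows "(\<integral>r. 1 / sinh (2 * Complex r c / of_real \<beta>) \<partial>lborel) = \<i> * pi * \<beta> / 2"
proof -
  have "(\<integral>r. 1 / sinh (2 * Complex r c / of_real \<beta>) \<partial>lborel)
      = (\<integral>r. 1 / sinh (2 * Complex (0 + (-1) * r) c / of_real \<beta>) \<partial>lborel)"
    using lborel_integral_real_affine[of "-1" "\<lambda>r. 1 / sinh (2 * Complex r c / of_real \<beta>)" 0] by simp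
  also have "\<dots> = (\<integral>r. - (1 / sinh (2 * Complex r (- c) / of_real \<beta>)) \<partial>lborel)"
  proof (rule Bochner_Integration.integral_cong[OF refl])
    fix r
    have "2 * Complex (0 + (-1) * r) c / of_real \<beta> = - (2 * Complex r (- c) / of_real \<beta>)"
      by (simp add: complex_eq_iff)
    then show "1 / sinh (2 * Complex (0 + (-1) * r) c / of_real \<beta>) = - (1 / sinh (2 * Complex r (- c) / of_real \<beta>))"
      by simp
  qed
  also have "\<dots> = \<i> * pi * \<beta> / 2"
    using integral_inverse_sinh_line[OF b, of "-c"] c by simp
  finally show ?thesis .
qed

text \<open>This is the residue theorem for \<open>q\<close>, which has a simple pole at 0 with
  residue \<beta> / 2; upper minus lower line is the clockwise orientation. Subtracting an explicit
  function with the same pole leaves an integrand holomorphic in the strip, to which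
  \<open>line_integral_shift\<close> applies.\<close>

lemma strip_cauchy_formula:
  fixes g :: "complex \<Rightarrow> complex"
  defines "q \<equiv> \<lambda>\<beta> z. 1 / (1 - exp (- 2 * z / complex_of_real \<beta>))"
  assumes b: "\<beta> > 0" and del: "\<delta> \<le> pi * \<beta> / 8" and k: "0 < k" "k \<le> 2 / \<beta>"
    and hol: "g holomorphic_on cstrip (-\<delta>) \<delta>"
    and bd: "\<And>w. w \<in> cstrip (-\<delta>) \<delta> \<Longrightarrow> norm (g w) \<le> \<Gamma> * exp (- k * \<bar>Re w\<bar>)"
    and t: "- \<delta> < t1" "t1 < Im s" "Im s < t2" "t2 < \<delta>"
  shows "(\<integral>r. g (Complex r t2) * q \<beta> (Complex r t2 - s) \<partial>lborel)
       - (\<integral>r. g (Complex r t1) * q \<beta> (Complex r t1 - s) \<partial>lborel) = - \<i> * pi * \<beta> * g s"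
proof -
  \<comment> \<open>\<open>E\<close> equals 1 at 0, is holomorphic where it is needed, and its
    product with \<open>q\<close> is 1/sinh. The pole is thus removed by a term that decays at both
    ends and has known line integrals.\<close>
  define E where "E = (\<lambda>z. 2 / (1 + exp (2 * z / complex_of_real \<beta>)))"
  define v where "v = (\<lambda>w. 2 * (w - s) / complex_of_real \<beta>)"
  define G0 where "G0 = (\<lambda>w. (g w - g s * E (w - s)) / (1 - exp (- v w)))"
  have s: "s \<in> cstrip (-\<delta>) \<delta>" using t by (auto simp: cstrip_def)
  have Rev: "Re (v w) = 2 / \<beta> * (Re w - Re s)" "Im (v w) = 2 / \<beta> * (Im w - Im s)" for w
    by (simp_all add: v_def)
  have aRev: "\<bar>Re (v w)\<bar> = 2 / \<beta> * \<bar>Re w - Re s\<bar>" "\<bar>Im (v w)\<bar> = 2 / \<beta> * \<bar>Im w - Im s\<bar>" for w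
    unfolding Rev abs_mult using b by auto
  have Imv: "\<bar>Im (v w)\<bar> < pi / 2" if "w \<in> cstrip (-\<delta>) \<delta>" for w
  proof -
    have "\<bar>Im w - Im s\<bar> < 2 * \<delta>" using that s by (auto simp: cstrip_def)
    then have "\<bar>Im w - Im s\<bar> < pi * \<beta> / 4" using del by linarith
    then have "2 / \<beta> * \<bar>Im w - Im s\<bar> < 2 / \<beta> * (pi * \<beta> / 4)" using b by (intro mult_strict_left_mono) auto
    then show ?thesis using b by (simp add: aRev)
  qed
  have ne1: "1 + exp (v w) \<noteq> 0" if "w \<in> cstrip (-\<delta>) \<delta>" for w
  proof
    assume "1 + exp (v w) = 0"
    then have "Re (exp (v w)) = -1" by (metis add_eq_0_iff minus_complex.simps(1) one_complex.simps(1) uminus_complex.simps(1))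
    moreover have "Re (exp (v w)) > 0"
      using Imv[OF that] by (simp add: Re_exp cos_gt_zero_pi)
    ultimately show False by simp
  qed
  have ne2: "1 - exp (- v w) \<noteq> 0" if "w \<in> cstrip (-\<delta>) \<delta>" "w \<noteq> s" for w
  proof
    assume "1 - exp (- v w) = 0"
    then have "exp (- v w) = 1" by simp
    then obtain n :: int where "Re (v w) = 0" "Im (- v w) = of_int (2 * n) * pi" by (auto simp: exp_eq_1)
    have n: "\<bar>real_of_int (2 * n)\<bar> * pi < pi / 2"
    proof -
      have "\<bar>Im (- v w)\<bar> < pi / 2" using Imv[OF that(1)] by simp
      then show ?thesis unfolding \<open>Im (- v w) = of_int (2 * n) * pi\<close> abs_mult by simp
    qed
    have "n = 0"
    proof (rule ccontr)
      assume "n \<noteq> 0"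
      then have "1 \<le> \<bar>real_of_int (2 * n)\<bar>" by linarith
      then have "1 * pi \<le> \<bar>real_of_int (2 * n)\<bar> * pi" by (intro mult_right_mono) auto
      with n show False using pi_gt_zero by linarith
    qed
    with \<open>Re (v w) = 0\<close> \<open>Im (- v w) = _\<close> have "v w = 0" by (simp add: complex_eq_iff)
    then show False using that b by (simp add: v_def)
  qed
  have Eg: "(\<lambda>w. E (w - s)) holomorphic_on cstrip (-\<delta>) \<delta>"
    unfolding E_def using ne1 b by (intro holomorphic_intros) (auto simp: v_def)
  have num: "(\<lambda>w. g w - g s * E (w - s)) holomorphic_on cstrip (-\<delta>) \<delta>"
    by (intro holomorphic_intros hol Eg)
  have holG0: "G0 holomorphic_on cstrip (-\<delta>) \<delta> - {s}"
    unfolding G0_def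
    by (intro holomorphic_on_divide holomorphic_on_subset[OF num])
       (use ne2 b in \<open>auto simp: v_def intro!: holomorphic_intros\<close>)
  obtain c where c: "G0 \<midarrow>s\<rightarrow> c"
  proof
    show "G0 \<midarrow>s\<rightarrow> deriv (\<lambda>w. g w - g s * E (w - s)) s / (2 / of_real \<beta>)"
      unfolding G0_def
    proof (rule lhopital_complex_simple)
      show "((\<lambda>w. g w - g s * E (w - s)) has_field_derivative deriv (\<lambda>w. g w - g s * E (w - s)) s) (at s)"
        by (rule holomorphic_derivI[OF num _ s]) simp
      show "((\<lambda>w. 1 - exp (- v w)) has_field_derivative (2 / of_real \<beta>)) (at s)"
        unfolding v_def using b by (auto intro!: derivative_eq_intros)
    qed (use b in \<open>auto simp: E_def v_def\<close>)
  qed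
  define G where "G = (\<lambda>w. if w = s then c else G0 w)"
  have holG: "G holomorphic_on cstrip (-\<delta>) \<delta>"
    unfolding G_def by (rule removable_singularity[OF holG0 _ c]) simp
  have qv: "q \<beta> (w - s) = 1 / (1 - exp (- v w))" for w by (simp add: q_def v_def)
  have qE: "q \<beta> (w - s) * E (w - s) = 1 / sinh (v w)" for w
  proof -
    have "(1 - exp (- v w)) * (1 + exp (v w)) = 2 * sinh (v w)"
      by (simp add: sinh_def scaleR_conv_of_real algebra_simps exp_minus)
    then show ?thesis unfolding qv E_def by (simp add: v_def)
  qed
  have qbd: "norm (q \<beta> (w - s)) \<le> 2" if "\<beta> \<le> \<bar>Re w - Re s\<bar>" for w
  proof -
    have "2 / \<beta> * \<beta> \<le> 2 / \<beta> * \<bar>Re w - Re s\<bar>" using b that by (intro mult_left_mono) auto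
    then have R1: "2 \<le> \<bar>Re (v w)\<bar>" using b by (simp add: aRev)
    have "1 / 2 \<le> norm (1 - exp (- v w))"
    proof (cases "Re (v w) \<ge> 0")
      case True
      then have x: "2 \<le> Re (v w)" using R1 by simp
      have "2 \<le> exp (Re (v w))" using exp_ge_add_one_self[of "Re (v w)"] x by linarith
      then have "exp (- Re (v w)) \<le> 1 / 2" by (simp add: exp_minus field_simps)
      moreover have "1 - exp (- Re (v w)) \<le> norm (1 - exp (- v w))"
        using norm_triangle_ineq2[of 1 "exp (- v w)"] by simp
      ultimately show ?thesis by linarith
    next
      case False
      then have x: "2 \<le> - Re (v w)" using R1 by simp
      have "2 \<le> exp (- Re (v w))" using exp_ge_add_one_self[of "- Re (v w)"] x by linarith
      moreover have "exp (- Re (v w)) - 1 \<le> norm (1 - exp (- v w))"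
        using norm_triangle_ineq2[of "exp (- v w)" 1] by (simp add: norm_minus_commute)
      ultimately show ?thesis by linarith
    qed
    then have "1 / norm (1 - exp (- v w)) \<le> 1 / (1 / 2)" by (intro divide_left_mono mult_pos_pos) auto
    then show ?thesis unfolding qv by (simp add: norm_divide)
  qed
  have shbd: "norm (1 / sinh (v w)) \<le> 4 * exp (k * \<bar>Re s\<bar>) * exp (- k * \<bar>Re w\<bar>)" if "\<beta> \<le> \<bar>Re w - Re s\<bar>" for w
  proof -
    have "2 / \<beta> * \<beta> \<le> 2 / \<beta> * \<bar>Re w - Re s\<bar>" using b that by (intro mult_left_mono) auto
    then have "2 \<le> \<bar>Re (v w)\<bar>" using b by (simp add: aRev)
    then have "1 \<le> \<bar>Re (v w)\<bar>" by simp
    from cmod_sinh_ge[OF this] have "exp \<bar>Re (v w)\<bar> / 4 \<le> norm (sinh (v w))" .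
    then have "1 / norm (sinh (v w)) \<le> 1 / (exp \<bar>Re (v w)\<bar> / 4)"
      by (intro divide_left_mono mult_pos_pos) (auto intro: less_le_trans[rotated])
    then have "norm (1 / sinh (v w)) \<le> 4 * exp (- \<bar>Re (v w)\<bar>)" by (simp add: norm_divide exp_minus field_simps)
    also have "\<dots> \<le> 4 * exp (k * \<bar>Re s\<bar> - k * \<bar>Re w\<bar>)"
    proof -
      have "k * (\<bar>Re w\<bar> - \<bar>Re s\<bar>) \<le> k * \<bar>Re w - Re s\<bar>" using k by (intro mult_left_mono) auto
      also have "\<dots> \<le> 2 / \<beta> * \<bar>Re w - Re s\<bar>" using k by (intro mult_right_mono) auto
      finally show ?thesis using b by (simp add: aRev right_diff_distrib)
    qed
    finally show ?thesis by (simp add: exp_diff exp_minus field_simps)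
  qed
  define C where "C = 2 * \<bar>\<Gamma>\<bar> + norm (g s) * (4 * exp (k * \<bar>Re s\<bar>))"
  define R where "R = \<bar>Re s\<bar> + \<beta>"
  have far: "\<beta> \<le> \<bar>Re w - Re s\<bar>" if "R \<le> \<bar>Re w\<bar>" for w using that by (simp add: R_def)
  have gqbd: "norm (g w * q \<beta> (w - s)) \<le> 2 * \<bar>\<Gamma>\<bar> * exp (- k * \<bar>Re w\<bar>)" if "w \<in> cstrip (-\<delta>) \<delta>" "R \<le> \<bar>Re w\<bar>" for w
  proof -
    have "norm (g w) \<le> \<bar>\<Gamma>\<bar> * exp (- k * \<bar>Re w\<bar>)"
      by (rule order_trans[OF bd[OF that(1)]]) (intro mult_right_mono, auto)
    then have "norm (g w) * norm (q \<beta> (w - s)) \<le> (\<bar>\<Gamma>\<bar> * exp (- k * \<bar>Re w\<bar>)) * 2"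
      using qbd[OF far[OF that(2)]] by (intro mult_mono) auto
    then show ?thesis by (simp add: norm_mult mult_ac)
  qed
  have Geq: "G w = g w * q \<beta> (w - s) - g s * (1 / sinh (v w))" if "w \<noteq> s" for w
  proof -
    have "G w = (g w - g s * E (w - s)) * q \<beta> (w - s)" using that by (simp add: G_def G0_def qv)
    also have "\<dots> = g w * q \<beta> (w - s) - g s * (q \<beta> (w - s) * E (w - s))" by (simp add: algebra_simps)
    finally show ?thesis by (simp add: qE)
  qed
  have Gbd: "norm (G w) \<le> C * exp (- k * \<bar>Re w\<bar>)" if w: "w \<in> cstrip (-\<delta>) \<delta>" "R \<le> \<bar>Re w\<bar>" for w
  proof -
    have "w \<noteq> s" using far[OF w(2)] b by auto
    then have "norm (G w) \<le> norm (g w * q \<beta> (w - s)) + norm (g s) * norm (1 / sinh (v w))"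
      unfolding Geq[OF \<open>w \<noteq> s\<close>] by (metis norm_mult norm_triangle_ineq4)
    also have "\<dots> \<le> 2 * \<bar>\<Gamma>\<bar> * exp (- k * \<bar>Re w\<bar>) + norm (g s) * (4 * exp (k * \<bar>Re s\<bar>) * exp (- k * \<bar>Re w\<bar>))"
      by (intro add_mono gqbd w mult_left_mono shbd far) auto
    finally show ?thesis by (simp add: C_def algebra_simps)
  qed
  have eqG: "(\<integral>r. G (Complex r t2) \<partial>lborel) = (\<integral>r. G (Complex r t1) \<partial>lborel)"
  proof (rule line_integral_shift[OF holG k(1)])
    show "\<exists>C R. \<forall>w. a' \<le> Im w \<and> Im w \<le> b' \<and> R \<le> \<bar>Re w\<bar> \<longrightarrow> cmod (G w) \<le> C * exp (- k * \<bar>Re w\<bar>)"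
      if "-\<delta> < a'" "b' < \<delta>" for a' b'
      using Gbd that by (intro exI[of _ C] exI[of _ R]) (auto simp: cstrip_def)
  qed (use t in auto)
  have line: "(\<integral>r. g (Complex r \<tau>) * q \<beta> (Complex r \<tau> - s) \<partial>lborel)
     = (\<integral>r. G (Complex r \<tau>) \<partial>lborel) + g s * (\<integral>r. 1 / sinh (2 * Complex r (\<tau> - Im s) / of_real \<beta>) \<partial>lborel)"
    if tau: "-\<delta> < \<tau>" "\<tau> < \<delta>" "\<tau> \<noteq> Im s" for \<tau>
  proof -
    have inst: "Complex r \<tau> \<in> cstrip (-\<delta>) \<delta>" for r using tau by (simp add: cstrip_def)
    have nes: "Complex r \<tau> \<noteq> s" for r using tau by auto
    have cc: "continuous_on UNIV (\<lambda>r. Complex r \<tau>)" by (simp add: Complex_eq) (intro continuous_intros)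
    have iG: "integrable lborel (\<lambda>r. G (Complex r \<tau>))"
    proof (rule integrable_exp_decay[OF _ k(1)])
      show "continuous_on UNIV (\<lambda>r. G (Complex r \<tau>))"
        by (rule continuous_on_compose2[OF holomorphic_on_imp_continuous_on[OF holG] cc]) (use inst in auto)
      show "norm (G (Complex r \<tau>)) \<le> C * exp (- k * \<bar>r\<bar>)" if "R \<le> \<bar>r\<bar>" for r
        using Gbd[OF inst] that by simp
    qed
    have sne: "sinh (v (Complex r \<tau>)) \<noteq> 0" for r
    proof (rule sinh_complex_nonzero)
      show "0 < \<bar>Im (v (Complex r \<tau>))\<bar>" using tau b by (simp add: aRev)
      show "\<bar>Im (v (Complex r \<tau>))\<bar> < pi" using Imv[OF inst[of r]] pi_gt_zero by linarith
    qed
    have iS: "integrable lborel (\<lambda>r. 1 / sinh (v (Complex r \<tau>)))"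
    proof (rule integrable_exp_decay[OF _ k(1)])
      show "continuous_on UNIV (\<lambda>r. 1 / sinh (v (Complex r \<tau>)))"
        using sne b unfolding v_def sinh_def scaleR_conv_of_real by (intro continuous_intros cc) auto
      show "norm (1 / sinh (v (Complex r \<tau>))) \<le> (4 * exp (k * \<bar>Re s\<bar>)) * exp (- k * \<bar>r\<bar>)" if "R \<le> \<bar>r\<bar>" for r
        using shbd[OF far[of "Complex r \<tau>"]] that by simp
    qed
    have "(\<integral>r. g (Complex r \<tau>) * q \<beta> (Complex r \<tau> - s) \<partial>lborel) = (\<integral>r. G (Complex r \<tau>) + g s * (1 / sinh (v (Complex r \<tau>))) \<partial>lborel)"
      by (rule Bochner_Integration.integral_cong[OF refl]) (simp add: Geq[OF nes])
    also have "\<dots> = (\<integral>r. G (Complex r \<tau>) \<partial>lborel) + g s * (\<integral>r. 1 / sinh (v (Complex r \<tau>)) \<partial>lborel)"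
      by (simp only: Bochner_Integration.integral_add[OF iG integrable_mult_right[OF iS]] integral_mult_right_zero)
    also have "(\<integral>r. 1 / sinh (v (Complex r \<tau>)) \<partial>lborel) = (\<integral>r. 1 / sinh (v (Complex (Re s + 1 * r) \<tau>)) \<partial>lborel)"
      using lborel_integral_real_affine[of 1 "\<lambda>r. 1 / sinh (v (Complex r \<tau>))" "Re s"] by simp
    also have "\<dots> = (\<integral>r. 1 / sinh (2 * Complex r (\<tau> - Im s) / of_real \<beta>) \<partial>lborel)"
    proof (rule Bochner_Integration.integral_cong[OF refl])
      fix r
      have "v (Complex (Re s + 1 * r) \<tau>) = 2 * Complex r (\<tau> - Im s) / of_real \<beta>"
        by (simp add: complex_eq_iff v_def)
      then show "1 / sinh (v (Complex (Re s + 1 * r) \<tau>)) = 1 / sinh (2 * Complex r (\<tau> - Im s) / of_real \<beta>)" by simp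
    qed
    finally show ?thesis .
  qed
  have d8: "2 * \<delta> \<le> pi * \<beta> / 4" using del by simp
  have pb: "pi * \<beta> > 0" using b by simp
  \<comment> \<open>The subtracted 1/sinh term carries the whole jump: the lines above and below the
    pole contribute half of it each, with opposite signs.\<close>
  have i2: "(\<integral>r. 1 / sinh (2 * Complex r (t2 - Im s) / of_real \<beta>) \<partial>lborel) = - \<i> * pi * \<beta> / 2"
    using t d8 pb by (intro integral_inverse_sinh_line b) linarith+
  have i1: "(\<integral>r. 1 / sinh (2 * Complex r (t1 - Im s) / of_real \<beta>) \<partial>lborel) = \<i> * pi * \<beta> / 2"
    using t d8 pb by (intro integral_inverse_sinh_line_neg b) linarith+
  show ?thesis
    using line[of t1] line[of t2] t eqG by (simp add: i1 i2 algebra_simps)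
qed

section \<open>Hilbert transforms of boundary values\<close>

lemma has_integral_symmetric_annulus:
  fixes f :: "real \<Rightarrow> real"
  assumes e: "0 < e" "e < R" and c: "continuous_on UNIV f"
  shows "((\<lambda>y. f y / (x - y)) has_integral integral {e..R} (\<lambda>r. (f (x - r) - f (x + r)) / r))
           {y. e < \<bar>x - y\<bar> \<and> \<bar>x - y\<bar> < R}"
proof -
  let ?g = "\<lambda>y. f y / (x - y)"
  have cl: "continuous_on {e..R} (\<lambda>r. f (x - r) / r)"
    using e by (intro continuous_intros continuous_on_compose2[OF c]) auto
  have cr: "continuous_on {e..R} (\<lambda>r. f (x + r) / r)"
    using e by (intro continuous_intros continuous_on_compose2[OF c]) auto
  have il: "((\<lambda>r. f (x - r) / r) has_integral integral {e..R} (\<lambda>r. f (x - r) / r)) {e..R}"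
    using integrable_continuous_real[OF cl] by (rule integrable_integral)
  have ir: "((\<lambda>r. f (x + r) / r) has_integral integral {e..R} (\<lambda>r. f (x + r) / r)) {e..R}"
    using integrable_continuous_real[OF cr] by (rule integrable_integral)
  have L: "(?g has_integral integral {e..R} (\<lambda>r. f (x - r) / r)) {x - R..x - e}"
  proof -
    have "((\<lambda>y. f (x - (-1 * y + x)) / (-1 * y + x)) has_integral (1 / \<bar>-1\<bar>) *\<^sub>R integral {e..R} (\<lambda>r. f (x - r) / r)) ((\<lambda>y. (1 / -1) * y + - (1 / -1) * x) ` {e..R})"
      using has_integral_affinity[of "\<lambda>r. f (x - r) / r" _ e R "-1" x] il by simp
    moreover have "(\<lambda>y. (1 / -1) * y + - (1 / -1) * x) ` {e..R} = {x - R..x - e}"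
      by (simp add: add.commute flip: diff_conv_add_uminus)
    ultimately show ?thesis by (simp add: algebra_simps)
  qed
  have Rr: "(?g has_integral - integral {e..R} (\<lambda>r. f (x + r) / r)) {x + e..x + R}"
  proof -
    have "((\<lambda>y. - (f (x + (1 * y + - x)) / (1 * y + - x))) has_integral (1 / \<bar>1\<bar>) *\<^sub>R (- integral {e..R} (\<lambda>r. f (x + r) / r))) ((\<lambda>y. (1 / 1) * y + - (1 / 1) * (- x)) ` {e..R})"
      using has_integral_affinity[of "\<lambda>r. - (f (x + r) / r)" _ e R 1 "- x"] has_integral_neg[OF ir] by simp
    moreover have "(\<lambda>y. (1 / 1) * y + - (1 / 1) * (- x)) ` {e..R} = {x + e..x + R}"
      by (simp add: add.commute)
    moreover have "- (f y / (y - x)) = f y / (x - y)" for y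
      by (metis minus_diff_eq minus_divide_right)
    ultimately show ?thesis by (simp add: add.commute)
  qed
  have U: "(?g has_integral (integral {e..R} (\<lambda>r. f (x - r) / r) + - integral {e..R} (\<lambda>r. f (x + r) / r))) ({x - R..x - e} \<union> {x + e..x + R})"
    by (rule has_integral_Un[OF L Rr]) (use e in \<open>auto intro: negligible_subset[of "{}"]\<close>)
  have "integral {e..R} (\<lambda>r. (f (x - r) - f (x + r)) / r) = integral {e..R} (\<lambda>r. f (x - r) / r) + - integral {e..R} (\<lambda>r. f (x + r) / r)"
    using integral_diff[OF integrable_continuous_real[OF cl] integrable_continuous_real[OF cr]]
    by (simp add: diff_divide_distrib)
  with U have U': "(?g has_integral integral {e..R} (\<lambda>r. (f (x - r) - f (x + r)) / r)) ({x - R..x - e} \<union> {x + e..x + R})" by simp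
  have eq: "{y. e < \<bar>x - y\<bar> \<and> \<bar>x - y\<bar> < R} \<subseteq> {x - R..x - e} \<union> {x + e..x + R}" by auto
  have eq2: "({x - R..x - e} \<union> {x + e..x + R}) - {y. e < \<bar>x - y\<bar> \<and> \<bar>x - y\<bar> < R} \<subseteq> {x - R, x - e, x + e, x + R}"
    using e by (auto simp: abs_if)
  have "negligible {x - R, x - e, x + e, x + R}" by simp
  then have n2: "negligible (({x - R..x - e} \<union> {x + e..x + R}) - {y. e < \<bar>x - y\<bar> \<and> \<bar>x - y\<bar> < R})"
    using eq2 by (rule negligible_subset)
  have n1: "negligible ({y. e < \<bar>x - y\<bar> \<and> \<bar>x - y\<bar> < R} - ({x - R..x - e} \<union> {x + e..x + R}))"
    using eq by (metis Diff_eq_empty_iff negligible_empty)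
  show ?thesis
    by (rule iffD1[OF has_integral_spike_set_eq[OF negligible_subset[OF n2] negligible_subset[OF n1]] U']) auto
qed

text \<open>Averaging a function of the closed upper half plane over half circles about a real point \<open>x\<close>
  replaces the contour argument: the radial derivative of the average is the integrand of the
  Hilbert transform.\<close>

lemma has_hilbert_boundary_value:
  fixes \<Phi> :: "complex \<Rightarrow> complex"
  assumes S: "open S" "{z. 0 \<le> Im z} - {0} \<subseteq> S"
    and hol: "\<Phi> holomorphic_on S"
    and cont: "continuous_on {z. 0 \<le> Im z} \<Phi>"
    and dec: "\<And>\<epsilon>. \<epsilon> > 0 \<Longrightarrow> \<exists>R. \<forall>z. 0 \<le> Im z \<longrightarrow> R \<le> norm z \<longrightarrow> norm (\<Phi> z) \<le> \<epsilon>"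
  shows "has_hilbert (\<lambda>y. - Im (\<Phi> (of_real y))) x (Re (\<Phi> (of_real x)))"
proof -
  \<comment> \<open>No factor 1/pi is included, so that \<open>m 0\<close> is pi times the boundary
    value and matches the prefactor in \<open>has_hilbert\<close>.\<close>
  define m where "m = (\<lambda>\<rho>. integral {0..pi} (\<lambda>\<theta>. \<Phi> (of_real x + of_real \<rho> * cis \<theta>)))"
  have cr: "continuous_on UNIV (\<lambda>y. \<Phi> (complex_of_real y))"
    by (rule continuous_on_compose2[OF cont]) (auto intro!: continuous_intros)
  have inH: "0 \<le> Im (of_real x + of_real \<rho> * cis \<theta>)" if "0 \<le> \<rho>" "\<theta> \<in> {0..pi}" for \<rho> \<theta>
    using that by (auto simp: sin_ge_zero)
  have cm: "continuous_on {0..} m"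
  proof -
    have "continuous_on ({0..} \<times> cbox 0 pi) (\<lambda>(\<rho>, \<theta>). \<Phi> (of_real x + of_real \<rho> * cis \<theta>))"
      unfolding case_prod_beta
      by (rule continuous_on_compose2[OF cont]) (use inH in \<open>auto intro!: continuous_intros\<close>)
    from integral_continuous_on_param[OF this] show ?thesis by (simp add: m_def)
  qed
  \<comment> \<open>For holomorphic \<Phi> the radial derivative is 1/(i \<rho>) times the angular
    one, so its integral over the half circle is a difference of end values. At radius |x| the half
    circle meets 0, where only continuity is assumed; this one radius is left out here and tolerated
    by the version of the fundamental theorem used below.\<close>
  have dm: "(m has_vector_derivative ((\<Phi> (of_real (x - \<rho>)) - \<Phi> (of_real (x + \<rho>))) / (\<i> * of_real \<rho>))) (at \<rho>)"
    if rho: "0 < \<rho>" "\<rho> \<noteq> \<bar>x\<bar>" for \<rho>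
  proof -
    define d where "d = min (\<rho> / 2) (\<bar>\<rho> - \<bar>x\<bar>\<bar> / 2)"
    have d: "d > 0" "d \<le> \<rho> / 2" "d \<le> \<bar>\<rho> - \<bar>x\<bar>\<bar> / 2"
      unfolding d_def using rho by (auto simp: min_def)
    define U where "U = {\<rho> - d<..<\<rho> + d}"
    have inS: "of_real x + of_real r * cis \<theta> \<in> S" if "r \<in> U" "\<theta> \<in> {0..pi}" for r \<theta>
    proof -
      have r: "0 < r" "r \<noteq> \<bar>x\<bar>" using that d by (auto simp: U_def)
      have "norm (of_real r * cis \<theta>) \<noteq> norm (- complex_of_real x)" using r by (simp add: norm_mult)
      then have "of_real x + of_real r * cis \<theta> \<noteq> 0" by (metis add.commute eq_neg_iff_add_eq_0)
      then show ?thesis using S(2) inH[of r \<theta>] r that by auto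
    qed
    have cd: "continuous_on S (deriv \<Phi>)"
      by (intro holomorphic_on_imp_continuous_on holomorphic_deriv hol S)
    have vd: "((\<lambda>r. \<Phi> (of_real x + of_real r * cis \<theta>)) has_vector_derivative cis \<theta> * deriv \<Phi> (of_real x + of_real r * cis \<theta>)) (at r within U)"
      if "r \<in> U" "\<theta> \<in> {0..pi}" for r \<theta>
    proof -
      have "(\<Phi> has_field_derivative deriv \<Phi> (of_real x + of_real r * cis \<theta>)) (at (of_real x + of_real r * cis \<theta>))"
        using holomorphic_derivI[OF hol S(1) inS[OF that]] .
      moreover have "((\<lambda>r. of_real x + of_real r * cis \<theta>) has_vector_derivative cis \<theta>) (at r within U)"
        by (auto intro!: derivative_eq_intros simp: has_vector_derivative_def)
           (auto simp: scaleR_conv_of_real intro!: derivative_eq_intros)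
      ultimately show ?thesis
        using field_vector_diff_chain_within[of "\<lambda>r. of_real x + of_real r * cis \<theta>" "cis \<theta>" r U \<Phi> "deriv \<Phi> (of_real x + of_real r * cis \<theta>)"]
        by (auto simp: o_def has_field_derivative_at_within)
    qed
    have "((\<lambda>r. integral (cbox 0 pi) (\<lambda>\<theta>. \<Phi> (of_real x + of_real r * cis \<theta>))) has_vector_derivative
            integral (cbox 0 pi) (\<lambda>\<theta>. cis \<theta> * deriv \<Phi> (of_real x + of_real \<rho> * cis \<theta>))) (at \<rho> within U)"
    proof (rule leibniz_rule_vector_derivative[where U = U])
      show "((\<lambda>r. \<Phi> (of_real x + of_real r * cis \<theta>)) has_vector_derivative cis \<theta> * deriv \<Phi> (of_real x + of_real r * cis \<theta>)) (at r within U)"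
        if "r \<in> U" "\<theta> \<in> cbox 0 pi" for r \<theta> using vd that by simp
      show "(\<lambda>\<theta>. \<Phi> (of_real x + of_real r * cis \<theta>)) integrable_on cbox 0 pi" if "r \<in> U" for r
        using inS[OF that] unfolding cbox_interval
        by (intro integrable_continuous_real continuous_on_compose2[OF holomorphic_on_imp_continuous_on[OF hol]] continuous_intros) auto
      show "continuous_on (U \<times> cbox 0 pi) (\<lambda>(r, \<theta>). cis \<theta> * deriv \<Phi> (of_real x + of_real r * cis \<theta>))"
        unfolding case_prod_beta
        by (intro continuous_intros continuous_on_compose2[OF cd]) (use inS in auto)
      show "\<rho> \<in> U" using d by (auto simp: U_def)
      show "convex U" by (simp add: U_def)
    qed
    moreover have "((\<lambda>\<theta>. cis \<theta> * deriv \<Phi> (of_real x + of_real \<rho> * cis \<theta>)) has_integral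
        (\<Phi> (of_real x + of_real \<rho> * cis pi) / (\<i> * of_real \<rho>) - \<Phi> (of_real x + of_real \<rho> * cis 0) / (\<i> * of_real \<rho>))) {0..pi}"
    proof (rule fundamental_theorem_of_calculus)
      fix \<theta> assume th: "\<theta> \<in> {0..pi}"
      have rU: "\<rho> \<in> U" using d by (auto simp: U_def)
      have "(\<Phi> has_field_derivative deriv \<Phi> (of_real x + of_real \<rho> * cis \<theta>)) (at (of_real x + of_real \<rho> * cis \<theta>))"
        using holomorphic_derivI[OF hol S(1) inS[OF rU th]] .
      moreover have "((\<lambda>\<theta>. of_real x + of_real \<rho> * cis \<theta>) has_vector_derivative of_real \<rho> * (\<i> * cis \<theta>)) (at \<theta> within {0..pi})"
        by (rule has_vector_derivative_at_within)
           (auto intro!: derivative_eq_intros has_vector_derivative_real_field simp: cis_conv_exp)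
      ultimately have "((\<lambda>\<theta>. \<Phi> (of_real x + of_real \<rho> * cis \<theta>)) has_vector_derivative
           of_real \<rho> * (\<i> * cis \<theta>) * deriv \<Phi> (of_real x + of_real \<rho> * cis \<theta>)) (at \<theta> within {0..pi})"
        using field_vector_diff_chain_within[of "\<lambda>\<theta>. of_real x + of_real \<rho> * cis \<theta>" "of_real \<rho> * (\<i> * cis \<theta>)" \<theta> "{0..pi}" \<Phi> "deriv \<Phi> (of_real x + of_real \<rho> * cis \<theta>)"]
        by (auto simp: o_def has_field_derivative_at_within)
      then have "((\<lambda>\<theta>. \<Phi> (of_real x + of_real \<rho> * cis \<theta>) / (\<i> * of_real \<rho>)) has_vector_derivative
           (of_real \<rho> * (\<i> * cis \<theta>) * deriv \<Phi> (of_real x + of_real \<rho> * cis \<theta>)) / (\<i> * of_real \<rho>)) (at \<theta> within {0..pi})"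
        by (rule has_vector_derivative_divide)
      then show "((\<lambda>\<theta>. \<Phi> (of_real x + of_real \<rho> * cis \<theta>) / (\<i> * of_real \<rho>)) has_vector_derivative
           cis \<theta> * deriv \<Phi> (of_real x + of_real \<rho> * cis \<theta>)) (at \<theta> within {0..pi})"
        using rho by (simp add: field_simps)
    qed auto
    ultimately have "(m has_vector_derivative
        (\<Phi> (of_real x + of_real \<rho> * cis pi) / (\<i> * of_real \<rho>) - \<Phi> (of_real x + of_real \<rho> * cis 0) / (\<i> * of_real \<rho>))) (at \<rho> within U)"
      by (simp add: m_def integral_unique)
    moreover have "at \<rho> within U = at \<rho>" using d by (intro at_within_open) (auto simp: U_def)
    ultimately show ?thesis by (simp add: diff_divide_distrib)
  qed
  have FTC: "integral {e..R} (\<lambda>r. ((- Im (\<Phi> (of_real (x - r)))) - (- Im (\<Phi> (of_real (x + r))))) / r) = Re (m e) - Re (m R)"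
    if "0 < e" "e < R" for e R
  proof -
    have "((\<lambda>\<rho>. (\<Phi> (of_real (x - \<rho>)) - \<Phi> (of_real (x + \<rho>))) / (\<i> * of_real \<rho>)) has_integral m R - m e) {e..R}"
      by (rule fundamental_theorem_of_calculus_interior_strong[of "{\<bar>x\<bar>}"])
         (use that dm in \<open>auto intro!: continuous_on_subset[OF cm]\<close>)
    then have "((\<lambda>\<rho>. - Re ((\<Phi> (of_real (x - \<rho>)) - \<Phi> (of_real (x + \<rho>))) / (\<i> * of_real \<rho>))) has_integral - Re (m R - m e)) {e..R}"
      by (intro has_integral_neg has_integral_Re)
    moreover have "- Re (z / (\<i> * of_real \<rho>)) = - Im z / \<rho>" for z and \<rho> :: real
      by (simp add: Re_divide power2_eq_square)
    ultimately show ?thesis by (intro integral_unique) (simp add: algebra_simps)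
  qed
  have lim0: "((\<lambda>e. Re (m e)) \<longlongrightarrow> pi * Re (\<Phi> (of_real x))) (at_right 0)"
  proof -
    have "(m \<longlongrightarrow> m 0) (at 0 within {0..})"
      using cm by (auto simp: continuous_on_def)
    then have "(m \<longlongrightarrow> m 0) (at_right 0)"
      by (rule tendsto_within_subset) auto
    moreover have "m 0 = of_real pi * \<Phi> (of_real x)" by (simp add: m_def scaleR_conv_of_real)
    ultimately have "((\<lambda>e. Re (m e)) \<longlongrightarrow> Re (of_real pi * \<Phi> (of_real x))) (at_right 0)"
      by (metis tendsto_Re)
    then show ?thesis by simp
  qed
  have limR: "((\<lambda>R. Re (m R)) \<longlongrightarrow> 0) at_top"
  proof (rule tendstoI)
    fix \<epsilon> :: real assume e: "\<epsilon> > 0"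
    then have "\<epsilon> / 4 > 0" by simp
    from dec[OF this] obtain R0 where R0: "\<And>z. 0 \<le> Im z \<Longrightarrow> R0 \<le> norm z \<Longrightarrow> norm (\<Phi> z) \<le> \<epsilon> / 4" by blast
    have "dist (Re (m R)) 0 < \<epsilon>" if R: "R \<ge> max 0 (R0 + \<bar>x\<bar>)" for R
    proof -
      have "norm (m R) \<le> \<epsilon> / 4 * (pi - 0)"
        unfolding m_def
      proof (rule integral_bound)
        show "continuous_on {0..pi} (\<lambda>\<theta>. \<Phi> (of_real x + of_real R * cis \<theta>))"
          by (rule continuous_on_compose2[OF cont]) (use inH R in \<open>auto intro!: continuous_intros\<close>)
        fix \<theta> assume th: "\<theta> \<in> {0..pi}"
        have "norm (of_real R * cis \<theta>) - norm (- complex_of_real x) \<le> norm (of_real R * cis \<theta> - (- complex_of_real x))"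
          by (rule norm_triangle_ineq2)
        then have "R - \<bar>x\<bar> \<le> norm (of_real x + of_real R * cis \<theta>)" using R by (simp add: norm_mult add.commute)
        then show "norm (\<Phi> (of_real x + of_real R * cis \<theta>)) \<le> \<epsilon> / 4"
          using R th inH[of R \<theta>] by (intro R0) auto
      qed (use pi_ge_zero in auto)
      also have "\<dots> < \<epsilon>" using pi_less_4 e by (simp add: field_simps)
      finally show ?thesis using abs_Re_le_cmod[of "m R"] by (simp add: dist_norm)
    qed
    then show "eventually (\<lambda>R. dist (Re (m R)) 0 < \<epsilon>) at_top"
      by (rule eventually_at_top_linorderI)
  qed
  have cf: "continuous_on UNIV (\<lambda>y. - Im (\<Phi> (complex_of_real y)))" by (intro continuous_intros cr)
  note ann = has_integral_symmetric_annulus[OF _ _ cf, of _ _ x]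
  show ?thesis unfolding has_hilbert_def
  proof (intro conjI allI impI)
    show "(\<lambda>y. - Im (\<Phi> (of_real y)) / (x - y)) integrable_on {y. e < \<bar>x - y\<bar> \<and> \<bar>x - y\<bar> < R}" if "0 < e \<and> e < R" for e R
      using ann[of e R] that by blast
    have ev: "eventually (\<lambda>(e, R). (1 / pi) * (Re (m e) - Re (m R)) =
        (1 / pi) * integral {y. e < \<bar>x - y\<bar> \<and> \<bar>x - y\<bar> < R} (\<lambda>y. - Im (\<Phi> (of_real y)) / (x - y))) (at_right 0 \<times>\<^sub>F at_top)"
    proof -
      have "eventually (\<lambda>e. 0 < e \<and> e < 1) (at_right (0::real))"
        unfolding eventually_at_right_field by (intro exI[of _ 1]) auto
      moreover have "eventually (\<lambda>R::real. 1 < R) at_top" by (rule eventually_gt_at_top)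
      ultimately have "eventually (\<lambda>(e, R). (0 < e \<and> e < 1) \<and> 1 < R) (at_right (0::real) \<times>\<^sub>F (at_top :: real filter))"
        unfolding eventually_prod_filter
        by (intro exI[of _ "\<lambda>e. 0 < e \<and> e < 1"] exI[of _ "\<lambda>R. 1 < R"]) auto
      then show ?thesis
      proof (rule eventually_mono)
        fix p :: "real \<times> real" assume p: "case p of (e, R) \<Rightarrow> (0 < e \<and> e < 1) \<and> 1 < R"
        obtain e R where pe: "p = (e, R)" by (metis surj_pair)
        have "0 < e" "e < R" using p pe by auto
        from integral_unique[OF ann[OF this]] FTC[OF this]
        show "case p of (e, R) \<Rightarrow> (1 / pi) * (Re (m e) - Re (m R)) =
        (1 / pi) * integral {y. e < \<bar>x - y\<bar> \<and> \<bar>x - y\<bar> < R} (\<lambda>y. - Im (\<Phi> (of_real y)) / (x - y))"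
          by (simp only: pe case_prod_conv)
      qed
    qed
    have l1: "((\<lambda>p. Re (m (fst p))) \<longlongrightarrow> pi * Re (\<Phi> (of_real x))) (at_right 0 \<times>\<^sub>F at_top)"
      by (rule filterlim_compose[OF lim0 filterlim_fst])
    have l2: "((\<lambda>p. Re (m (snd p))) \<longlongrightarrow> 0) (at_right (0::real) \<times>\<^sub>F at_top)"
      by (rule filterlim_compose[OF limR filterlim_snd])
    have "((\<lambda>p. (1 / pi) * (Re (m (fst p)) - Re (m (snd p)))) \<longlongrightarrow> (1 / pi) * (pi * Re (\<Phi> (of_real x)) - 0)) (at_right 0 \<times>\<^sub>F at_top)"
      by (intro tendsto_intros l1 l2)
    then have "((\<lambda>(e, R). (1 / pi) * (Re (m e) - Re (m R))) \<longlongrightarrow> Re (\<Phi> (of_real x))) (at_right 0 \<times>\<^sub>F at_top)"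
      by (simp add: split_beta')
    then show "((\<lambda>(e, R). (1 / pi) * integral {y. e < \<bar>x - y\<bar> \<and> \<bar>x - y\<bar> < R} (\<lambda>y. - Im (\<Phi> (of_real y)) / (x - y)))
        \<longlongrightarrow> Re (\<Phi> (of_real x))) (at_right 0 \<times>\<^sub>F at_top)"
      by (rule Lim_transform_eventually) (use ev in \<open>auto elim: eventually_mono\<close>)
  qed
qed

section \<open>The linearised equation\<close>

text \<open>With x = exp (Re z) and y = Im z, the square of |1 + exp z| is (1+x)^2 cos^2 (y/2) +
  (1-x)^2 sin^2 (y/2). On the given range cos (y/2) is at least cos (5 pi / 12) = sin (pi / 12),
  which exceeds 1/4.\<close>

lemma cmod_one_plus_exp_ge:
  assumes "\<bar>Im z\<bar> \<le> 5 * pi / 6"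
  shows "(1 + exp (Re z)) / 4 \<le> norm (1 + exp z)"
proof -
  define x y where "x = exp (Re z)" and "y = Im z"
  have x: "x > 0" by (simp add: x_def)
  have c: "1 / 4 \<le> cos (y / 2)"
  proof -
    have "cos (5 * pi / 12) \<le> cos \<bar>y / 2\<bar>"
      by (rule cos_monotone_0_pi_le) (use assms in \<open>auto simp: y_def\<close>)
    moreover have "cos (5 * pi / 12) = sin (pi / 12)"
      using cos_sin_eq[of "5 * pi / 12"] by (simp add: field_simps)
    moreover have "1 / 4 \<le> sin (pi / 12)"
    proof -
      have "1 / 2 = sin (2 * (pi / 12))" using sin_30 by simp
      also have "\<dots> = 2 * sin (pi / 12) * cos (pi / 12)" by (rule sin_double)
      also have "\<dots> \<le> 2 * sin (pi / 12) * 1" by (intro mult_left_mono) (auto intro!: sin_ge_zero)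
      finally show ?thesis by simp
    qed
    ultimately show ?thesis using cos_abs_real[of "y / 2"] by linarith
  qed
  have cy: "cos y = 2 * (cos (y / 2))\<^sup>2 - 1" using cos_double_cos[of "y / 2"] by simp
  have "((1 + x) * cos (y / 2))\<^sup>2 \<le> (norm (1 + exp z))\<^sup>2"
  proof -
    have "(norm (1 + exp z))\<^sup>2 = (1 + x * cos y)\<^sup>2 + (x * sin y)\<^sup>2"
      by (simp add: cmod_power2 Re_exp Im_exp x_def y_def)
    also have "\<dots> = 1 + 2 * x * cos y + x\<^sup>2 * ((sin y)\<^sup>2 + (cos y)\<^sup>2)"
      unfolding power2_sum power_mult_distrib by (simp only: distrib_left) simp
    also have "\<dots> = 1 + 2 * x * cos y + x\<^sup>2" by simp
    finally have "(norm (1 + exp z))\<^sup>2 - ((1 + x) * cos (y / 2))\<^sup>2 = (1 - (cos (y / 2))\<^sup>2) * (1 - x)\<^sup>2"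
      unfolding cy by (simp add: power2_eq_square algebra_simps)
    moreover have "\<dots> \<ge> 0" by (intro mult_nonneg_nonneg) (auto simp: abs_square_le_1)
    ultimately show ?thesis by linarith
  qed
  then have "(1 + x) * cos (y / 2) \<le> norm (1 + exp z)" by (rule power2_le_imp_le) simp
  moreover have "(1 + x) * (1 / 4) \<le> (1 + x) * cos (y / 2)" using c x by (intro mult_left_mono) auto
  ultimately show ?thesis by (simp add: x_def)
qed

lemma exp_div_one_plus_exp_square_le: "exp x / (1 + exp x)\<^sup>2 \<le> exp (- \<bar>x\<bar>)" for x :: real
proof (cases "x \<ge> 0")
  case True
  have "exp x * exp x \<le> (1 + exp x)\<^sup>2" by (simp add: power2_eq_square algebra_simps)
  moreover have "(1 + exp x)\<^sup>2 > 0" by (intro zero_less_power add_pos_pos) auto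
  ultimately have "exp x * exp x / (1 + exp x)\<^sup>2 \<le> 1" by simp
  then show ?thesis using True by (simp add: exp_minus field_simps)
next
  case False
  have "1 \<le> (1 + exp x)\<^sup>2" by (simp add: power2_eq_square algebra_simps)
  then have "exp x * 1 \<le> exp x * (1 + exp x)\<^sup>2" by (intro mult_left_mono) auto
  moreover have "(1 + exp x)\<^sup>2 > 0" by (intro zero_less_power add_pos_pos) auto
  ultimately have "exp x / (1 + exp x)\<^sup>2 \<le> exp x" by (simp add: pos_divide_le_eq)
  then show ?thesis using False by simp
qed

text \<open>\<open>tnh\<close> is tanh (s/2), \<open>kap\<close> is 1 / (4 cosh^2 (s/2)), which
  solves the homogeneous linearised equation, and \<open>kinv\<close> is its reciprocal written as
  an entire function, the integrating factor.\<close>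

definition kap :: "complex \<Rightarrow> complex" where "kap s = exp s / (1 + exp s)\<^sup>2"
definition tnh :: "complex \<Rightarrow> complex" where "tnh s = (exp s - 1) / (exp s + 1)"
definition kinv :: "complex \<Rightarrow> complex" where "kinv s = exp (- s) + 2 + exp s"

lemma one_plus_exp_nonzero: "\<bar>Im s\<bar> \<le> 5 * pi / 6 \<Longrightarrow> 1 + exp s \<noteq> 0"
  using cmod_one_plus_exp_ge[of s] exp_gt_zero[of "Re s"] by (metis add_pos_pos divide_pos_pos linorder_not_le norm_zero zero_less_numeral zero_less_one)

lemma kap_bound: assumes "\<bar>Im s\<bar> \<le> 5 * pi / 6" shows "norm (kap s) \<le> 16 * exp (- \<bar>Re s\<bar>)"
proof -
  have p: "0 < 1 + exp (Re s)" by (simp add: add_pos_pos)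
  have "((1 + exp (Re s)) / 4)\<^sup>2 \<le> (norm (1 + exp s))\<^sup>2"
    using cmod_one_plus_exp_ge[OF assms] p by (intro power_mono) auto
  then have "exp (Re s) / (norm (1 + exp s))\<^sup>2 \<le> exp (Re s) / ((1 + exp (Re s)) / 4)\<^sup>2"
    using p one_plus_exp_nonzero[OF assms] by (intro divide_left_mono mult_pos_pos) auto
  also have "\<dots> = 16 * (exp (Re s) / (1 + exp (Re s))\<^sup>2)" by (simp add: power_divide)
  also have "\<dots> \<le> 16 * exp (- \<bar>Re s\<bar>)" using exp_div_one_plus_exp_square_le by (intro mult_left_mono) auto
  finally show ?thesis by (simp add: kap_def norm_divide norm_power)
qed

lemma tnh_bound: assumes "\<bar>Im s\<bar> \<le> 5 * pi / 6" shows "norm (tnh s) \<le> 4"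
proof -
  have p: "0 < 1 + exp (Re s)" by (simp add: add_pos_pos)
  have "norm (exp s - 1) \<le> 1 + exp (Re s)" using norm_triangle_ineq4[of "exp s" 1] by simp
  also have "\<dots> \<le> 4 * norm (1 + exp s)" using cmod_one_plus_exp_ge[OF assms] by simp
  finally show ?thesis using one_plus_exp_nonzero[OF assms]
    by (simp add: tnh_def norm_divide divide_le_eq add.commute)
qed

lemma kinv_bound: "norm (kinv s) \<le> 4 * exp \<bar>Re s\<bar>"
proof -
  have "norm (kinv s) \<le> exp (- Re s) + 2 + exp (Re s)"
    unfolding kinv_def by (rule norm_triangle_le, rule add_mono, rule norm_triangle_le) auto
  moreover have "exp (- Re s) \<le> exp \<bar>Re s\<bar>" "exp (Re s) \<le> exp \<bar>Re s\<bar>" "1 \<le> exp \<bar>Re s\<bar>" by auto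
  ultimately show ?thesis by linarith
qed

lemma kap_kinv: assumes "1 + exp s \<noteq> 0" shows "kap s * kinv s = 1"
proof -
  have "exp s * kinv s = (1 + exp s)\<^sup>2"
    by (simp add: kinv_def power2_eq_square algebra_simps exp_minus)
  then show ?thesis using assms by (simp add: kap_def field_simps)
qed

lemma kinv_deriv: "(kinv has_field_derivative (exp s - exp (- s))) (at s)"
  unfolding kinv_def by (auto intro!: derivative_eq_intros)

lemma kinv_tnh: assumes "1 + exp s \<noteq> 0" shows "exp s - exp (- s) = tnh s * kinv s"
proof -
  have "exp s * (exp s - exp (- s)) = (exp s - 1) * (exp s + 1)" by (simp add: algebra_simps exp_minus)
  moreover have "exp s * kinv s = (exp s + 1)\<^sup>2"
    by (simp add: kinv_def power2_eq_square algebra_simps exp_minus)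
  ultimately have "exp s * (exp s - exp (- s)) = exp s * (tnh s * kinv s)"
    using assms by (simp add: tnh_def add.commute power2_eq_square field_simps)
  then show ?thesis by simp
qed

lemma tnh_deriv: assumes "1 + exp s \<noteq> 0" shows "(tnh has_field_derivative 2 * kap s) (at s)"
  unfolding tnh_def kap_def using assms
  by (auto intro!: derivative_eq_intros simp: add.commute power2_eq_square algebra_simps)

lemma kap_deriv: assumes "1 + exp s \<noteq> 0" shows "(kap has_field_derivative - (tnh s * kap s)) (at s)"
proof -
  have "(kap has_field_derivative (exp s * (1 + exp s)\<^sup>2 - exp s * (2 * (1 + exp s) * exp s)) / ((1 + exp s)\<^sup>2 * (1 + exp s)\<^sup>2)) (at s)"
    unfolding kap_def using assms by (auto intro!: derivative_eq_intros)
  moreover have "(exp s * (1 + exp s)\<^sup>2 - exp s * (2 * (1 + exp s) * exp s)) / ((1 + exp s)\<^sup>2 * (1 + exp s)\<^sup>2) = - (tnh s * kap s)"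
  proof -
    define d where "d = 1 + exp s"
    have e: "exp s = d - 1" "exp s + 1 = d" "d \<noteq> 0" using assms by (auto simp: d_def)
    show ?thesis unfolding tnh_def kap_def e(2) d_def[symmetric] unfolding e(1) using e(3)
      by (simp add: field_simps power2_eq_square)
  qed
  ultimately show ?thesis by simp
qed

text \<open>The product of p and \<open>kinv\<close> has derivative m times \<open>kinv\<close> and
  is integrated along the segment from 0 to s. Since \<open>kinv\<close> grows like exp |Re s| and m
  decays at rate c < 1, the product is O(exp ((1 - c) |Re s|)); multiplying back by
  \<open>kap\<close> leaves decay at rate c. Keeping 1 - c at least 1/4 makes the constant
  uniform.\<close>

lemma ode_bound:
  fixes p m :: "complex \<Rightarrow> complex"
  assumes h: "h \<le> 5 * pi / 6" and s: "s \<in> cstrip (-h) h"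
    and hol: "p holomorphic_on cstrip (-h) h"
    and ode: "\<And>z. z \<in> cstrip (-h) h \<Longrightarrow> deriv p z + tnh z * p z = m z"
    and c: "0 \<le> c" "c \<le> 3/4" and M: "M \<ge> 0"
    and m: "\<And>u. 0 \<le> u \<Longrightarrow> u \<le> 1 \<Longrightarrow> norm (m (of_real u * s)) \<le> M * exp (- c * (u * \<bar>Re s\<bar>))"
    and p0: "norm (p 0) \<le> M0"
  shows "norm (p s) \<le> 448 * (M + M0) * exp (- c * \<bar>Re s\<bar>)"
proof -
  define X where "X = \<bar>Re s\<bar>"
  have X: "X \<ge> 0" by (simp add: X_def)
  have M0: "M0 \<ge> 0" using p0 norm_ge_zero order_trans by blast
  have ins: "of_real u * s \<in> cstrip (-h) h" if "0 \<le> u" "u \<le> 1" for u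
  proof -
    have "\<bar>u * Im s\<bar> \<le> 1 * \<bar>Im s\<bar>" unfolding abs_mult using that by (intro mult_right_mono) auto
    moreover have "\<bar>Im s\<bar> < h" using s by (auto simp: cstrip_def)
    ultimately show ?thesis by (auto simp: cstrip_def)
  qed
  have im: "\<bar>Im z\<bar> \<le> 5 * pi / 6" if "z \<in> cstrip (-h) h" for z using that h by (auto simp: cstrip_def)
  have ne: "1 + exp z \<noteq> 0" if "z \<in> cstrip (-h) h" for z using one_plus_exp_nonzero im that by blast
  define q where "q = (\<lambda>z. p z * kinv z)"
  have qd: "(q has_field_derivative m z * kinv z) (at z)" if z: "z \<in> cstrip (-h) h" for z
  proof -
    have "(p has_field_derivative deriv p z) (at z)" by (rule holomorphic_derivI[OF hol _ z]) simp
    then have "(q has_field_derivative (p z * (exp z - exp (- z)) + deriv p z * kinv z)) (at z)"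
      unfolding q_def by (rule DERIV_mult'[OF _ kinv_deriv])
    moreover have "p z * (exp z - exp (- z)) + deriv p z * kinv z = m z * kinv z"
      unfolding kinv_tnh[OF ne[OF z]] ode[OF z, symmetric] by (simp add: algebra_simps)
    ultimately show ?thesis by simp
  qed
  have sb: "norm s \<le> X + 3"
  proof -
    have "\<bar>Im s\<bar> \<le> 3" using im[OF s] pi_less_4 pi_approx by (simp add: field_simps)
    then show ?thesis using cmod_le[of s] by (simp add: X_def)
  qed
  define D where "D = 1 - c"
  have D: "1/4 \<le> D" using c by (simp add: D_def)
  \<comment> \<open>An explicit majorant. The real part X of the segment is integrated exactly,
    giving exp (D u X) / D with no factor X; its imaginary part, at most 3, is estimated
    crudely.\<close>
  define \<phi> where "\<phi> = (\<lambda>u. 4 * M * (exp (D * u * X) / D + 3 * u * exp (D * X)))"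
  define Q where "Q = (\<lambda>u::real. q (of_real u * s))"
  have "norm (Q 1 - Q 0) \<le> \<phi> 1 - \<phi> 0"
  proof (rule differentiable_bound_general[where f' = "\<lambda>u. s * (m (of_real u * s) * kinv (of_real u * s))" and \<phi>' = "\<lambda>u. 4 * M * (X * exp (D * u * X) + 3 * exp (D * X))"])
    have Qd: "(Q has_vector_derivative s * (m (of_real u * s) * kinv (of_real u * s))) (at u within A)" if "0 \<le> u" "u \<le> 1" for u A
    proof -
      have "((\<lambda>u. of_real u * s) has_vector_derivative s) (at u within A)"
        by (auto intro!: derivative_eq_intros)
      from field_vector_diff_chain_within[OF this, of q] qd[OF ins[OF that]]
      show ?thesis unfolding Q_def by (simp add: o_def has_field_derivative_at_within)
    qed
    then show "continuous_on {0..1} Q"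
      by (intro continuous_on_vector_derivative) auto
    show "(Q has_vector_derivative s * (m (of_real u * s) * kinv (of_real u * s))) (at u)" if "0 < u" "u < 1" for u
      using Qd[of u UNIV] that by simp
    show "continuous_on {0..1} \<phi>" unfolding \<phi>_def using D by (intro continuous_intros) auto
    show "(\<phi> has_vector_derivative 4 * M * (X * exp (D * u * X) + 3 * exp (D * X))) (at u)" for u
      unfolding \<phi>_def using D
      by (auto intro!: derivative_eq_intros simp: has_real_derivative_iff_has_vector_derivative[symmetric])
    fix u :: real assume u: "0 < u" "u < 1"
    have "norm (m (of_real u * s)) * norm (kinv (of_real u * s)) \<le> (M * exp (- c * (u * X))) * (4 * exp (u * X))"
    proof (intro mult_mono)
      show "norm (m (of_real u * s)) \<le> M * exp (- c * (u * X))" using m[of u] u by (simp add: X_def)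
      show "norm (kinv (of_real u * s)) \<le> 4 * exp (u * X)" using kinv_bound[of "of_real u * s"] u by (simp add: X_def abs_mult)
    qed (use M in auto)
    also have "\<dots> = 4 * M * exp (D * u * X)" by (simp add: D_def algebra_simps flip: exp_add)
    finally have mk: "norm (m (of_real u * s)) * norm (kinv (of_real u * s)) \<le> 4 * M * exp (D * u * X)" .
    have "norm s * (norm (m (of_real u * s)) * norm (kinv (of_real u * s))) \<le> (X + 3) * (4 * M * exp (D * u * X))"
      by (rule mult_mono[OF sb mk]) (use M X in auto)
    also have "\<dots> = 4 * M * (X * exp (D * u * X) + 3 * exp (D * u * X))" by (simp add: algebra_simps)
    also have "\<dots> \<le> 4 * M * (X * exp (D * u * X) + 3 * exp (D * X))"
    proof -
      have "D * u * X \<le> D * 1 * X" using D X u by (intro mult_right_mono mult_left_mono) auto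
      then show ?thesis using M by (intro mult_left_mono add_left_mono) auto
    qed
    finally show "norm (s * (m (of_real u * s) * kinv (of_real u * s))) \<le> 4 * M * (X * exp (D * u * X) + 3 * exp (D * X))"
      by (simp add: norm_mult mult.assoc)
  qed simp
  also have "\<phi> 1 - \<phi> 0 \<le> 4 * M * (exp (D * X) / D + 3 * exp (D * X))"
    using M D by (simp add: \<phi>_def algebra_simps)
  also have "\<dots> \<le> 4 * M * (4 * exp (D * X) + 3 * exp (D * X))"
  proof -
    have "exp (D * X) / D \<le> exp (D * X) / (1/4)" using D by (intro divide_left_mono) auto
    then show ?thesis using M by (intro mult_left_mono add_right_mono) auto
  qed
  finally have d1: "norm (Q 1 - Q 0) \<le> 28 * M * exp (D * X)" by simp
  have "norm (Q 0) \<le> 4 * M0"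
    using p0 by (simp add: Q_def q_def kinv_def norm_mult)
  also have "\<dots> \<le> 28 * M0 * exp (D * X)"
  proof -
    have "1 \<le> exp (D * X)" using D X by simp
    then have "M0 * 1 \<le> M0 * exp (D * X)" using M0 by (intro mult_left_mono) auto
    then show ?thesis using M0 by simp
  qed
  finally have "norm (Q 1) \<le> 28 * M * exp (D * X) + 28 * M0 * exp (D * X)"
    using d1 norm_triangle_ineq2[of "Q 1" "Q 0"] by linarith
  then have q1: "norm (p s * kinv s) \<le> 28 * (M + M0) * exp (D * X)" by (simp add: Q_def q_def algebra_simps)
  have "p s = kap s * (p s * kinv s)" using kap_kinv[OF ne[OF s]] by (simp add: algebra_simps)
  then have "norm (p s) = norm (kap s) * norm (p s * kinv s)" by (metis norm_mult)
  also have "\<dots> \<le> (16 * exp (- X)) * (28 * (M + M0) * exp (D * X))"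
    using kap_bound[OF im[OF s]] q1 M M0 by (intro mult_mono) (auto simp: X_def)
  also have "\<dots> = 448 * (M + M0) * (exp (- X) * exp (D * X))" by simp
  also have "exp (- X) * exp (D * X) = exp (- c * X)" by (simp add: D_def algebra_simps flip: exp_add)
  finally show ?thesis by (simp add: X_def)
qed

lemma deriv_cnj_cnj:
  assumes "f holomorphic_on S" "open S" "cnj z \<in> S"
  shows "((\<lambda>z. cnj (f (cnj z))) has_field_derivative cnj (deriv f (cnj z))) (at z)"
  using has_field_derivative_cnj_cnj[OF holomorphic_derivI[OF assms]] by (simp add: o_def)

lemma tnh_cnj: "tnh (cnj z) = cnj (tnh z)" by (simp add: tnh_def exp_cnj)

text \<open>The variable is \<open>s = \<beta> log y\<close>, where \<open>x = i y\<close> is the physical variable continued to the upper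
  half plane, so \<open>x > 0\<close> and \<open>x < 0\<close> are the lines \<open>Im s = -\<omega>\<close> and \<open>Im s = \<omega>\<close>. The decay rate 3/4 below and
  \<open>\<beta> = 4\<alpha>/3\<close> are matched so that \<open>exp (3 s / 4)\<close> has modulus \<open>|x|\<close> to the power \<open>\<alpha>\<close>.\<close>

locale gdg =
  fixes \<alpha> :: real
  assumes alpha: "0 < \<alpha>" "\<alpha> < 1"
begin

definition \<beta> :: real where "\<beta> = 4 * \<alpha> / 3"
definition \<omega> :: real where "\<omega> = pi * \<beta> / 2"
definition \<delta> :: real where "\<delta> = pi * \<beta> / 8"
definition Str :: "complex set" where "Str = cstrip (-(\<omega> + \<delta>)) (\<omega> + \<delta>)"
definition Inn :: "complex set" where "Inn = cstrip (-\<delta>) \<delta>"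

lemma beta: "0 < \<beta>" "\<beta> < 4 / 3" using alpha by (auto simp: \<beta>_def)

lemma om4: "\<omega> = 4 * \<delta>" by (simp add: \<omega>_def \<delta>_def)

lemma delta: "0 < \<delta>" using beta by (simp add: \<delta>_def)

lemma omega: "0 < \<omega>" "\<omega> \<le> 2 * \<beta>" using beta pi_less_4 by (auto simp: \<omega>_def)

text \<open>Here \<alpha> < 1 enters: \<beta> < 4/3 keeps the enlarged strip below height pi, where
  1 + exp s has its first zeros.\<close>

lemma width: "\<omega> + \<delta> \<le> 5 * pi / 6"
proof -
  have "pi * \<beta> \<le> pi * (4 / 3)" using beta by (intro mult_left_mono) auto
  then show ?thesis by (simp add: \<omega>_def \<delta>_def)
qed

lemma open_Str [simp]: "open Str" and open_Inn [simp]: "open Inn"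
  and convex_Str [simp]: "convex Str" and convex_Inn [simp]: "convex Inn"
  by (auto simp: Str_def Inn_def)

lemma Str_iff: "s \<in> Str \<longleftrightarrow> \<bar>Im s\<bar> < \<omega> + \<delta>" by (auto simp: Str_def cstrip_def)
lemma Inn_iff: "s \<in> Inn \<longleftrightarrow> \<bar>Im s\<bar> < \<delta>" by (auto simp: Inn_def cstrip_def)

lemma cnj_Str: "s \<in> Str \<Longrightarrow> cnj s \<in> Str" and cnj_Inn: "s \<in> Inn \<Longrightarrow> cnj s \<in> Inn"
  by (auto simp: Str_iff Inn_iff)

lemma Str_im: "s \<in> Str \<Longrightarrow> \<bar>Im s\<bar> \<le> 5 * pi / 6" using width by (auto simp: Str_iff)

lemma Str_ne: "s \<in> Str \<Longrightarrow> 1 + exp s \<noteq> 0" using one_plus_exp_nonzero Str_im by blast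

lemma zero_in_Str [simp]: "0 \<in> Str" using omega delta by (simp add: Str_iff)

section \<open>Weighted classes of holomorphic functions on the strip\<close>

abbreviation wt :: "real \<Rightarrow> real" where "wt x \<equiv> exp (- (3/4) * \<bar>x\<bar>)"
abbreviation wp :: "real \<Rightarrow> real" where "wp x \<equiv> exp (- (3/4) * max 0 x)"

text \<open>As Re s tends to plus infinity (x to infinity) F decays, but as Re s tends to minus
  infinity (x to 0) it merely approaches a constant. So F is weighted on one side only, its
  derivative on both. The symmetry under conjugation encodes that w is odd and Hw is even.\<close>

definition bnd1 :: "real \<Rightarrow> (complex \<Rightarrow> complex) \<Rightarrow> bool" where
  "bnd1 M F \<longleftrightarrow> F holomorphic_on Str \<and> (\<forall>s\<in>Str. F (cnj s) = cnj (F s)) \<and>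
     (\<forall>s\<in>Str. norm (F s) \<le> M * wp (Re s)) \<and>
     (\<forall>s\<in>Str. norm (deriv F s) \<le> M * wt (Re s))"

definition bnd2 :: "real \<Rightarrow> (complex \<Rightarrow> complex) \<Rightarrow> bool" where
  "bnd2 M F \<longleftrightarrow> bnd1 M F \<and> (\<forall>s\<in>Str. norm (deriv (deriv F) s) \<le> M * wt (Re s))"

lemma bnd1_mono: "bnd1 M F \<Longrightarrow> M \<le> M' \<Longrightarrow> bnd1 M' F"
  unfolding bnd1_def by (meson exp_ge_zero mult_right_mono order_trans)

lemma bnd2_mono: "bnd2 M F \<Longrightarrow> M \<le> M' \<Longrightarrow> bnd2 M' F"
  unfolding bnd2_def by (meson bnd1_mono exp_ge_zero mult_right_mono order_trans)

lemma bnd1_nonneg: "bnd1 M F \<Longrightarrow> M \<ge> 0"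
proof -
  assume "bnd1 M F"
  then have "norm (F 0) \<le> M * exp (- (3/4) * max 0 (Re 0))" unfolding bnd1_def using zero_in_Str by blast
  then have "norm (F 0) \<le> M" by simp
  then show ?thesis using norm_ge_zero[of "F 0"] by linarith
qed

lemma bnd1_hol: "bnd1 M F \<Longrightarrow> F holomorphic_on Str" by (simp add: bnd1_def)
lemma bnd1_deriv: "bnd1 M F \<Longrightarrow> s \<in> Str \<Longrightarrow> (F has_field_derivative deriv F s) (at s)"
  using holomorphic_derivI[OF bnd1_hol] by simp
lemma bnd2_bnd1: "bnd2 M F \<Longrightarrow> bnd1 M F" by (simp add: bnd2_def)
lemma bnd2_nonneg: "bnd2 M F \<Longrightarrow> M \<ge> 0" using bnd1_nonneg bnd2_bnd1 by blast
lemma bnd2_hol: "bnd2 M F \<Longrightarrow> F holomorphic_on Str" using bnd2_bnd1 bnd1_hol by blast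
lemma bnd2_hol': "bnd2 M F \<Longrightarrow> deriv F holomorphic_on Str" using bnd2_hol holomorphic_deriv open_Str by blast
lemma bnd2_deriv: "bnd2 M F \<Longrightarrow> s \<in> Str \<Longrightarrow> (F has_field_derivative deriv F s) (at s)"
  using bnd1_deriv bnd2_bnd1 by blast
lemma bnd2_deriv2: "bnd2 M F \<Longrightarrow> s \<in> Str \<Longrightarrow> (deriv F has_field_derivative deriv (deriv F) s) (at s)"
  using holomorphic_derivI[OF bnd2_hol'] by simp
lemma bnd1_bound: "bnd1 M F \<Longrightarrow> s \<in> Str \<Longrightarrow> norm (F s) \<le> M * wp (Re s)" by (simp add: bnd1_def)
lemma bnd1_bound': "bnd1 M F \<Longrightarrow> s \<in> Str \<Longrightarrow> norm (deriv F s) \<le> M * wt (Re s)" by (simp add: bnd1_def)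
lemma bnd2_bound'': "bnd2 M F \<Longrightarrow> s \<in> Str \<Longrightarrow> norm (deriv (deriv F) s) \<le> M * wt (Re s)" by (simp add: bnd2_def)
lemma bnd1_sym: "bnd1 M F \<Longrightarrow> s \<in> Str \<Longrightarrow> F (cnj s) = cnj (F s)" by (simp add: bnd1_def)

lemma bnd1_le: assumes "bnd1 M F" "s \<in> Str" shows "norm (F s) \<le> M"
proof -
  have "norm (F s) \<le> M * wp (Re s)" by (rule bnd1_bound[OF assms])
  also have "\<dots> \<le> M * 1" using bnd1_nonneg[OF assms(1)] by (intro mult_left_mono) auto
  finally show ?thesis by simp
qed

lemma bnd1_le': assumes "bnd1 M F" "s \<in> Str" shows "norm (deriv F s) \<le> M"
proof -
  have "norm (deriv F s) \<le> M * wt (Re s)" by (rule bnd1_bound'[OF assms])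
  also have "\<dots> \<le> M * 1" using bnd1_nonneg[OF assms(1)] by (intro mult_left_mono) auto
  finally show ?thesis by simp
qed

lemma bnd1_zero: "bnd1 0 (\<lambda>_. 0)" by (auto simp: bnd1_def)

lemma bnd1_add: assumes F: "bnd1 M F" and G: "bnd1 M' G" shows "bnd1 (M + M') (\<lambda>s. F s + G s)"
  unfolding bnd1_def
proof (intro conjI ballI)
  show "(\<lambda>s. F s + G s) holomorphic_on Str" by (intro holomorphic_intros bnd1_hol[OF F] bnd1_hol[OF G])
  fix s assume s: "s \<in> Str"
  show "F (cnj s) + G (cnj s) = cnj (F s + G s)" using bnd1_sym[OF F s] bnd1_sym[OF G s] by simp
  show "norm (F s + G s) \<le> (M + M') * wp (Re s)"
    unfolding distrib_right by (intro norm_triangle_le add_mono bnd1_bound F G s)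
  have "deriv (\<lambda>s. F s + G s) s = deriv F s + deriv G s"
    by (intro DERIV_imp_deriv DERIV_add bnd1_deriv[OF F s] bnd1_deriv[OF G s])
  then show "norm (deriv (\<lambda>s. F s + G s) s) \<le> (M + M') * wt (Re s)"
    unfolding distrib_right by (simp only:) (intro norm_triangle_le add_mono bnd1_bound' F G s)
qed

lemma bnd1_sum:
  assumes "finite I" "\<And>i. i \<in> I \<Longrightarrow> bnd1 (M i) (F i)"
  shows "bnd1 (\<Sum>i\<in>I. M i) (\<lambda>s. \<Sum>i\<in>I. F i s)"
  using assms
proof (induction I rule: finite_induct)
  case empty then show ?case using bnd1_zero by simp
next
  case (insert i I) then show ?case using bnd1_add[of "M i" "F i"] by simp
qed

lemma bnd1_half: assumes F: "bnd1 M F" shows "bnd1 (M / 2) (\<lambda>s. F s / 2)"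
  unfolding bnd1_def
proof (intro conjI ballI)
  show "(\<lambda>s. F s / 2) holomorphic_on Str" by (intro holomorphic_intros bnd1_hol[OF F]) auto
  fix s assume s: "s \<in> Str"
  show "F (cnj s) / 2 = cnj (F s / 2)" using bnd1_sym[OF F s] by simp
  show "norm (F s / 2) \<le> M / 2 * wp (Re s)" using bnd1_bound[OF F s] by (simp add: norm_divide)
  have "deriv (\<lambda>s. F s / 2) s = deriv F s / 2"
    by (intro DERIV_imp_deriv DERIV_cdivide bnd1_deriv[OF F s])
  then show "norm (deriv (\<lambda>s. F s / 2) s) \<le> M / 2 * wt (Re s)"
    using bnd1_bound'[OF F s] by (simp only: norm_divide) simp
qed

lemma bnd1_mult: assumes F: "bnd1 M F" and G: "bnd1 M' G" shows "bnd1 (2 * M * M') (\<lambda>s. F s * G s)"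
  unfolding bnd1_def
proof (intro conjI ballI)
  note M = bnd1_nonneg[OF F] bnd1_nonneg[OF G]
  show "(\<lambda>s. F s * G s) holomorphic_on Str" by (intro holomorphic_intros bnd1_hol[OF F] bnd1_hol[OF G])
  fix s assume s: "s \<in> Str"
  show "F (cnj s) * G (cnj s) = cnj (F s * G s)" using bnd1_sym[OF F s] bnd1_sym[OF G s] by simp
  have "norm (F s) * norm (G s) \<le> (M * wp (Re s)) * M'"
    by (rule mult_mono[OF bnd1_bound[OF F s] bnd1_le[OF G s]]) (use M in auto)
  also have "\<dots> \<le> 2 * M * M' * wp (Re s)" using M by (simp add: mult_ac)
  finally show "norm (F s * G s) \<le> 2 * M * M' * wp (Re s)" by (simp add: norm_mult)
  have d: "deriv (\<lambda>s. F s * G s) s = F s * deriv G s + deriv F s * G s"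
    by (intro DERIV_imp_deriv DERIV_mult' bnd1_deriv[OF F s] bnd1_deriv[OF G s])
  have "norm (F s) * norm (deriv G s) \<le> M * (M' * wt (Re s))"
    by (rule mult_mono[OF bnd1_le[OF F s] bnd1_bound'[OF G s]]) (use M in auto)
  moreover have "norm (deriv F s) * norm (G s) \<le> (M * wt (Re s)) * M'"
    by (rule mult_mono[OF bnd1_bound'[OF F s] bnd1_le[OF G s]]) (use M in auto)
  ultimately have "norm (F s) * norm (deriv G s) + norm (deriv F s) * norm (G s) \<le> 2 * M * M' * wt (Re s)"
    by (simp add: mult_ac)
  then show "norm (deriv (\<lambda>s. F s * G s) s) \<le> 2 * M * M' * wt (Re s)"
    unfolding d by (intro norm_triangle_le) (simp add: norm_mult)
qed

text \<open>Variation of constants with \<open>kap\<close>; the primitive vanishing at 0 selects the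
  solution with f(0) = 0. The source is controlled with one derivative and the solution with two: f'
  solves the differentiated equation, from which f'' is then read off.\<close>

lemma linearised_solvable:
  assumes N: "bnd1 M N"
  shows "\<exists>f. bnd2 (10^8 * M) f \<and> (\<forall>s\<in>Str. deriv f s + tnh s * f s = N s)"
proof -
  note M = bnd1_nonneg[OF N]
  have hk: "kap holomorphic_on Str"
    using kap_deriv[OF Str_ne] by (intro holomorphic_onI) (auto simp: field_differentiable_def intro: has_field_derivative_at_within)
  have "(\<lambda>s. N s * kinv s) holomorphic_on Str"
    unfolding kinv_def by (intro holomorphic_intros bnd1_hol[OF N])
  from holomorphic_convex_primitive'[OF convex_Str open_Str this]
  obtain h0 where h0: "\<And>s. s \<in> Str \<Longrightarrow> (h0 has_field_derivative N s * kinv s) (at s within Str)" by blast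
  define f where "f = (\<lambda>s. kap s * (h0 s - h0 0))"
  have fd: "(f has_field_derivative N s - tnh s * f s) (at s)" if s: "s \<in> Str" for s
  proof -
    have "(h0 has_field_derivative N s * kinv s) (at s)" using h0[OF s] at_within_open[OF s open_Str] by simp
    then have "(f has_field_derivative kap s * (N s * kinv s - 0) + - (tnh s * kap s) * (h0 s - h0 0)) (at s)"
      unfolding f_def by (intro DERIV_mult' kap_deriv[OF Str_ne[OF s]] DERIV_diff DERIV_const)
    moreover have "kap s * (N s * kinv s - 0) + - (tnh s * kap s) * (h0 s - h0 0) = N s * (kap s * kinv s) - tnh s * f s"
      by (simp add: f_def algebra_simps)
    ultimately show ?thesis by (simp only: kap_kinv[OF Str_ne[OF s]] mult_1_right)
  qed
  have fh: "f holomorphic_on Str"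
    using fd by (intro holomorphic_onI) (auto simp: field_differentiable_def intro: has_field_derivative_at_within)
  have df: "deriv f s = N s - tnh s * f s" if "s \<in> Str" for s by (rule DERIV_imp_deriv[OF fd[OF that]])
  have ode: "deriv f s + tnh s * f s = N s" if "s \<in> Str" for s using df[OF that] by simp
  have f0: "f 0 = 0" by (simp add: f_def)
  have us: "of_real u * s \<in> Str" if "0 \<le> u" "u \<le> 1" "s \<in> Str" for u s
  proof -
    have "\<bar>u * Im s\<bar> \<le> 1 * \<bar>Im s\<bar>" unfolding abs_mult using that by (intro mult_right_mono) auto
    then show ?thesis using that by (auto simp: Str_iff)
  qed
  \<comment> \<open>To the right the decay of \<open>N\<close> is passed on with rate 3/4; to the
    left \<open>N\<close> is only bounded, and \<open>ode_bound\<close> is used with rate 0.\<close>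
  have fb: "norm (f s) \<le> 448 * M * wp (Re s)" if s: "s \<in> Str" for s
  proof (cases "Re s \<ge> 0")
    case True
    have "norm (f s) \<le> 448 * (M + 0) * wt (Re s)"
    proof (rule ode_bound[OF width s[unfolded Str_def] fh[unfolded Str_def] ode[unfolded Str_def]])
      fix u :: real assume u: "0 \<le> u" "u \<le> 1"
      show "norm (N (of_real u * s)) \<le> M * exp (- (3/4) * (u * \<bar>Re s\<bar>))"
        using bnd1_bound[OF N us[OF u s]] u True by (simp add: max_def split: if_splits)
    qed (use M f0 in auto)
    then show ?thesis using True by simp
  next
    case False
    have "norm (f s) \<le> 448 * (M + 0) * exp (- 0 * \<bar>Re s\<bar>)"
    proof (rule ode_bound[OF width s[unfolded Str_def] fh[unfolded Str_def] ode[unfolded Str_def]])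
      fix u :: real assume u: "0 \<le> u" "u \<le> 1"
      show "norm (N (of_real u * s)) \<le> M * exp (- 0 * (u * \<bar>Re s\<bar>))"
        using bnd1_le[OF N us[OF u s]] by simp
    qed (use M f0 in auto)
    then show ?thesis using False by simp
  qed
  have wmono: "wp x \<le> 1" for x :: real by simp
  have fb1: "norm (f s) \<le> 448 * M" if s: "s \<in> Str" for s
  proof -
    have "448 * M * wp (Re s) \<le> 448 * M * 1" using M wmono by (intro mult_left_mono) auto
    with fb[OF s] show ?thesis by simp
  qed
  \<comment> \<open>The difference of f and its reflection solves the homogeneous equation and
    vanishes at 0, so \<open>ode_bound\<close> with zero constants serves as a uniqueness
    theorem.\<close>
  have sym: "f (cnj s) = cnj (f s)" if s: "s \<in> Str" for s
  proof -
    define d where "d = (\<lambda>s. cnj (f (cnj s)) - f s)"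
    have dd: "(d has_field_derivative - (tnh z * d z)) (at z)" if z: "z \<in> Str" for z
    proof -
      have "(d has_field_derivative cnj (deriv f (cnj z)) - deriv f z) (at z)"
        unfolding d_def using deriv_cnj_cnj[OF fh open_Str cnj_Str[OF z]] fd[OF z] df[OF z] by (intro DERIV_diff) auto
      moreover have "cnj (deriv f (cnj z)) - deriv f z = - (tnh z * d z)"
        using bnd1_sym[OF N z] by (simp add: df[OF z] df[OF cnj_Str[OF z]] d_def tnh_cnj algebra_simps)
      ultimately show ?thesis by simp
    qed
    have "norm (d s) \<le> 448 * (0 + 0) * exp (- 0 * \<bar>Re s\<bar>)"
    proof (rule ode_bound[OF width s[unfolded Str_def]])
      show "d holomorphic_on cstrip (- (\<omega> + \<delta>)) (\<omega> + \<delta>)"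
        using dd unfolding Str_def[symmetric] by (intro holomorphic_onI) (auto simp: field_differentiable_def intro: has_field_derivative_at_within)
      show "deriv d z + tnh z * d z = (\<lambda>_. 0) z" if "z \<in> cstrip (- (\<omega> + \<delta>)) (\<omega> + \<delta>)" for z
        using DERIV_imp_deriv[OF dd] that unfolding Str_def by simp
    qed (auto simp: d_def f0)
    then have "cnj (f (cnj s)) = f s" by (simp add: d_def)
    then show ?thesis by (metis complex_cnj_cnj)
  qed
  \<comment> \<open>The right side of the equation for f'. It decays on both sides although f does
    not, because the derivative of \<open>tnh\<close> is twice \<open>kap\<close>.\<close>
  define m where "m = (\<lambda>s. deriv N s - 2 * kap s * f s)"
  have p': "(deriv f has_field_derivative m s - tnh s * deriv f s) (at s)" if s: "s \<in> Str" for s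
  proof -
    have "((\<lambda>s. N s - tnh s * f s) has_field_derivative (deriv N s - (tnh s * deriv f s + 2 * kap s * f s))) (at s)"
      by (intro DERIV_diff DERIV_mult' bnd1_deriv[OF N s] tnh_deriv[OF Str_ne[OF s]]) (use fd[OF s] df[OF s] in simp)
    then have "(deriv f has_field_derivative (deriv N s - (tnh s * deriv f s + 2 * kap s * f s))) (at s)"
      by (rule has_field_derivative_transform_within_open[OF _ open_Str s]) (simp add: df)
    then show ?thesis by (simp add: m_def algebra_simps)
  qed
  have ph: "deriv f holomorphic_on Str" by (rule holomorphic_deriv[OF fh open_Str])
  have mb: "norm (m s) \<le> 14337 * M * wt (Re s)" if s: "s \<in> Str" for s
  proof -
    have "norm (2 * kap s * f s) \<le> 2 * (16 * exp (- \<bar>Re s\<bar>)) * (448 * M)"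
      unfolding norm_mult by (intro mult_mono kap_bound[OF Str_im[OF s]] fb1[OF s]) (use M in auto)
    also have "\<dots> \<le> 14336 * M * wt (Re s)"
    proof -
      have "exp (- \<bar>Re s\<bar>) \<le> wt (Re s)" by simp
      then have "14336 * M * exp (- \<bar>Re s\<bar>) \<le> 14336 * M * wt (Re s)" using M by (intro mult_left_mono) auto
      then show ?thesis by (simp add: mult_ac)
    qed
    finally have "norm (2 * kap s * f s) \<le> 14336 * M * wt (Re s)" .
    moreover have "norm (m s) \<le> norm (deriv N s) + norm (2 * kap s * f s)" unfolding m_def by (rule norm_triangle_ineq4)
    ultimately show ?thesis using bnd1_bound'[OF N s] by linarith
  qed
  have pb: "norm (deriv f s) \<le> 6423424 * M * wt (Re s)" if s: "s \<in> Str" for s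
  proof -
    have "norm (deriv f s) \<le> 448 * (14337 * M + M) * wt (Re s)"
    proof (rule ode_bound[OF width s[unfolded Str_def] ph[unfolded Str_def]])
      show "deriv (deriv f) z + tnh z * deriv f z = m z" if "z \<in> cstrip (- (\<omega> + \<delta>)) (\<omega> + \<delta>)" for z
        using DERIV_imp_deriv[OF p'] that unfolding Str_def by simp
      show "norm (deriv f 0) \<le> M" using df[of 0] f0 bnd1_le[OF N, of 0] by simp
      fix u :: real assume u: "0 \<le> u" "u \<le> 1"
      show "norm (m (of_real u * s)) \<le> (14337 * M) * exp (- (3/4) * (u * \<bar>Re s\<bar>))"
        using mb[OF us[OF u s]] u by (simp add: abs_mult)
    qed (use M in auto)
    then show ?thesis by simp
  qed
  have p'b: "norm (deriv (deriv f) s) \<le> 10^8 * M * wt (Re s)" if s: "s \<in> Str" for s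
  proof -
    have "norm (tnh s * deriv f s) \<le> 4 * (6423424 * M * wt (Re s))"
      unfolding norm_mult by (intro mult_mono tnh_bound[OF Str_im[OF s]] pb[OF s]) (use M in auto)
    moreover have "norm (m s - tnh s * deriv f s) \<le> norm (m s) + norm (tnh s * deriv f s)" by (rule norm_triangle_ineq4)
    ultimately have "norm (deriv (deriv f) s) \<le> 25708033 * (M * wt (Re s))"
      using DERIV_imp_deriv[OF p'[OF s]] mb[OF s] by simp
    also have "\<dots> \<le> 10^8 * (M * wt (Re s))" using M by (intro mult_right_mono) auto
    finally show ?thesis by simp
  qed
  have "bnd2 (10^8 * M) f" unfolding bnd2_def bnd1_def
  proof (intro conjI ballI fh sym p'b)
    fix s assume s: "s \<in> Str"
    have "448 * M * wp (Re s) \<le> 10^8 * M * wp (Re s)"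
      using M by (intro mult_right_mono) auto
    then show "norm (f s) \<le> 10^8 * M * wp (Re s)" using fb[OF s] by linarith
    have "6423424 * M * wt (Re s) \<le> 10^8 * M * wt (Re s)"
      using M by (intro mult_right_mono) auto
    then show "norm (deriv f s) \<le> 10^8 * M * wt (Re s)" using pb[OF s] by linarith
  qed
  then show ?thesis using ode by blast
qed

section \<open>The explicit profile for a = 0\<close>

definition Z0 :: "complex \<Rightarrow> complex" where "Z0 s = 2 / (1 + exp s)"

lemma Z0_deriv: "s \<in> Str \<Longrightarrow> (Z0 has_field_derivative - 2 * kap s) (at s)"
  unfolding Z0_def kap_def using Str_ne[of s] by (auto intro!: derivative_eq_intros simp: power2_eq_square)

lemma tnh_Z0: "s \<in> Str \<Longrightarrow> tnh s = 1 - Z0 s"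
  unfolding Z0_def tnh_def using Str_ne[of s] by (simp add: field_simps)

lemma Z0_ode: assumes s: "s \<in> Str" shows "deriv Z0 s + Z0 s - Z0 s * Z0 s / 2 = 0"
proof -
  define d where "d = 1 + exp s"
  have e: "exp s = d - 1" "d \<noteq> 0" using Str_ne[OF s] by (auto simp: d_def)
  show ?thesis unfolding DERIV_imp_deriv[OF Z0_deriv[OF s]] unfolding Z0_def kap_def d_def[symmetric] unfolding e(1)
    using e(2) by (simp add: field_simps power2_eq_square)
qed

lemma bnd2_Z0: "bnd2 128 Z0"
  unfolding bnd2_def bnd1_def
proof (intro conjI ballI)
  show "Z0 holomorphic_on Str"
    using Z0_deriv by (intro holomorphic_onI) (auto simp: field_differentiable_def intro: has_field_derivative_at_within)
  fix s assume s: "s \<in> Str"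
  show "Z0 (cnj s) = cnj (Z0 s)" by (simp add: Z0_def exp_cnj)
  show "norm (Z0 s) \<le> 128 * wp (Re s)"
  proof -
    have p: "0 < 1 + exp (Re s)" by (simp add: add_pos_pos)
    have "norm (Z0 s) = 2 / norm (1 + exp s)" by (simp add: Z0_def norm_divide)
    also have "\<dots> \<le> 2 / ((1 + exp (Re s)) / 4)"
      using cmod_one_plus_exp_ge[OF Str_im[OF s]] p by (intro divide_left_mono mult_pos_pos) auto
    also have "\<dots> = 8 * (1 / (1 + exp (Re s)))" by simp
    also have "\<dots> \<le> 8 * (1 / exp (max 0 (Re s)))" using p
      by (intro mult_left_mono divide_left_mono mult_pos_pos) (auto simp: max_def)
    also have "\<dots> = 8 * exp (- max 0 (Re s))" by (simp add: exp_minus field_simps)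
    also have "\<dots> \<le> 128 * wp (Re s)" by (intro mult_mono) (auto simp: max_def)
    finally show ?thesis .
  qed
  have w: "exp (- \<bar>Re s\<bar>) \<le> wt (Re s)" by simp
  have "norm (- 2 * kap s) \<le> 32 * exp (- \<bar>Re s\<bar>)" using kap_bound[OF Str_im[OF s]] by (simp add: norm_mult)
  then show "norm (deriv Z0 s) \<le> 128 * wt (Re s)"
    unfolding DERIV_imp_deriv[OF Z0_deriv[OF s]] using w exp_ge_zero[of "- \<bar>Re s\<bar>"] by linarith
  have "(deriv Z0 has_field_derivative - 2 * - (tnh s * kap s)) (at s)"
  proof (rule has_field_derivative_transform_within_open[OF _ open_Str s])
    show "((\<lambda>s. - 2 * kap s) has_field_derivative - 2 * - (tnh s * kap s)) (at s)"
      by (intro DERIV_cmult kap_deriv Str_ne s)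
  qed (simp add: DERIV_imp_deriv[OF Z0_deriv])
  then have "deriv (deriv Z0) s = 2 * (tnh s * kap s)" by (simp add: DERIV_imp_deriv)
  moreover have "norm (tnh s) * norm (kap s) \<le> 4 * (16 * exp (- \<bar>Re s\<bar>))"
    by (intro mult_mono tnh_bound kap_bound Str_im s) auto
  ultimately have "norm (deriv (deriv Z0) s) \<le> 128 * exp (- \<bar>Re s\<bar>)" by (simp add: norm_mult mult.commute)
  then show "norm (deriv (deriv Z0) s) \<le> 128 * wt (Re s)" using w by linarith
qed

end

section \<open>The nonlocal term\<close>

lemma DERIV_shift_minus:
  "(f has_field_derivative D) (at (x - c)) \<Longrightarrow> ((\<lambda>x. f (x - c)) has_field_derivative D) (at x)"
  using DERIV_shift[of f D x "- c"] by simp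

lemma norm_integral_le:
  fixes f :: "'a \<Rightarrow> complex" and B :: "'a \<Rightarrow> real"
  assumes "integrable M B" "\<And>x. x \<in> space M \<Longrightarrow> norm (f x) \<le> B x"
  shows "norm (\<integral>x. f x \<partial>M) \<le> (\<integral>x. B x \<partial>M)"
proof (cases "integrable M f")
  case True
  have "norm (\<integral>x. f x \<partial>M) \<le> (\<integral>x. norm (f x) \<partial>M)" by (rule integral_norm_bound)
  also have "\<dots> \<le> (\<integral>x. B x \<partial>M)" using True assms by (intro integral_mono) auto
  finally show ?thesis .
next
  case False
  have "0 \<le> (\<integral>x. B x \<partial>M)"
    using assms(2) norm_ge_zero order_trans by (intro Bochner_Integration.integral_nonneg) blast
  then show ?thesis using False by (simp add: not_integrable_integral_eq)
qed

context gdg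
begin

text \<open>The kernel has period 2 i \<omega> and simple poles at i \<omega> and -i \<omega>; it
  tends to 1 on the left and to 0 on the right. Its convolutions therefore decay to the right only,
  and they jump across one period.\<close>

definition K :: "complex \<Rightarrow> complex" where "K z = 1 / (1 + exp (2 * z / of_real \<beta>))"

lemma beta2: "3/2 \<le> 2 / \<beta>" "1 / \<beta> \<le> 2 / \<beta> - 3/4" using beta by (auto simp: field_simps)

lemma K_im: assumes "\<bar>Im z\<bar> < \<omega>" shows "\<bar>Im (2 * z / of_real \<beta>)\<bar> < pi"
proof -
  have "2 / \<beta> * \<bar>Im z\<bar> < 2 / \<beta> * \<omega>" using assms beta by (intro mult_strict_left_mono) auto
  moreover have "2 / \<beta> * \<omega> = pi" using beta by (simp add: \<omega>_def)
  moreover have "\<bar>Im (2 * z / of_real \<beta>)\<bar> = 2 / \<beta> * \<bar>Im z\<bar>" using beta by (simp add: abs_mult)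
  ultimately show ?thesis by simp
qed

lemma K_ne: assumes "\<bar>Im z\<bar> < \<omega>" shows "1 + exp (2 * z / of_real \<beta>) \<noteq> 0"
proof
  assume a: "1 + exp (2 * z / of_real \<beta>) = 0"
  then have "exp (2 * z / of_real \<beta>) = - 1" by (metis add_eq_0_iff add.commute)
  then have "exp (2 * z / of_real \<beta>) = exp (of_real pi * \<i>)" by (simp only: exp_pi_i)
  then obtain n :: int where n: "2 * z / of_real \<beta> = of_real pi * \<i> + (of_int (2 * n) * pi) * \<i>"
    unfolding exp_eq by blast
  have "Im (2 * z / of_real \<beta>) = (1 + 2 * of_int n) * pi" unfolding n by (simp add: algebra_simps)
  then have "\<bar>1 + 2 * real_of_int n\<bar> * pi < 1 * pi" using K_im[OF assms] by (simp add: abs_mult)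
  then have "\<bar>1 + 2 * real_of_int n\<bar> < 1" using mult_less_cancel_right_pos pi_gt_zero by blast
  then have "\<bar>1 + 2 * n\<bar> < 1" by linarith
  then show False by presburger
qed

lemma K_deriv: assumes "\<bar>Im z\<bar> < \<omega>"
  shows "(K has_field_derivative - (2 / of_real \<beta>) * kap (2 * z / of_real \<beta>)) (at z)"
  unfolding K_def kap_def using K_ne[OF assms] beta
  by (auto intro!: derivative_eq_intros simp: power2_eq_square)

text \<open>The height 4/5 \<omega> is what the choice \<tau> = Im s / 5 leaves when |Im s| \<le>
  \<omega>. It keeps 2 z / \<beta> within height 4 pi / 5 < 5 pi / 6, uniformly in \<beta>.\<close>

lemma K_near:
  assumes z: "\<bar>Im z\<bar> \<le> 4/5 * \<omega>"
  shows "norm (K z) \<le> 4 * exp (- (3/2) * max 0 (Re z))"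
    and "norm (kap (2 * z / of_real \<beta>)) \<le> 16 * exp (- (2 / \<beta>) * \<bar>Re z\<bar>)"
proof -
  have im: "\<bar>Im (2 * z / of_real \<beta>)\<bar> \<le> 5 * pi / 6"
  proof -
    have "2 / \<beta> * \<bar>Im z\<bar> \<le> 2 / \<beta> * (4/5 * \<omega>)" using assms beta by (intro mult_left_mono) auto
    moreover have "2 / \<beta> * (4/5 * \<omega>) = 4/5 * pi" using beta by (simp add: \<omega>_def)
    moreover have "\<bar>Im (2 * z / of_real \<beta>)\<bar> = 2 / \<beta> * \<bar>Im z\<bar>" using beta by (simp add: abs_mult)
    ultimately show ?thesis using pi_gt_zero by linarith
  qed
  have re: "Re (2 * z / of_real \<beta>) = 2 / \<beta> * Re z" by simp
  have p: "0 < 1 + exp (2 / \<beta> * Re z)" by (simp add: add_pos_pos)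
  have g: "(1 + exp (2 / \<beta> * Re z)) / 4 \<le> norm (1 + exp (2 * z / of_real \<beta>))"
    using cmod_one_plus_exp_ge[OF im] unfolding re .
  have "norm (K z) = 1 / norm (1 + exp (2 * z / of_real \<beta>))" by (simp add: K_def norm_divide)
  also have "\<dots> \<le> 1 / ((1 + exp (2 / \<beta> * Re z)) / 4)"
  proof (rule divide_left_mono[OF g])
    show "0 < norm (1 + exp (2 * z / of_real \<beta>)) * ((1 + exp (2 / \<beta> * Re z)) / 4)"
      using g p by (intro mult_pos_pos) (auto intro: less_le_trans[rotated])
  qed simp
  also have "\<dots> = 4 * (1 / (1 + exp (2 / \<beta> * Re z)))" by simp
  also have "\<dots> \<le> 4 * (1 / exp (3/2 * max 0 (Re z)))"
  proof -
    have "exp (3/2 * max 0 (Re z)) \<le> 1 + exp (2 / \<beta> * Re z)"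
    proof (cases "Re z \<ge> 0")
      case True
      then have "3/2 * Re z \<le> 2 / \<beta> * Re z" using beta2(1) by (rule mult_right_mono[rotated])
      then have "exp (3/2 * Re z) \<le> exp (2 / \<beta> * Re z)" by simp
      with True show ?thesis by (simp add: max_def add_increasing)
    qed (simp add: max_def)
    then show ?thesis using p by (intro mult_left_mono divide_left_mono mult_pos_pos) auto
  qed
  finally show "norm (K z) \<le> 4 * exp (- (3/2) * max 0 (Re z))" by (simp add: exp_minus field_simps)
  have "norm (kap (2 * z / of_real \<beta>)) \<le> 16 * exp (- \<bar>Re (2 * z / of_real \<beta>)\<bar>)" by (rule kap_bound[OF im])
  then show "norm (kap (2 * z / of_real \<beta>)) \<le> 16 * exp (- (2 / \<beta>) * \<bar>Re z\<bar>)"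
    unfolding re using beta by (simp add: abs_mult)
qed

text \<open>A qualitative bound at any height below the poles. Its constant depends on the height
  and serves only to justify differentiation under the integral and the moving of lines.\<close>

lemma K_bounded:
  assumes y: "y < \<omega>"
  shows "\<exists>C. \<forall>z. \<bar>Im z\<bar> \<le> y \<longrightarrow> norm (K z) \<le> C"
proof -
  define R where "R = \<beta>"
  have "compact (cbox (Complex (-R) (-y)) (Complex R y))" by simp
  moreover have "continuous_on (cbox (Complex (-R) (-y)) (Complex R y)) K"
  proof (intro continuous_at_imp_continuous_on ballI)
    fix z assume "z \<in> cbox (Complex (-R) (-y)) (Complex R y)"
    then have "\<bar>Im z\<bar> < \<omega>" using y by (auto simp: in_cbox_complex_iff)
    then show "isCont K z" using K_deriv DERIV_isCont by blast
  qed
  ultimately have "bounded (K ` cbox (Complex (-R) (-y)) (Complex R y))"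
    by (meson compact_continuous_image compact_imp_bounded)
  then obtain D where "\<forall>x\<in>K ` cbox (Complex (-R) (-y)) (Complex R y). norm x \<le> D" unfolding bounded_iff by blast
  then have D: "norm (K z) \<le> D" if "z \<in> cbox (Complex (-R) (-y)) (Complex R y)" for z using that by blast
  have "norm (K z) \<le> max D 2" if z: "\<bar>Im z\<bar> \<le> y" for z
  proof (cases "\<bar>Re z\<bar> \<le> R")
    case True
    then have "z \<in> cbox (Complex (-R) (-y)) (Complex R y)" using z by (auto simp: in_cbox_complex_iff)
    then show ?thesis using D by fastforce
  next
    case False
    define v where "v = 2 * z / of_real \<beta>"
    have "2 / \<beta> * \<beta> \<le> 2 / \<beta> * \<bar>Re z\<bar>" using False beta by (intro mult_left_mono) (auto simp: R_def)
    moreover have "\<bar>Re v\<bar> = 2 / \<beta> * \<bar>Re z\<bar>" using beta by (simp add: abs_mult v_def)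
    ultimately have R1: "2 \<le> \<bar>Re v\<bar>" using beta by simp
    have "1 / 2 \<le> norm (1 + exp v)"
    proof (cases "Re v \<ge> 0")
      case True
      have "2 \<le> exp (Re v)" using exp_ge_add_one_self[of "Re v"] R1 True by linarith
      moreover have "exp (Re v) - 1 \<le> norm (1 + exp v)" using norm_triangle_ineq2[of "exp v" "-1"] by (simp add: add.commute)
      ultimately show ?thesis by linarith
    next
      case False
      have "2 \<le> exp (- Re v)" using exp_ge_add_one_self[of "- Re v"] R1 False by linarith
      then have "exp (Re v) \<le> 1 / 2" by (simp add: exp_minus field_simps)
      moreover have "1 - exp (Re v) \<le> norm (1 + exp v)" using norm_triangle_ineq2[of 1 "- exp v"] by simp
      ultimately show ?thesis by linarith
    qed
    then have "1 / norm (1 + exp v) \<le> 1 / (1 / 2)" by (intro divide_left_mono mult_pos_pos) auto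
    then show ?thesis by (simp add: K_def v_def norm_divide max_def)
  qed
  then show ?thesis by blast
qed

text \<open>The line of integration is a free parameter; \<open>Nop\<close> moves it with \<open>s\<close>, which continues the
  Cauchy-type integral across \<open>|Im s| = \<omega>\<close>, where the jump relation then yields the bounds.\<close>

definition Nt :: "(complex \<Rightarrow> complex) \<Rightarrow> real \<Rightarrow> complex \<Rightarrow> complex" where
  "Nt g \<tau> s = 2 / (of_real pi * of_real \<beta>) * (\<integral>r. g (Complex r \<tau>) * K (s - Complex r \<tau>) \<partial>lborel)"

definition Nop :: "(complex \<Rightarrow> complex) \<Rightarrow> complex \<Rightarrow> complex" where
  "Nop g s = Nt g (Im s / 5) s"

context
  fixes g :: "complex \<Rightarrow> complex" and \<Gamma> \<Gamma>' :: real
  assumes hol: "g holomorphic_on Inn"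
    and sym: "\<And>s. s \<in> Inn \<Longrightarrow> g (cnj s) = cnj (g s)"
    and bd: "\<And>s. s \<in> Inn \<Longrightarrow> norm (g s) \<le> \<Gamma> * wt (Re s)"
    and bd': "\<And>s. s \<in> Inn \<Longrightarrow> norm (deriv g s) \<le> \<Gamma>' * wt (Re s)"
begin

lemma Gamma_nonneg: "\<Gamma> \<ge> 0" "\<Gamma>' \<ge> 0"
proof -
  have z: "0 \<in> Inn" using delta by (simp add: Inn_iff)
  have "norm (g 0) \<le> \<Gamma>" "norm (deriv g 0) \<le> \<Gamma>'" using bd[OF z] bd'[OF z] by auto
  then show "\<Gamma> \<ge> 0" "\<Gamma>' \<ge> 0" using norm_ge_zero order_trans by blast+
qed

lemma line_in_Inn: "\<bar>\<tau>\<bar> < \<delta> \<Longrightarrow> Complex r \<tau> \<in> Inn" by (simp add: Inn_iff)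

lemma cont_Complex: "continuous_on UNIV (\<lambda>r. Complex r \<tau>)" by (simp add: Complex_eq) (intro continuous_intros)

lemma cont_g_line: "\<bar>\<tau>\<bar> < \<delta> \<Longrightarrow> continuous_on UNIV (\<lambda>r. g (Complex r \<tau>))"
  by (rule continuous_on_compose2[OF holomorphic_on_imp_continuous_on[OF hol] cont_Complex]) (use line_in_Inn in auto)

lemma Nt_deriv:
  assumes t: "\<bar>\<tau>\<bar> < \<delta>" and s: "\<bar>Im s - \<tau>\<bar> < \<omega>"
  shows "(Nt g \<tau> has_field_derivative (2 / (of_real pi * of_real \<beta>) *
     (\<integral>r. g (Complex r \<tau>) * (- (2 / of_real \<beta>) * kap (2 * (s - Complex r \<tau>) / of_real \<beta>)) \<partial>lborel))) (at s)"
proof -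
  obtain y where y: "\<bar>Im s - \<tau>\<bar> < y" "y < \<omega>" using dense[OF s] by blast
  obtain C where C: "\<And>z. \<bar>Im z\<bar> \<le> y \<Longrightarrow> norm (K z) \<le> C" using K_bounded[OF y(2)] by blast
  define S where "S = cstrip (\<tau> - y) (\<tau> + y)"
  have dK: "((\<lambda>s. g (Complex r \<tau>) * K (s - Complex r \<tau>)) has_field_derivative
      g (Complex r \<tau>) * (- (2 / of_real \<beta>) * kap (2 * (z - Complex r \<tau>) / of_real \<beta>))) (at z)" if z: "z \<in> S" for z r
  proof -
    have "\<bar>Im (z - Complex r \<tau>)\<bar> < \<omega>" using z y by (auto simp: S_def cstrip_def)
    from DERIV_shift_minus[OF K_deriv[OF this]] show ?thesis by (rule DERIV_cmult)
  qed
  have C0: "C \<ge> 0" using C[of 0] y norm_ge_zero order_trans by (metis abs_ge_zero abs_zero less_le_trans less_imp_le zero_complex.simps(2))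
  have "((\<lambda>s. \<integral>r. g (Complex r \<tau>) * K (s - Complex r \<tau>) \<partial>lborel) has_field_derivative
      (\<integral>r. deriv (\<lambda>s. g (Complex r \<tau>) * K (s - Complex r \<tau>)) s \<partial>lborel)) (at s)"
  proof (rule parametric_integral_has_field_derivative[where S = S and B = "\<lambda>r. \<Gamma> * C * wt (r - 0)"])
    show "open S" by (simp add: S_def)
    show "s \<in> S" using y by (auto simp: S_def cstrip_def)
    show "(\<lambda>z. g (Complex r \<tau>) * K (z - Complex r \<tau>)) holomorphic_on S" for r
      using dK by (intro holomorphic_onI) (auto simp: field_differentiable_def intro: has_field_derivative_at_within)
    show "(\<lambda>r. g (Complex r \<tau>) * K (z - Complex r \<tau>)) \<in> borel_measurable lborel" if z: "z \<in> S" for z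
    proof -
      have "1 + exp (2 * (z - Complex r \<tau>) / of_real \<beta>) \<noteq> 0" for r
        using z y by (intro K_ne) (auto simp: S_def cstrip_def)
      then have "continuous_on UNIV (\<lambda>r. g (Complex r \<tau>) * K (z - Complex r \<tau>))"
        unfolding K_def using beta by (intro continuous_intros cont_g_line t cont_Complex) auto
      then show ?thesis by (simp add: borel_measurable_continuous_onI)
    qed
    show "norm (g (Complex r \<tau>) * K (z - Complex r \<tau>)) \<le> \<Gamma> * C * wt (r - 0)" if z: "z \<in> S" for z r
    proof -
      have "norm (g (Complex r \<tau>)) * norm (K (z - Complex r \<tau>)) \<le> (\<Gamma> * wt r) * C"
      proof (rule mult_mono)
        show "norm (g (Complex r \<tau>)) \<le> \<Gamma> * wt r" using bd[OF line_in_Inn[OF t]] by simp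
        show "norm (K (z - Complex r \<tau>)) \<le> C" using z by (intro C) (auto simp: S_def cstrip_def)
      qed (use Gamma_nonneg in auto)
      then show ?thesis by (simp add: norm_mult mult_ac)
    qed
    show "integrable lborel (\<lambda>r. \<Gamma> * C * wt (r - 0))"
      by (intro integrable_mult_right integrable_exp_neg_abs) simp
  qed
  then have "(Nt g \<tau> has_field_derivative 2 / (of_real pi * of_real \<beta>) *
      (\<integral>r. deriv (\<lambda>s. g (Complex r \<tau>) * K (s - Complex r \<tau>)) s \<partial>lborel)) (at s)"
    unfolding Nt_def by (rule DERIV_cmult)
  moreover have "deriv (\<lambda>s. g (Complex r \<tau>) * K (s - Complex r \<tau>)) s =
      g (Complex r \<tau>) * (- (2 / of_real \<beta>) * kap (2 * (s - Complex r \<tau>) / of_real \<beta>))" for r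
    by (rule DERIV_imp_deriv[OF dK]) (use y in \<open>auto simp: S_def cstrip_def\<close>)
  ultimately show ?thesis by simp
qed

text \<open>The line may be moved as long as it stays in \<open>Inn\<close> and does not cross the
  poles of the kernel, which lie at the heights Im s + \<omega> and Im s - \<omega>; these limits
  are \<open>a\<close> and \<open>b\<close>.\<close>

lemma Nt_indep:
  assumes t: "\<bar>\<tau>1\<bar> < \<delta>" "\<bar>\<tau>2\<bar> < \<delta>" and s: "\<bar>Im s - \<tau>1\<bar> < \<omega>" "\<bar>Im s - \<tau>2\<bar> < \<omega>"
  shows "Nt g \<tau>1 s = Nt g \<tau>2 s"
proof -
  define a b where "a = max (-\<delta>) (Im s - \<omega>)" and "b = min \<delta> (Im s + \<omega>)"
  have "(\<integral>r. (\<lambda>w. g w * K (s - w)) (Complex r \<tau>1) \<partial>lborel) = (\<integral>r. (\<lambda>w. g w * K (s - w)) (Complex r \<tau>2) \<partial>lborel)"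
  proof (rule line_integral_shift[where a = a and b = b and k = "3/4"])
    have sub: "cstrip a b \<subseteq> Inn" by (auto simp: cstrip_def Inn_iff a_def b_def)
    have ne: "1 + exp (2 * (s - w) / of_real \<beta>) \<noteq> 0" if "w \<in> cstrip a b" for w
      using that by (intro K_ne) (auto simp: cstrip_def a_def b_def)
    show "(\<lambda>w. g w * K (s - w)) holomorphic_on cstrip a b"
      unfolding K_def using beta ne by (intro holomorphic_intros holomorphic_on_subset[OF hol sub]) auto
    show "\<exists>C R. \<forall>w. a' \<le> Im w \<and> Im w \<le> b' \<and> R \<le> \<bar>Re w\<bar> \<longrightarrow> norm (g w * K (s - w)) \<le> C * wt (Re w)"
      if ab: "a < a'" "b' < b" for a' b'
    proof -
      define y where "y = max (Im s - a') (b' - Im s)"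
      have "y < \<omega>" using ab by (auto simp: y_def a_def b_def)
      then obtain C where C: "\<And>z. \<bar>Im z\<bar> \<le> y \<Longrightarrow> norm (K z) \<le> C" using K_bounded by blast
      have "norm (g w * K (s - w)) \<le> \<Gamma> * C * wt (Re w)" if w: "a' \<le> Im w" "Im w \<le> b'" for w
      proof -
        have "norm (g w) * norm (K (s - w)) \<le> (\<Gamma> * wt (Re w)) * C"
        proof (rule mult_mono)
          show "norm (g w) \<le> \<Gamma> * wt (Re w)" using w ab sub by (intro bd) (auto simp: cstrip_def)
          show "norm (K (s - w)) \<le> C" using w by (intro C) (auto simp: y_def)
        qed (use Gamma_nonneg in auto)
        then show ?thesis by (simp add: norm_mult mult_ac)
      qed
      then show ?thesis by blast
    qed
  qed (use t s in \<open>auto simp: a_def b_def\<close>)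
  then show ?thesis by (simp add: Nt_def)
qed

lemma Nop_eq: assumes "\<bar>\<tau>\<bar> < \<delta>" "\<bar>Im s - \<tau>\<bar> < \<omega>" "s \<in> Str" shows "Nop g s = Nt g \<tau> s"
  unfolding Nop_def by (rule Nt_indep) (use assms om4 in \<open>auto simp: Str_iff\<close>)

text \<open>The reason for the divisor 5: since \<omega> = 4 \<delta>, the condition |Im s| < 5
  \<delta> gives both a line inside \<open>Inn\<close> and a distance 4/5 |Im s| that stays below
  the height \<omega> of the poles.\<close>

lemma tau5: assumes "s \<in> Str" shows "\<bar>Im s / 5\<bar> < \<delta>" "\<bar>Im s - Im s / 5\<bar> < \<omega>"
  using assms om4 by (auto simp: Str_iff)

lemma Nop_deriv:
  assumes s: "s \<in> Str"
  shows "(Nop g has_field_derivative (2 / (of_real pi * of_real \<beta>) *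
     (\<integral>r. g (Complex r (Im s / 5)) * (- (2 / of_real \<beta>) * kap (2 * (s - Complex r (Im s / 5)) / of_real \<beta>)) \<partial>lborel))) (at s)"
proof (rule has_field_derivative_transform_within_open[OF Nt_deriv[OF tau5[OF s]]])
  define S where "S = Str \<inter> cstrip (Im s / 5 - \<omega>) (Im s / 5 + \<omega>)"
  show "open S" by (auto simp: S_def)
  show "s \<in> S" using s tau5[OF s] by (auto simp: S_def cstrip_def)
  show "Nt g (Im s / 5) x = Nop g x" if "x \<in> S" for x
    using that tau5[OF s] by (intro Nop_eq[symmetric]) (auto simp: S_def cstrip_def)
qed

lemma Nop_hol: "Nop g holomorphic_on Str"
  using Nop_deriv by (intro holomorphic_onI) (auto simp: field_differentiable_def intro: has_field_derivative_at_within)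

lemma Nop_sym: assumes s: "s \<in> Str" shows "Nop g (cnj s) = cnj (Nop g s)"
proof -
  have "g (Complex r (- (Im s / 5))) * K (cnj s - Complex r (- (Im s / 5))) = cnj (g (Complex r (Im s / 5)) * K (s - Complex r (Im s / 5)))" for r
  proof -
    have c: "Complex r (- (Im s / 5)) = cnj (Complex r (Im s / 5))" by (simp add: complex_eq_iff)
    have "K (cnj w) = cnj (K w)" for w by (simp add: K_def exp_cnj)
    then have "K (cnj s - cnj (Complex r (Im s / 5))) = cnj (K (s - Complex r (Im s / 5)))" by (metis complex_cnj_diff)
    then show ?thesis unfolding c using sym[OF line_in_Inn[OF tau5(1)[OF s]]] by simp
  qed
  then have "(\<integral>r. g (Complex r (- (Im s / 5))) * K (cnj s - Complex r (- (Im s / 5))) \<partial>lborel)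
      = (\<integral>r. cnj (g (Complex r (Im s / 5)) * K (s - Complex r (Im s / 5))) \<partial>lborel)" by (simp only:)
  also have "\<dots> = cnj (\<integral>r. g (Complex r (Im s / 5)) * K (s - Complex r (Im s / 5)) \<partial>lborel)" by (rule Bochner_Integration.integral_cnj)
  finally show ?thesis unfolding Nop_def Nt_def by simp
qed

text \<open>By the period 2 i \<omega> both arguments see the same kernel, but the upper one needs a
  line above Im s and the lower one a line below it. The difference is the residue at s.\<close>

lemma Nop_jump:
  assumes s: "s \<in> Inn" shows "Nop g (s + \<i> * \<omega>) - Nop g (s - \<i> * \<omega>) = - 2 * \<i> * g s"
proof -
  define t2 t1 where "t2 = (Im s + \<delta>) / 2" and "t1 = (Im s - \<delta>) / 2"
  have t: "-\<delta> < t1" "t1 < Im s" "Im s < t2" "t2 < \<delta>" using s by (auto simp: Inn_iff t1_def t2_def)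
  have e: "exp (2 * (s + \<i> * \<omega> - w) / of_real \<beta>) = - exp (- 2 * (w - s) / of_real \<beta>)"
      "exp (2 * (s - \<i> * \<omega> - w) / of_real \<beta>) = - exp (- 2 * (w - s) / of_real \<beta>)" for w
  proof -
    have "2 * (s + \<i> * \<omega> - w) / of_real \<beta> = - 2 * (w - s) / of_real \<beta> + \<i> * pi"
      "2 * (s - \<i> * \<omega> - w) / of_real \<beta> = - 2 * (w - s) / of_real \<beta> - \<i> * pi"
      using beta by (simp_all add: \<omega>_def field_simps)
    then show "exp (2 * (s + \<i> * \<omega> - w) / of_real \<beta>) = - exp (- 2 * (w - s) / of_real \<beta>)"
      "exp (2 * (s - \<i> * \<omega> - w) / of_real \<beta>) = - exp (- 2 * (w - s) / of_real \<beta>)"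
      by (simp_all only: exp_add exp_diff exp_pi_i' mult.commute[of \<i>]) simp_all
  qed
  have s1: "s + \<i> * \<omega> \<in> Str" "s - \<i> * \<omega> \<in> Str" using s omega delta by (auto simp: Inn_iff Str_iff)
  have "Nop g (s + \<i> * \<omega>) = Nt g t2 (s + \<i> * \<omega>)" using t omega delta om4 s by (intro Nop_eq s1) (auto simp: Inn_iff)
  moreover have "Nop g (s - \<i> * \<omega>) = Nt g t1 (s - \<i> * \<omega>)" using t omega delta om4 s by (intro Nop_eq s1) (auto simp: Inn_iff)
  moreover have "(\<integral>r. g (Complex r t2) * (1 / (1 - exp (- 2 * (Complex r t2 - s) / of_real \<beta>))) \<partial>lborel)
       - (\<integral>r. g (Complex r t1) * (1 / (1 - exp (- 2 * (Complex r t1 - s) / of_real \<beta>))) \<partial>lborel) = - \<i> * pi * \<beta> * g s"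
    by (rule strip_cauchy_formula[where k = "3/4" and \<Gamma> = \<Gamma> and \<delta> = \<delta>])
       (use beta beta2 t hol[unfolded Inn_def] bd[unfolded Inn_def] in \<open>auto simp: \<delta>_def\<close>)
  moreover have kk: "K (s + \<i> * \<omega> - w) = 1 / (1 - exp (- 2 * (w - s) / of_real \<beta>))"
      "K (s - \<i> * \<omega> - w) = 1 / (1 - exp (- 2 * (w - s) / of_real \<beta>))" for w
    unfolding K_def e by simp_all
  ultimately have "Nop g (s + \<i> * \<omega>) - Nop g (s - \<i> * \<omega>) = 2 / (of_real pi * of_real \<beta>) * (- \<i> * pi * \<beta> * g s)"
    by (simp only: Nt_def kk right_diff_distrib[symmetric])
  also have "\<dots> = - 2 * \<i> * g s" using beta by simp
  finally show ?thesis .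
qed

text \<open>Up to |Im s| = \<omega> the moved line keeps a fixed relative distance from the poles,
  so the kernel bounds are uniform. The derivative of the kernel is 2/\<beta> times a function of
  width O(\<beta>); hence both estimates cost only the prefactor 1/\<beta>.\<close>

lemma Nop_bound_centre:
  assumes s: "\<bar>Im s\<bar> \<le> \<omega>"
  shows "norm (Nop g s) \<le> 18 * \<Gamma> / \<beta> * wp (Re s)"
    and "norm (deriv (Nop g) s) \<le> 64 * \<Gamma> / \<beta> * wt (Re s)"
proof -
  have st: "s \<in> Str" using s delta by (auto simp: Str_iff)
  define \<tau> where "\<tau> = Im s / 5"
  have tau: "\<bar>\<tau>\<bar> < \<delta>" using tau5[OF st] by (simp add: \<tau>_def)
  have im: "\<bar>Im (s - Complex r \<tau>)\<bar> \<le> 4/5 * \<omega>" for r using s by (simp add: \<tau>_def)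
  have gb: "norm (g (Complex r \<tau>)) \<le> \<Gamma> * wt r" for r using bd[OF line_in_Inn[OF tau]] by simp
  define x where "x = Re s"
  have pb: "0 < pi * \<beta>" using beta by simp
  \<comment> \<open>For x \<ge> 0 part of the decay is used to pull the weight in x out of the
    integral; for x < 0 that weight is 1 and the integrable weight in r suffices.\<close>
  have w: "wt r * exp (- (3/2) * max 0 (x - r)) \<le>
      wp x * (wt (r - x) + wt (r - 0))" for r
  proof (cases "x \<ge> 0")
    case True
    have "wt r * exp (- (3/2) * max 0 (x - r)) \<le> wp x * wt (r - x)"
    proof -
      have "3/4 * max 0 x + 3/4 * \<bar>r - x\<bar> \<le> 3/4 * \<bar>r\<bar> + 3/2 * max 0 (x - r)"
      proof -
        have "max 0 x + \<bar>r - x\<bar> \<le> \<bar>r\<bar> + 2 * max 0 (x - r)" using True by (auto simp: max_def abs_if)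
        from mult_left_mono[OF this, of "3/4"] show ?thesis by (simp add: distrib_left)
      qed
      then show ?thesis unfolding exp_add[symmetric] by (intro iffD2[OF exp_le_cancel_iff]) linarith
    qed
    then show ?thesis by (simp add: distrib_left add_increasing2)
  next
    case False
    have "wt r * exp (- (3/2) * max 0 (x - r)) \<le> wt r * 1"
      by (intro mult_left_mono) auto
    then show ?thesis using False by (simp add: max_def add_increasing)
  qed
  have i1: "has_bochner_integral lborel (\<lambda>r. wt (r - x) + wt (r - 0)) (2 / (3/4) + 2 / (3/4))"
    by (intro has_bochner_integral_add has_bochner_integral_exp_neg_abs) auto
  have "norm (\<integral>r. g (Complex r \<tau>) * K (s - Complex r \<tau>) \<partial>lborel)
      \<le> (\<integral>r. 4 * \<Gamma> * wp x * (wt (r - x) + wt (r - 0)) \<partial>lborel)"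
  proof (rule norm_integral_le)
    show "integrable lborel (\<lambda>r. 4 * \<Gamma> * wp x * (wt (r - x) + wt (r - 0)))"
      using i1 by (intro integrable_mult_right) (simp add: has_bochner_integral_iff)
    fix r
    have "norm (g (Complex r \<tau>)) * norm (K (s - Complex r \<tau>)) \<le> (\<Gamma> * wt r) * (4 * exp (- (3/2) * max 0 (x - r)))"
      using K_near(1)[OF im[of r]] by (intro mult_mono gb) (auto simp: x_def Gamma_nonneg)
    also have "\<dots> = 4 * \<Gamma> * (wt r * exp (- (3/2) * max 0 (x - r)))" by simp
    also have "\<dots> \<le> 4 * \<Gamma> * (wp x * (wt (r - x) + wt (r - 0)))"
      using Gamma_nonneg by (intro mult_left_mono w) auto
    finally show "norm (g (Complex r \<tau>) * K (s - Complex r \<tau>)) \<le> 4 * \<Gamma> * wp x * (wt (r - x) + wt (r - 0))"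
      by (simp add: norm_mult mult.assoc)
  qed
  also have "\<dots> = 4 * \<Gamma> * wp x * (16/3)"
    using has_bochner_integral_integral_eq[OF i1] by simp
  finally have a: "norm (\<integral>r. g (Complex r \<tau>) * K (s - Complex r \<tau>) \<partial>lborel) \<le> 64/3 * \<Gamma> * wp x" by simp
  have "norm (Nop g s) = 2 / (pi * \<beta>) * norm (\<integral>r. g (Complex r \<tau>) * K (s - Complex r \<tau>) \<partial>lborel)"
    unfolding Nop_def Nt_def \<tau>_def[symmetric] using beta by (simp add: norm_mult norm_divide)
  also have "\<dots> \<le> 2 / (3 * \<beta>) * (64/3 * \<Gamma> * wp x)"
    using a beta pi_gt3 Gamma_nonneg by (intro mult_mono divide_left_mono) auto
  also have "\<dots> \<le> 18 * \<Gamma> / \<beta> * wp x"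
    using beta Gamma_nonneg by (simp add: field_simps)
  finally show "norm (Nop g s) \<le> 18 * \<Gamma> / \<beta> * wp (Re s)" by (simp add: x_def)
  \<comment> \<open>Of the rate 2/\<beta>, the amount 3/4 is spent on moving the weight from r to x;
    at least 1/\<beta> remains because \<beta> < 4/3.\<close>
  have w2: "wt r * exp (- (2 / \<beta>) * \<bar>x - r\<bar>) \<le> wt x * exp (- (1 / \<beta>) * \<bar>r - x\<bar>)" for r
  proof -
    have "(1 / \<beta>) * \<bar>r - x\<bar> \<le> (2 / \<beta> - 3/4) * \<bar>r - x\<bar>" using beta2(2) by (intro mult_right_mono) auto
    moreover have "3/4 * \<bar>x\<bar> \<le> 3/4 * \<bar>r\<bar> + 3/4 * \<bar>r - x\<bar>"
      using abs_triangle_ineq[of r "x - r"] abs_minus_commute[of r x] by simp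
    ultimately have "3/4 * \<bar>x\<bar> + (1 / \<beta>) * \<bar>r - x\<bar> \<le> 3/4 * \<bar>r\<bar> + 2 / \<beta> * \<bar>r - x\<bar>" by (simp add: left_diff_distrib)
    then show ?thesis unfolding exp_add[symmetric] by (simp add: abs_minus_commute)
  qed
  have i2: "has_bochner_integral lborel (\<lambda>r. exp (- (1 / \<beta>) * \<bar>r - x\<bar>)) (2 / (1 / \<beta>))"
    using beta by (intro has_bochner_integral_exp_neg_abs) auto
  have "norm (\<integral>r. g (Complex r \<tau>) * (- (2 / of_real \<beta>) * kap (2 * (s - Complex r \<tau>) / of_real \<beta>)) \<partial>lborel)
      \<le> (\<integral>r. 32 / \<beta> * \<Gamma> * wt x * exp (- (1 / \<beta>) * \<bar>r - x\<bar>) \<partial>lborel)"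
  proof (rule norm_integral_le)
    show "integrable lborel (\<lambda>r. 32 / \<beta> * \<Gamma> * wt x * exp (- (1 / \<beta>) * \<bar>r - x\<bar>))"
      using i2 by (intro integrable_mult_right) (simp add: has_bochner_integral_iff)
    fix r
    have "norm (g (Complex r \<tau>)) * (2 / \<beta> * norm (kap (2 * (s - Complex r \<tau>) / of_real \<beta>))) \<le> (\<Gamma> * wt r) * (2 / \<beta> * (16 * exp (- (2 / \<beta>) * \<bar>x - r\<bar>)))"
      using K_near(2)[OF im[of r]] beta by (intro mult_mono gb) (auto simp: x_def Gamma_nonneg)
    also have "\<dots> = 32 / \<beta> * \<Gamma> * (wt r * exp (- (2 / \<beta>) * \<bar>x - r\<bar>))" by simp
    also have "\<dots> \<le> 32 / \<beta> * \<Gamma> * (wt x * exp (- (1 / \<beta>) * \<bar>r - x\<bar>))"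
      using Gamma_nonneg beta by (intro mult_left_mono w2) auto
    finally show "norm (g (Complex r \<tau>) * (- (2 / of_real \<beta>) * kap (2 * (s - Complex r \<tau>) / of_real \<beta>))) \<le> 32 / \<beta> * \<Gamma> * wt x * exp (- (1 / \<beta>) * \<bar>r - x\<bar>)"
      using beta by (simp add: norm_mult norm_divide mult.assoc)
  qed
  also have "\<dots> = 32 / \<beta> * \<Gamma> * wt x * (2 * \<beta>)"
    using has_bochner_integral_integral_eq[OF i2] by simp
  finally have b: "norm (\<integral>r. g (Complex r \<tau>) * (- (2 / of_real \<beta>) * kap (2 * (s - Complex r \<tau>) / of_real \<beta>)) \<partial>lborel) \<le> 64 * \<Gamma> * wt x"
    using beta by (simp add: mult_ac)
  have "norm (deriv (Nop g) s) = 2 / (pi * \<beta>) * norm (\<integral>r. g (Complex r \<tau>) * (- (2 / of_real \<beta>) * kap (2 * (s - Complex r \<tau>) / of_real \<beta>)) \<partial>lborel)"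
    unfolding DERIV_imp_deriv[OF Nop_deriv[OF st]] \<tau>_def[symmetric] using beta by (simp add: norm_mult norm_divide)
  also have "\<dots> \<le> 2 / (3 * \<beta>) * (64 * \<Gamma> * wt x)"
    using b beta pi_gt3 Gamma_nonneg by (intro mult_mono divide_left_mono) auto
  also have "\<dots> \<le> 64 * \<Gamma> / \<beta> * wt x"
    using beta Gamma_nonneg by (simp add: field_simps)
  finally show "norm (deriv (Nop g) s) \<le> 64 * \<Gamma> / \<beta> * wt (Re s)" by (simp add: x_def)
qed

text \<open>Beyond Im s = \<omega> the direct bound would degenerate. There the jump relation
  expresses the value at s through the one at s - 2 i \<omega>, which lies in the central strip, and
  a value of g. The lower half follows by conjugation.\<close>

lemma bnd1_Nop: "bnd1 (64 * \<Gamma> / \<beta> + 2 * \<Gamma> + 2 * \<Gamma>') (Nop g)"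
proof -
  define Q where "Q = 64 * \<Gamma> / \<beta> + 2 * \<Gamma> + 2 * \<Gamma>'"
  have Gb: "\<Gamma> / \<beta> \<ge> 0" using Gamma_nonneg beta by simp
  have up: "norm (Nop g s) \<le> Q * wp (Re s) \<and> norm (deriv (Nop g) s) \<le> Q * wt (Re s)"
    if s: "s \<in> Str" and im: "0 \<le> Im s" for s
  proof (cases "Im s \<le> \<omega>")
    case True
    have b1: "18 * \<Gamma> / \<beta> * wp (Re s) \<le> Q * wp (Re s)"
      using Gb Gamma_nonneg by (intro mult_right_mono) (auto simp: Q_def)
    have b2: "64 * \<Gamma> / \<beta> * wt (Re s) \<le> Q * wt (Re s)"
      using Gb Gamma_nonneg by (intro mult_right_mono) (auto simp: Q_def)
    have "\<bar>Im s\<bar> \<le> \<omega>" using True im by simp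
    from Nop_bound_centre[OF this] b1 b2 show ?thesis by linarith
  next
    case False
    define S where "S = cstrip (\<omega> - \<delta>) (\<omega> + \<delta>)"
    have sS: "s \<in> S" using s False delta by (auto simp: S_def cstrip_def Str_iff)
    have inn: "z - \<i> * \<omega> \<in> Inn" if "z \<in> S" for z using that by (auto simp: S_def cstrip_def Inn_iff)
    have str: "z - 2 * \<i> * \<omega> \<in> Str" if "z \<in> S" for z using that delta omega om4 by (auto simp: S_def cstrip_def Str_iff)
    have eq: "Nop g z = Nop g (z - 2 * \<i> * \<omega>) - 2 * \<i> * g (z - \<i> * \<omega>)" if "z \<in> S" for z
      using Nop_jump[OF inn[OF that]] by (simp add: algebra_simps)
    have lo: "\<bar>Im (s - 2 * \<i> * \<omega>)\<bar> \<le> \<omega>" using s False delta om4 by (auto simp: Str_iff)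
    note c = Nop_bound_centre[OF lo]
    have e1: "wt (Re s) \<le> wp (Re s)" by simp
    have "norm (Nop g s) \<le> norm (Nop g (s - 2 * \<i> * \<omega>)) + 2 * norm (g (s - \<i> * \<omega>))"
      unfolding eq[OF sS] using norm_triangle_ineq4[of "Nop g (s - 2 * \<i> * \<omega>)" "2 * \<i> * g (s - \<i> * \<omega>)"] by (simp add: norm_mult)
    also have "\<dots> \<le> 18 * \<Gamma> / \<beta> * wp (Re s) + 2 * (\<Gamma> * wp (Re s))"
    proof -
      have "norm (g (s - \<i> * \<omega>)) \<le> \<Gamma> * wt (Re s)" using bd[OF inn[OF sS]] by simp
      also have "\<dots> \<le> \<Gamma> * wp (Re s)" using Gamma_nonneg by (intro mult_left_mono e1)
      finally show ?thesis using c(1) by simp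
    qed
    also have "\<dots> = (18 * \<Gamma> / \<beta> + 2 * \<Gamma>) * wp (Re s)" by (simp add: algebra_simps)
    also have "\<dots> \<le> Q * wp (Re s)" using Gb Gamma_nonneg by (intro mult_right_mono) (auto simp: Q_def)
    finally have r1: "norm (Nop g s) \<le> Q * wp (Re s)" .
    have "(Nop g has_field_derivative (deriv (Nop g) (s - 2 * \<i> * \<omega>) - 2 * \<i> * deriv g (s - \<i> * \<omega>))) (at s)"
    proof (rule has_field_derivative_transform_within_open[of "\<lambda>z. Nop g (z - 2 * \<i> * \<omega>) - 2 * \<i> * g (z - \<i> * \<omega>)" _ _ S])
      have "((\<lambda>z. Nop g (z - 2 * \<i> * \<omega>)) has_field_derivative deriv (Nop g) (s - 2 * \<i> * \<omega>) * 1) (at s)"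
        using DERIV_shift_minus[OF holomorphic_derivI[OF Nop_hol open_Str str[OF sS]]] by simp
      moreover have "((\<lambda>z. g (z - \<i> * \<omega>)) has_field_derivative deriv g (s - \<i> * \<omega>) * 1) (at s)"
        using DERIV_shift_minus[OF holomorphic_derivI[OF hol open_Inn inn[OF sS]]] by simp
      ultimately show "((\<lambda>z. Nop g (z - 2 * \<i> * \<omega>) - 2 * \<i> * g (z - \<i> * \<omega>)) has_field_derivative (deriv (Nop g) (s - 2 * \<i> * \<omega>) - 2 * \<i> * deriv g (s - \<i> * \<omega>))) (at s)"
        by (intro DERIV_diff DERIV_cmult) auto
    qed (use sS eq in \<open>auto simp: S_def\<close>)
    then have "deriv (Nop g) s = deriv (Nop g) (s - 2 * \<i> * \<omega>) - 2 * \<i> * deriv g (s - \<i> * \<omega>)" by (rule DERIV_imp_deriv)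
    then have "norm (deriv (Nop g) s) \<le> norm (deriv (Nop g) (s - 2 * \<i> * \<omega>)) + 2 * norm (deriv g (s - \<i> * \<omega>))"
      using norm_triangle_ineq4[of "deriv (Nop g) (s - 2 * \<i> * \<omega>)" "2 * \<i> * deriv g (s - \<i> * \<omega>)"] by (simp add: norm_mult)
    also have "\<dots> \<le> 64 * \<Gamma> / \<beta> * wt (Re s) + 2 * (\<Gamma>' * wt (Re s))"
      using c(2) bd'[OF inn[OF sS]] by simp
    also have "\<dots> = (64 * \<Gamma> / \<beta> + 2 * \<Gamma>') * wt (Re s)" by (simp add: algebra_simps)
    also have "\<dots> \<le> Q * wt (Re s)" using Gb Gamma_nonneg by (intro mult_right_mono) (auto simp: Q_def)
    finally show ?thesis using r1 by blast
  qed
  have all: "norm (Nop g s) \<le> Q * wp (Re s) \<and> norm (deriv (Nop g) s) \<le> Q * wt (Re s)"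
    if s: "s \<in> Str" for s
  proof (cases "0 \<le> Im s")
    case True then show ?thesis using up s by blast
  next
    case False
    have u: "norm (Nop g (cnj s)) \<le> Q * wp (Re s) \<and> norm (deriv (Nop g) (cnj s)) \<le> Q * wt (Re s)"
      using up[OF cnj_Str[OF s]] False by simp
    have "(Nop g has_field_derivative cnj (deriv (Nop g) (cnj s))) (at s)"
      by (rule has_field_derivative_transform_within_open[OF deriv_cnj_cnj[OF Nop_hol open_Str cnj_Str[OF s]] open_Str s])
         (simp add: Nop_sym)
    then have "deriv (Nop g) s = cnj (deriv (Nop g) (cnj s))" by (rule DERIV_imp_deriv)
    then show ?thesis using u Nop_sym[OF s] by simp
  qed
  show ?thesis unfolding Q_def[symmetric] bnd1_def using all Nop_hol Nop_sym by blast
qed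

end


text \<open>For \<open>F = Hw - iw\<close> continued to the upper half plane, \<open>hF F\<close> and \<open>wF F\<close> are \<open>Hw\<close> and \<open>w\<close>
  as functions of \<open>s = \<beta> log x\<close>, and \<open>VF F\<close> is \<open>u / x\<close>.\<close>

definition hF :: "(complex \<Rightarrow> complex) \<Rightarrow> complex \<Rightarrow> complex" where
  "hF F s = (F (s + \<i> * \<omega>) + F (s - \<i> * \<omega>)) / 2"

definition wF :: "(complex \<Rightarrow> complex) \<Rightarrow> complex \<Rightarrow> complex" where
  "wF F s = (F (s + \<i> * \<omega>) - F (s - \<i> * \<omega>)) / (2 * \<i>)"

definition VF :: "(complex \<Rightarrow> complex) \<Rightarrow> complex \<Rightarrow> complex" where
  "VF F s = (\<integral>v. hF F (s + of_real (\<beta> * ln v)) \<partial>restrict_space lborel {0<..1})"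

text \<open>The transport term as (u/x) times x w_x, where x d/dx becomes \<beta> d/ds. It takes two
  arguments because the coefficient recursion needs its bilinear form.\<close>

definition gop :: "(complex \<Rightarrow> complex) \<Rightarrow> (complex \<Rightarrow> complex) \<Rightarrow> complex \<Rightarrow> complex" where
  "gop F G s = of_real \<beta> * VF F s * wF (deriv G) s"

section \<open>Symmetry, derivatives and bounds of the transport term\<close>

lemma Inn_shift: assumes "s \<in> Inn" shows "s + \<i> * \<omega> \<in> Str" "s - \<i> * \<omega> \<in> Str"
  using assms omega by (auto simp: Inn_iff Str_iff)

lemma Inn_real: "s \<in> Inn \<Longrightarrow> s + of_real r \<in> Inn" by (simp add: Inn_iff)

lemma bnd2_sym': assumes F: "bnd1 M F" and s: "s \<in> Str" shows "deriv F (cnj s) = cnj (deriv F s)"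
proof -
  have "(F has_field_derivative cnj (deriv F (cnj s))) (at s)"
    by (rule has_field_derivative_transform_within_open[OF deriv_cnj_cnj[OF bnd1_hol[OF F] open_Str cnj_Str[OF s]] open_Str s])
       (simp add: bnd1_sym[OF F])
  then have "deriv F s = cnj (deriv F (cnj s))" by (rule DERIV_imp_deriv)
  then show ?thesis by simp
qed

lemma cnj_shift: "cnj s + \<i> * of_real \<omega> = cnj (s - \<i> * of_real \<omega>)" "cnj s - \<i> * of_real \<omega> = cnj (s + \<i> * of_real \<omega>)"
  by simp_all

lemma hF_sym: assumes "\<forall>s\<in>Str. F (cnj s) = cnj (F s)" "s \<in> Inn" shows "hF F (cnj s) = cnj (hF F s)"
  unfolding hF_def cnj_shift using bspec[OF assms(1) Inn_shift(1)[OF assms(2)]] bspec[OF assms(1) Inn_shift(2)[OF assms(2)]] by (simp add: add.commute)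

lemma wF_sym: assumes "\<forall>s\<in>Str. F (cnj s) = cnj (F s)" "s \<in> Inn" shows "wF F (cnj s) = cnj (wF F s)"
  unfolding wF_def cnj_shift using bspec[OF assms(1) Inn_shift(1)[OF assms(2)]] bspec[OF assms(1) Inn_shift(2)[OF assms(2)]]
  by (simp add: field_simps)

lemma hF_deriv:
  assumes F: "F holomorphic_on Str" and s: "s \<in> Inn"
  shows "(hF F has_field_derivative hF (deriv F) s) (at s)"
proof -
  have "((\<lambda>s. F (s + \<i> * \<omega>)) has_field_derivative deriv F (s + \<i> * \<omega>)) (at s)"
    using holomorphic_derivI[OF F open_Str Inn_shift(1)[OF s]] DERIV_shift by blast
  moreover have "((\<lambda>s. F (s - \<i> * \<omega>)) has_field_derivative deriv F (s - \<i> * \<omega>)) (at s)"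
    by (rule DERIV_shift_minus[OF holomorphic_derivI[OF F open_Str Inn_shift(2)[OF s]]])
  ultimately show ?thesis unfolding hF_def by (intro DERIV_cdivide DERIV_add)
qed

lemma wF_deriv:
  assumes F: "F holomorphic_on Str" and s: "s \<in> Inn"
  shows "(wF F has_field_derivative wF (deriv F) s) (at s)"
proof -
  have "((\<lambda>s. F (s + \<i> * \<omega>)) has_field_derivative deriv F (s + \<i> * \<omega>)) (at s)"
    using holomorphic_derivI[OF F open_Str Inn_shift(1)[OF s]] DERIV_shift by blast
  moreover have "((\<lambda>s. F (s - \<i> * \<omega>)) has_field_derivative deriv F (s - \<i> * \<omega>)) (at s)"
    by (rule DERIV_shift_minus[OF holomorphic_derivI[OF F open_Str Inn_shift(2)[OF s]]])
  ultimately show ?thesis unfolding wF_def by (intro DERIV_cdivide DERIV_diff)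
qed

lemma hF_le:
  assumes s: "s \<in> Inn" and F: "\<And>z. z \<in> Str \<Longrightarrow> norm (F z) \<le> B (Re z)"
  shows "norm (hF F s) \<le> B (Re s)"
proof -
  have "norm (F (s + \<i> * \<omega>) + F (s - \<i> * \<omega>)) \<le> B (Re s) + B (Re s)"
    using F[OF Inn_shift(1)[OF s]] F[OF Inn_shift(2)[OF s]] by (intro norm_triangle_le add_mono) auto
  then show ?thesis by (simp add: hF_def norm_divide)
qed

lemma wF_le:
  assumes s: "s \<in> Inn" and F: "\<And>z. z \<in> Str \<Longrightarrow> norm (F z) \<le> B (Re z)"
  shows "norm (wF F s) \<le> B (Re s)"
proof -
  have "norm (F (s + \<i> * \<omega>) - F (s - \<i> * \<omega>)) \<le> B (Re s) + B (Re s)"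
    using F[OF Inn_shift(1)[OF s]] F[OF Inn_shift(2)[OF s]] by (intro order_trans[OF norm_triangle_ineq4] add_mono) auto
  then show ?thesis by (simp add: wF_def norm_divide norm_mult)
qed

text \<open>The difference across the strip gains a factor \<open>\<omega> = O(\<beta>)\<close>; this is what makes
  the estimates uniform as \<open>\<alpha>\<close> tends to 0.\<close>

lemma wF_le_deriv:
  assumes s: "s \<in> Inn" and hol: "F holomorphic_on Str" and F: "\<And>z. z \<in> Str \<Longrightarrow> norm (deriv F z) \<le> B (Re z)"
  shows "norm (wF F s) \<le> \<omega> * B (Re s)"
proof -
  have seg: "z \<in> Str \<and> Re z = Re s" if zz: "z \<in> closed_segment (s - \<i> * \<omega>) (s + \<i> * \<omega>)" for z
  proof -
    have "z \<in> Str" using zz Inn_shift[OF s] convex_Str convex_contains_segment by blast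
    moreover have "Re z = Re s"
    proof -
      obtain u where "z = (1 - u) *\<^sub>R (s - \<i> * \<omega>) + u *\<^sub>R (s + \<i> * \<omega>)" using zz unfolding in_segment by blast
      then have "Re z = (1 - u) * Re s + u * Re s" by simp
      then show ?thesis by (simp add: algebra_simps)
    qed
    ultimately show ?thesis by blast
  qed
  have "norm (F (s + \<i> * \<omega>) - F (s - \<i> * \<omega>)) \<le> B (Re s) * norm ((s + \<i> * \<omega>) - (s - \<i> * \<omega>))"
  proof (rule field_differentiable_bound[where S = "closed_segment (s - \<i> * \<omega>) (s + \<i> * \<omega>)" and f' = "deriv F"])
    fix z assume z: "z \<in> closed_segment (s - \<i> * \<omega>) (s + \<i> * \<omega>)"
    show "(F has_field_derivative deriv F z) (at z within closed_segment (s - \<i> * \<omega>) (s + \<i> * \<omega>))"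
      using holomorphic_derivI[OF hol open_Str] seg[OF z] by (blast intro: has_field_derivative_at_within)
    show "norm (deriv F z) \<le> B (Re s)" using F seg[OF z] by metis
  qed auto
  also have "norm ((s + \<i> * \<omega>) - (s - \<i> * \<omega>)) = 2 * \<omega>"
  proof -
    have "(s + \<i> * \<omega>) - (s - \<i> * \<omega>) = \<i> * of_real (2 * \<omega>)" by (simp add: algebra_simps)
    then show ?thesis using omega by (simp add: norm_mult del: of_real_mult)
  qed
  finally show ?thesis by (simp add: wF_def norm_divide norm_mult mult_ac)
qed

lemma prob_unit: "emeasure (restrict_space lborel {0<..1::real}) {0<..1} = 1"
  by (subst emeasure_restrict_space) auto

lemma integrable_const_unit: "integrable (restrict_space lborel {0<..1::real}) (\<lambda>_. c :: real)"
proof -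
  have "finite_measure (restrict_space lborel {0<..1::real})"
    by (rule finite_measureI) (simp add: space_restrict_space prob_unit)
  then show ?thesis by (rule finite_measure.integrable_const)
qed

lemma integral_const_unit: "(\<integral>v. c \<partial>restrict_space lborel {0<..1::real}) = (c :: real)"
  by (simp add: measure_def space_restrict_space prob_unit)

text \<open>The substitution y = x v writes u/x as the mean of Hw (x v) over 0 < v \<le> 1, and
  multiplying x by v shifts s by \<beta> ln v. A mean over a probability space keeps uniform bounds
  without a constant.\<close>

lemma VF_le: assumes "\<And>r. norm (hF F (s + of_real r)) \<le> M" shows "norm (VF F s) \<le> M"
proof -
  have "norm (VF F s) \<le> (\<integral>v. M \<partial>restrict_space lborel {0<..1::real})"
    unfolding VF_def by (rule norm_integral_le[OF integrable_const_unit]) (rule assms)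
  then show ?thesis by (simp only: integral_const_unit)
qed

lemma VF_measurable:
  assumes F: "F holomorphic_on Str" and z: "z \<in> Inn"
  shows "(\<lambda>v. hF F (z + of_real (\<beta> * ln v))) \<in> borel_measurable (restrict_space lborel {0<..1})"
proof -
  have c: "continuous_on Inn (hF F)"
    using hF_deriv[OF F] by (intro continuous_at_imp_continuous_on) (auto intro: DERIV_isCont)
  have "continuous_on {0<..1} (\<lambda>v. hF F (z + of_real (\<beta> * ln v)))"
    by (rule continuous_on_compose2[OF c]) (use Inn_real[OF z] in \<open>auto intro!: continuous_intros simp del: of_real_mult\<close>)
  then show ?thesis
    by (subst measurable_cong_sets[OF sets_restrict_space_cong[OF sets_lborel] refl])
       (rule borel_measurable_continuous_on_restrict)
qed

lemma VF_deriv: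
  assumes F: "F holomorphic_on Str" and bd: "\<And>z. z \<in> Str \<Longrightarrow> norm (F z) \<le> M" and s: "s \<in> Inn"
  shows "(VF F has_field_derivative VF (deriv F) s) (at s)"
proof -
  have d: "((\<lambda>z. hF F (z + of_real (\<beta> * ln v))) has_field_derivative hF (deriv F) (z + of_real (\<beta> * ln v))) (at z)" if "z \<in> Inn" for z v
    using hF_deriv[OF F Inn_real[OF that]] DERIV_shift by blast
  have "((\<lambda>s. \<integral>v. hF F (s + of_real (\<beta> * ln v)) \<partial>restrict_space lborel {0<..1}) has_field_derivative
     (\<integral>v. deriv (\<lambda>s. hF F (s + of_real (\<beta> * ln v))) s \<partial>restrict_space lborel {0<..1})) (at s)"
  proof (rule parametric_integral_has_field_derivative[where S = Inn and B = "\<lambda>_. M"])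
    show "(\<lambda>z. hF F (z + of_real (\<beta> * ln v))) holomorphic_on Inn" for v
      using d by (intro holomorphic_onI) (auto simp: field_differentiable_def intro: has_field_derivative_at_within)
    show "(\<lambda>v. hF F (z + of_real (\<beta> * ln v))) \<in> borel_measurable (restrict_space lborel {0<..1})" if z: "z \<in> Inn" for z
      by (rule VF_measurable[OF F z])
    show "norm (hF F (z + of_real (\<beta> * ln v))) \<le> M" if "z \<in> Inn" for z v
      using hF_le[OF Inn_real[OF that], of F "\<lambda>_. M"] bd by blast
  qed (use s integrable_const_unit in auto)
  moreover have "deriv (\<lambda>s. hF F (s + of_real (\<beta> * ln v))) s = hF (deriv F) (s + of_real (\<beta> * ln v))" for v
    by (rule DERIV_imp_deriv[OF d[OF s]])
  ultimately show ?thesis unfolding VF_def by (simp only:)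
qed

lemma VF_sym: assumes "\<forall>s\<in>Str. F (cnj s) = cnj (F s)" "s \<in> Inn" shows "VF F (cnj s) = cnj (VF F s)"
proof -
  have "hF F (cnj s + of_real r) = cnj (hF F (s + of_real r))" for r
    using hF_sym[OF assms(1) Inn_real[OF assms(2)], of r] by simp
  then show ?thesis unfolding VF_def by (simp only: Bochner_Integration.integral_cnj)
qed

text \<open>\<open>gop\<close> carries \<beta> explicitly and a second power through \<omega> \<le>
  2 \<beta> from the difference across the strip; one of them pays for the 1/\<beta> in
  \<open>bnd1_Nop\<close>. The constant arises as 128 + 4 \<beta> + 8, which is below 150.\<close>

lemma bnd1_Nop_gop:
  assumes F: "bnd2 M F" and G: "bnd2 M' G"
  shows "bnd1 (150 * \<beta> * M * M') (Nop (gop F G))"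
    and "\<And>s. s \<in> Inn \<Longrightarrow> wF (Nop (gop F G)) s = - gop F G s"
proof -
  note M = bnd2_nonneg[OF F] bnd2_nonneg[OF G]
  have V: "norm (VF F s) \<le> M" if "s \<in> Inn" for s
    by (rule VF_le, rule hF_le[where B = "\<lambda>_. M"]) (use Inn_real[OF that] bnd1_le[OF bnd2_bnd1[OF F]] in auto)
  have V': "norm (VF (deriv F) s) \<le> M" if "s \<in> Inn" for s
    by (rule VF_le, rule hF_le[where B = "\<lambda>_. M"]) (use Inn_real[OF that] bnd1_le'[OF bnd2_bnd1[OF F]] in auto)
  have w: "norm (wF (deriv G) s) \<le> \<omega> * (M' * wt (Re s))" if "s \<in> Inn" for s
    by (rule wF_le_deriv[OF that bnd2_hol'[OF G], of "\<lambda>x. M' * wt x"]) (rule bnd2_bound''[OF G])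
  have w': "norm (wF (deriv (deriv G)) s) \<le> M' * wt (Re s)" if "s \<in> Inn" for s
    by (rule wF_le[OF that, of _ "\<lambda>x. M' * wt x"]) (rule bnd2_bound''[OF G])
  have gd: "(gop F G has_field_derivative of_real \<beta> * (VF F s * wF (deriv (deriv G)) s + VF (deriv F) s * wF (deriv G) s)) (at s)"
    if s: "s \<in> Inn" for s
  proof -
    have "((\<lambda>s. of_real \<beta> * (VF F s * wF (deriv G) s)) has_field_derivative of_real \<beta> * (VF F s * wF (deriv (deriv G)) s + VF (deriv F) s * wF (deriv G) s)) (at s)"
      by (intro DERIV_cmult DERIV_mult' VF_deriv[OF bnd2_hol[OF F] bnd1_le[OF bnd2_bnd1[OF F]] s] wF_deriv[OF bnd2_hol'[OF G] s])
    then show ?thesis unfolding gop_def by (simp only: mult.assoc)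
  qed
  have hol: "gop F G holomorphic_on Inn"
    using gd by (intro holomorphic_onI) (auto simp: field_differentiable_def intro: has_field_derivative_at_within)
  have sym: "gop F G (cnj s) = cnj (gop F G s)" if s: "s \<in> Inn" for s
  proof -
    have "\<forall>s\<in>Str. F (cnj s) = cnj (F s)" "\<forall>s\<in>Str. deriv G (cnj s) = cnj (deriv G s)"
      using bnd1_sym[OF bnd2_bnd1[OF F]] bnd2_sym'[OF bnd2_bnd1[OF G]] by auto
    then show ?thesis using VF_sym[of F s] wF_sym[of "deriv G" s] s by (simp add: gop_def)
  qed
  have bd: "norm (gop F G s) \<le> (2 * \<beta> * \<beta> * M * M') * wt (Re s)" if s: "s \<in> Inn" for s
  proof -
    have "norm (gop F G s) = \<beta> * norm (VF F s) * norm (wF (deriv G) s)" using beta by (simp add: gop_def norm_mult)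
    also have "\<dots> \<le> \<beta> * M * (2 * \<beta> * (M' * wt (Re s)))"
    proof (intro mult_mono V s)
      have "\<omega> * (M' * wt (Re s)) \<le> 2 * \<beta> * (M' * wt (Re s))"
        using omega M by (intro mult_right_mono) auto
      then show "norm (wF (deriv G) s) \<le> 2 * \<beta> * (M' * wt (Re s))" using w[OF s] by linarith
    qed (use beta M in auto)
    finally show ?thesis by (simp add: mult_ac)
  qed
  \<comment> \<open>The term with the differentiated jump is estimated without the gain of \<omega>,
    since \<open>G\<close> is controlled only up to its second derivative; one factor \<beta> is
    enough here.\<close>
  have bd': "norm (deriv (gop F G) s) \<le> (4 * \<beta> * M * M') * wt (Re s)" if s: "s \<in> Inn" for s
  proof -
    define E where "E = M' * wt (Re s)"
    have E: "E \<ge> 0" using M by (simp add: E_def)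
    have "norm (deriv (gop F G) s) \<le> \<beta> * (norm (VF F s) * norm (wF (deriv (deriv G)) s) + norm (VF (deriv F) s) * norm (wF (deriv G) s))"
      unfolding DERIV_imp_deriv[OF gd[OF s]] norm_mult using beta
      by (auto intro!: mult_left_mono order_trans[OF norm_triangle_ineq] simp: norm_mult)
    also have "\<dots> \<le> \<beta> * (M * E + M * (\<omega> * E))"
      using V[OF s] V'[OF s] w[OF s] w'[OF s] M beta unfolding E_def[symmetric]
      by (intro mult_left_mono add_mono mult_mono) auto
    also have "\<dots> \<le> \<beta> * (M * E + M * (3 * E))"
    proof -
      have "\<omega> \<le> 3" using omega(2) beta by linarith
      then show ?thesis using M E beta by (intro mult_left_mono add_left_mono mult_right_mono) auto
    qed
    finally show ?thesis by (simp add: E_def mult_ac)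
  qed
  have "bnd1 (64 * (2 * \<beta> * \<beta> * M * M') / \<beta> + 2 * (2 * \<beta> * \<beta> * M * M') + 2 * (4 * \<beta> * M * M')) (Nop (gop F G))"
    by (rule bnd1_Nop[OF hol sym bd bd'])
  then show "bnd1 (150 * \<beta> * M * M') (Nop (gop F G))"
  proof (rule bnd1_mono)
    define X where "X = \<beta> * M * M'"
    have "\<beta> * X \<le> 4/3 * X" using beta M by (intro mult_right_mono) (auto simp: X_def)
    moreover have "X \<ge> 0" using beta M by (simp add: X_def)
    moreover have "64 * (2 * \<beta> * \<beta> * M * M') / \<beta> = 128 * X" using beta by (simp add: X_def)
    moreover have "2 * (2 * \<beta> * \<beta> * M * M') = 4 * (\<beta> * X)" "2 * (4 * \<beta> * M * M') = 8 * X" "150 * \<beta> * M * M' = 150 * X"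
      by (simp_all add: X_def)
    ultimately show "64 * (2 * \<beta> * \<beta> * M * M') / \<beta> + 2 * (2 * \<beta> * \<beta> * M * M') + 2 * (4 * \<beta> * M * M') \<le> 150 * \<beta> * M * M'"
      by linarith
  qed
  show "wF (Nop (gop F G)) s = - gop F G s" if s: "s \<in> Inn" for s
  proof -
    have "Nop (gop F G) (s + \<i> * \<omega>) - Nop (gop F G) (s - \<i> * \<omega>) = - 2 * \<i> * gop F G s"
      by (rule Nop_jump[OF hol sym bd bd' s])
    then show ?thesis unfolding wF_def by (simp only:) simp
  qed
qed

end

section \<open>The power series in the parameter\<close>

lemma sum_inverse_squares_le: "(\<Sum>j=1..<n. 1 / (real j)\<^sup>2) \<le> 2"
proof -
  have *: "(\<Sum>j=1..<Suc (Suc n). 1 / (real j)\<^sup>2) \<le> 2 - 1 / real (Suc n)" for n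
  proof (induction n)
    case 0 then show ?case by simp
  next
    case (Suc n)
    define x where "x = real (Suc n)"
    have x: "x > 0" by (simp add: x_def)
    have "1 / (x + 1)\<^sup>2 \<le> 1 / (x * (x + 1))" using x by (intro divide_left_mono) (auto simp: power2_eq_square)
    also have "\<dots> = 1 / x - 1 / (x + 1)" using x by (simp add: field_simps)
    finally show ?case using Suc.IH by (simp add: x_def add.commute)
  qed
  consider "n = 0" | "n = 1" | m where "n = Suc (Suc m)" by (metis One_nat_def not0_implies_Suc)
  then show ?thesis
  proof cases
    case 3
    have "1 / real (Suc m) \<ge> 0" by simp
    then show ?thesis using *[of m] unfolding 3 by linarith
  qed auto
qed

text \<open>From (x + y)^2 \<le> 2 (x^2 + y^2). The sequence 1/n^2 is stable under convolution up to
  a constant, so q^n / n^2 can serve as coefficient bound in a quadratic recursion.\<close>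

lemma convolution_inverse_squares_le:
  "(\<Sum>j=1..<n. 1 / ((real j)\<^sup>2 * (real (n - j))\<^sup>2)) \<le> 8 / (real n)\<^sup>2"
proof (cases "n \<ge> 2")
  case True
  have t: "1 / ((real j)\<^sup>2 * (real (n - j))\<^sup>2) \<le> 2 / (real n)\<^sup>2 * (1 / (real j)\<^sup>2 + 1 / (real (n - j))\<^sup>2)" if "j \<in> {1..<n}" for j
  proof -
    define x y where "x = real j" and "y = real (n - j)"
    have p: "x > 0" "y > 0" "real n = x + y" using that by (auto simp: x_def y_def)
    have "(x + y)\<^sup>2 \<le> 2 * (x\<^sup>2 + y\<^sup>2)" using zero_le_power2[of "x - y"] by (simp add: power2_eq_square algebra_simps)
    then have "(x + y)\<^sup>2 / ((x + y)\<^sup>2 * (x\<^sup>2 * y\<^sup>2)) \<le> 2 * (x\<^sup>2 + y\<^sup>2) / ((x + y)\<^sup>2 * (x\<^sup>2 * y\<^sup>2))"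
      by (intro divide_right_mono) auto
    moreover have "(x + y)\<^sup>2 / ((x + y)\<^sup>2 * (x\<^sup>2 * y\<^sup>2)) = 1 / (x\<^sup>2 * y\<^sup>2)" using p by simp
    moreover have "2 * (x\<^sup>2 + y\<^sup>2) / ((x + y)\<^sup>2 * (x\<^sup>2 * y\<^sup>2)) = 2 / (x + y)\<^sup>2 * (1 / x\<^sup>2 + 1 / y\<^sup>2)"
    proof -
      have "1 / x\<^sup>2 + 1 / y\<^sup>2 = (x\<^sup>2 + y\<^sup>2) / (x\<^sup>2 * y\<^sup>2)" using p by (simp add: field_simps)
      then show ?thesis by simp
    qed
    ultimately show ?thesis using p unfolding x_def[symmetric] y_def[symmetric] by simp
  qed
  have "(\<Sum>j=1..<n. 1 / ((real j)\<^sup>2 * (real (n - j))\<^sup>2)) \<le> (\<Sum>j=1..<n. 2 / (real n)\<^sup>2 * (1 / (real j)\<^sup>2 + 1 / (real (n - j))\<^sup>2))"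
    by (rule sum_mono[OF t])
  also have "\<dots> = 2 / (real n)\<^sup>2 * ((\<Sum>j=1..<n. 1 / (real j)\<^sup>2) + (\<Sum>j=1..<n. 1 / (real (n - j))\<^sup>2))"
    by (simp add: sum_distrib_left sum.distrib distrib_left)
  also have "(\<Sum>j=1..<n. 1 / (real (n - j))\<^sup>2) = (\<Sum>j=1..<n. 1 / (real j)\<^sup>2)"
    by (rule sum.reindex_bij_witness[of _ "\<lambda>j. n - j" "\<lambda>j. n - j"]) auto
  also have "2 / (real n)\<^sup>2 * ((\<Sum>j=1..<n. 1 / (real j)\<^sup>2) + (\<Sum>j=1..<n. 1 / (real j)\<^sup>2)) \<le> 2 / (real n)\<^sup>2 * (2 + 2)"
    using sum_inverse_squares_le[of n] by (intro mult_left_mono) auto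
  finally show ?thesis by simp
next
  case False
  then have "n = 0 \<or> n = 1" by auto
  then show ?thesis by auto
qed

context gdg
begin

section \<open>Coefficient bounds and the recursion\<close>

definition q :: real where "q = 10^25 * \<beta>"

text \<open>128 is the bound of \<open>Z0\<close>. The divisor 10^10 beats the factor 10^8 of
  \<open>linearised_solvable\<close> in the quadratic term. The 10^25 in \<open>q\<close> is then
  dictated by n = 1, where 10^8 times 150 times 128^2 times \<beta> must not exceed q /
  10^10.\<close>

definition b :: "nat \<Rightarrow> real" where
  "b n = (if n = 0 then 128 else q ^ n / (10^10 * (real n)\<^sup>2))"

lemma q_pos: "q > 0" using beta by (simp add: q_def)

lemma b_pos: "b n > 0" using q_pos by (simp add: b_def)

lemma b_conv: "(\<Sum>j=1..<n. b j * b (n - j)) \<le> 8 / 10^10 * (q ^ n / (10^10 * (real n)\<^sup>2))"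
proof -
  have "(\<Sum>j=1..<n. b j * b (n - j)) = (\<Sum>j=1..<n. q ^ n / 10^20 * (1 / ((real j)\<^sup>2 * (real (n - j))\<^sup>2)))"
  proof (rule sum.cong[OF refl])
    fix j assume "j \<in> {1..<n}"
    then have "j \<noteq> 0" "n - j \<noteq> 0" "q ^ j * q ^ (n - j) = q ^ n" by (auto simp flip: power_add)
    then show "b j * b (n - j) = q ^ n / 10^20 * (1 / ((real j)\<^sup>2 * (real (n - j))\<^sup>2))"
      by (simp add: b_def)
  qed
  also have "\<dots> = q ^ n / 10^20 * (\<Sum>j=1..<n. 1 / ((real j)\<^sup>2 * (real (n - j))\<^sup>2))" by (simp add: sum_distrib_left)
  also have "\<dots> \<le> q ^ n / 10^20 * (8 / (real n)\<^sup>2)"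
    using q_pos convolution_inverse_squares_le by (intro mult_left_mono) auto
  finally show ?thesis by simp
qed

text \<open>The induction step for the coefficient bounds: 10^8 bounds the solution operator, the
  first sum comes from the quadratic term and the second one from the transport term.\<close>

lemma b_rec:
  assumes n: "n \<ge> 1"
  shows "10^8 * ((\<Sum>j=1..<n. b j * b (n - j)) + (\<Sum>j<n. 150 * \<beta> * b j * b (n - 1 - j))) \<le> b n"
proof (cases "n = 1")
  case True
  then show ?thesis using beta by (simp add: b_def q_def)
next
  case False
  define m where "m = n - 1"
  have m: "m \<ge> 1" "n = Suc m" using n False by (auto simp: m_def)
  define X where "X = q ^ n / (10^10 * (real n)\<^sup>2)"
  have X: "X \<ge> 0" using q_pos by (simp add: X_def)
  define Y where "Y = q ^ m / (10^10 * (real m)\<^sup>2)"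
  have bm: "b m = Y" "b n = X" using m by (auto simp: b_def X_def Y_def)
  have "(\<Sum>j<n. b j * b (n - 1 - j)) = (\<Sum>j\<in>{0..<Suc m}. b j * b (m - j))"
    by (simp add: m(2) atLeast0LessThan)
  also have "\<dots> = b 0 * b m + (\<Sum>j=1..<m. b j * b (m - j)) + b m * b 0"
    using m by (simp add: sum.atLeast_Suc_lessThan)
  also have "\<dots> \<le> 256 * Y + 8 / 10^10 * Y"
    using b_conv[of m] unfolding Y_def[symmetric] bm(1) by (simp add: b_def)
  finally have s2: "(\<Sum>j<n. b j * b (n - 1 - j)) \<le> 257 * Y"
    using b_pos[of m] unfolding bm(1) by simp
  \<comment> \<open>Besides the factor \<open>q\<close>, passing from n - 1 to n costs (n / (n -
    1))^2, which is at most 4.\<close>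
  have Y: "q * Y \<le> 4 * X"
  proof -
    have "q * Y = q ^ n / (10^10 * (real m)\<^sup>2)" by (simp add: Y_def m(2))
    also have "\<dots> \<le> q ^ n / (10^10 * ((real n)\<^sup>2 / 4))"
    proof (intro divide_left_mono mult_left_mono)
      have "real n / 2 \<le> real m" using m by simp
      then have "(real n / 2)\<^sup>2 \<le> (real m)\<^sup>2" by (intro power_mono) auto
      then show "(real n)\<^sup>2 / 4 \<le> (real m)\<^sup>2" by (simp add: power_divide)
    qed (use m q_pos in auto)
    also have "\<dots> = 4 * X" by (simp add: X_def)
    finally show ?thesis .
  qed
  have bY: "10^25 * (\<beta> * Y) \<le> 4 * X" using Y by (simp add: q_def mult_ac)
  have "(\<Sum>j<n. 150 * \<beta> * b j * b (n - 1 - j)) = 150 * \<beta> * (\<Sum>j<n. b j * b (n - 1 - j))"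
    by (simp add: sum_distrib_left mult_ac)
  also have "\<dots> \<le> 150 * \<beta> * (257 * Y)" using s2 beta by (intro mult_left_mono) auto
  also have "\<dots> = 38550 * (\<beta> * Y)" by simp
  finally have s3: "(\<Sum>j<n. 150 * \<beta> * b j * b (n - 1 - j)) \<le> 38550 * (\<beta> * Y)" .
  have s1: "(\<Sum>j=1..<n. b j * b (n - j)) \<le> 8 / 10^10 * X" using b_conv[of n] by (simp add: X_def)
  define Z where "Z = \<beta> * Y"
  have Z: "Z \<ge> 0" "10^25 * Z \<le> 4 * X" using beta q_pos bY by (auto simp: Z_def Y_def)
  have "10^8 * ((\<Sum>j=1..<n. b j * b (n - j)) + (\<Sum>j<n. 150 * \<beta> * b j * b (n - 1 - j))) \<le> 10^8 * (8 / 10^10 * X + 38550 * Z)"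
    by (intro mult_left_mono add_mono s1 s3[folded Z_def]) auto
  also have "\<dots> \<le> X" using Z X by simp
  finally show ?thesis unfolding bm(2) .
qed

text \<open>The two products with \<open>f 0\<close> are left out because they belong to the left
  side, where \<open>tnh\<close> is 1 - \<open>Z0\<close>. Only lower indices occur, so each
  coefficient solves a linear equation.\<close>

definition rhs :: "(nat \<Rightarrow> complex \<Rightarrow> complex) \<Rightarrow> nat \<Rightarrow> complex \<Rightarrow> complex" where
  "rhs f n s = (\<Sum>j=1..<n. f j s * f (n - j) s / 2) + (\<Sum>j<n. Nop (gop (f j) (f (n - 1 - j))) s)"

lemma profile_series_ex:
  "\<exists>f. f 0 = Z0 \<and> (\<forall>n. bnd2 (b n) (f n)) \<and>
      (\<forall>n\<ge>1. \<forall>s\<in>Str. deriv (f n) s + tnh s * f n s = rhs f n s)"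
proof -
  define P where "P = (\<lambda>f n r. if n = 0 then r = Z0 else
      bnd2 (b n) r \<and> (\<forall>s\<in>Str. deriv r s + tnh s * r s = rhs f n s))"
  have "\<exists>f. \<forall>n. P f n (f n)"
  \<comment> \<open>A coefficient can be found only once the bounds of all earlier ones are known,
    hence a dependent choice along the well-founded order rather than a recursive
    definition.\<close>
  proof (rule dependent_wf_choice[of "{(x, y). x < y}"])
    show "wf {(x, y). x < (y::nat)}" by (rule wf)
    fix f g :: "nat \<Rightarrow> complex \<Rightarrow> complex" and n r
    assume eq: "\<And>z. (z, n) \<in> {(x, y). x < y} \<Longrightarrow> f z = g z"
    have "rhs f n = rhs g n" unfolding rhs_def using eq by (intro ext arg_cong2[where f = "(+)"] sum.cong) auto
    then show "P f n r = P g n r" by (simp add: P_def)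
  next
    fix n and f :: "nat \<Rightarrow> complex \<Rightarrow> complex"
    assume IH: "\<And>y. (y, n) \<in> {(x, y). x < y} \<Longrightarrow> P f y (f y)"
    have nbj: "bnd2 (b j) (f j)" if "j < n" for j
      using IH[of j] that bnd2_Z0 by (auto simp: P_def b_def split: if_splits)
    show "\<exists>r. P f n r"
    proof (cases "n = 0")
      case True then show ?thesis by (simp add: P_def)
    next
      case False
      have "bnd1 (\<Sum>j=1..<n. 2 * b j * b (n - j) / 2) (\<lambda>s. \<Sum>j=1..<n. f j s * f (n - j) s / 2)"
        using nbj by (intro bnd1_sum bnd1_half bnd1_mult bnd2_bnd1) auto
      moreover have "bnd1 (\<Sum>j<n. 150 * \<beta> * b j * b (n - 1 - j)) (\<lambda>s. \<Sum>j<n. Nop (gop (f j) (f (n - 1 - j))) s)"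
        using nbj by (intro bnd1_sum bnd1_Nop_gop) auto
      ultimately have "bnd1 ((\<Sum>j=1..<n. 2 * b j * b (n - j) / 2) + (\<Sum>j<n. 150 * \<beta> * b j * b (n - 1 - j))) (rhs f n)"
        unfolding rhs_def[abs_def] by (rule bnd1_add)
      from linearised_solvable[OF this] obtain r where r: "bnd2 (10^8 * ((\<Sum>j=1..<n. 2 * b j * b (n - j) / 2) + (\<Sum>j<n. 150 * \<beta> * b j * b (n - 1 - j)))) r"
        "\<forall>s\<in>Str. deriv r s + tnh s * r s = rhs f n s" by blast
      have "bnd2 (b n) r" using r(1)
      proof (rule bnd2_mono)
        show "10^8 * ((\<Sum>j=1..<n. 2 * b j * b (n - j) / 2) + (\<Sum>j<n. 150 * \<beta> * b j * b (n - 1 - j))) \<le> b n"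
          using b_rec[of n] False by simp
      qed
      then show ?thesis using r False by (auto simp: P_def)
    qed
  qed
  then obtain f where f: "\<And>n. P f n (f n)" by blast
  have "f 0 = Z0" using f[of 0] by (simp add: P_def)
  moreover have "bnd2 (b n) (f n)" for n
    using f[of n] bnd2_Z0 by (auto simp: P_def b_def split: if_splits)
  moreover have "\<forall>s\<in>Str. deriv (f n) s + tnh s * f n s = rhs f n s" if "n \<ge> 1" for n
    using f[of n] that by (simp add: P_def)
  ultimately show ?thesis by blast
qed

definition ff :: "nat \<Rightarrow> complex \<Rightarrow> complex" where
  "ff = (SOME f. f 0 = Z0 \<and> (\<forall>n. bnd2 (b n) (f n)) \<and>
      (\<forall>n\<ge>1. \<forall>s\<in>Str. deriv (f n) s + tnh s * f n s = rhs f n s))"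

lemma ff: "ff 0 = Z0" "bnd2 (b n) (ff n)"
  "n \<ge> 1 \<Longrightarrow> s \<in> Str \<Longrightarrow> deriv (ff n) s + tnh s * ff n s = rhs ff n s"
  using someI_ex[OF profile_series_ex, folded ff_def] by auto

lemma ff_rec:
  assumes s: "s \<in> Str"
  shows "deriv (ff n) s + ff n s = (\<Sum>j\<le>n. ff j s * ff (n - j) s) / 2 + (\<Sum>j<n. Nop (gop (ff j) (ff (n - 1 - j))) s)"
proof (cases "n = 0")
  case True
  then show ?thesis using Z0_ode[OF s] by (simp add: ff(1))
next
  case False
  have sp: "(\<Sum>j\<le>n. ff j s * ff (n - j) s) = 2 * (Z0 s * ff n s) + (\<Sum>j=1..<n. ff j s * ff (n - j) s)"
  proof -
    have "{..n} = insert 0 (insert n {1..<n})" using False by auto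
    then show ?thesis using False by (simp add: ff(1))
  qed
  have "deriv (ff n) s + (1 - Z0 s) * ff n s = rhs ff n s" using ff(3)[of n s] False s tnh_Z0[OF s] by simp
  then have "deriv (ff n) s + ff n s = Z0 s * ff n s + rhs ff n s" by (simp add: algebra_simps)
  then show ?thesis unfolding sp rhs_def by (simp add: sum_divide_distrib add_divide_distrib)
qed

text \<open>Taking jumps turns half the square of F into Hw times w, and \<open>Nop\<close> into the
  prescribed transport term. This is the part of order n of the profile equation.\<close>

lemma wF_ff_rec:
  assumes s: "s \<in> Inn"
  shows "wF (deriv (ff n)) s + wF (ff n) s = (\<Sum>j\<le>n. hF (ff j) s * wF (ff (n - j)) s)
     - of_real \<beta> * (\<Sum>j<n. VF (ff j) s * wF (deriv (ff (n - 1 - j))) s)"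
proof -
  let ?p = "s + \<i> * of_real \<omega>" and ?m = "s - \<i> * of_real \<omega>"
  note r = ff_rec[OF Inn_shift(1)[OF s], of n] ff_rec[OF Inn_shift(2)[OF s], of n]
  have "wF (deriv (ff n)) s + wF (ff n) s = ((deriv (ff n) ?p + ff n ?p) - (deriv (ff n) ?m + ff n ?m)) / (2 * \<i>)"
    unfolding wF_def add_divide_distrib[symmetric] by (rule arg_cong[where f = "\<lambda>x. x / (2 * \<i>)"]) simp
  also have "\<dots> = ((\<Sum>j\<le>n. ff j ?p * ff (n - j) ?p) - (\<Sum>j\<le>n. ff j ?m * ff (n - j) ?m)) / (4 * \<i>)
      + (\<Sum>j<n. wF (Nop (gop (ff j) (ff (n - 1 - j)))) s)"
  proof -
    have ws: "(\<Sum>j<n. wF (Nop (gop (ff j) (ff (n - 1 - j)))) s) =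
        ((\<Sum>j<n. Nop (gop (ff j) (ff (n - 1 - j))) ?p) - (\<Sum>j<n. Nop (gop (ff j) (ff (n - 1 - j))) ?m)) / (2 * \<i>)"
      by (simp only: wF_def sum_divide_distrib[symmetric] sum_subtractf)
    show ?thesis unfolding r ws by (simp add: field_simps)
  qed
  also have "(\<Sum>j<n. wF (Nop (gop (ff j) (ff (n - 1 - j)))) s) = - (of_real \<beta> * (\<Sum>j<n. VF (ff j) s * wF (deriv (ff (n - 1 - j))) s))"
    by (simp add: bnd1_Nop_gop(2)[OF ff(2) ff(2) s] gop_def sum_negf sum_distrib_left mult.assoc)
  also have "((\<Sum>j\<le>n. ff j ?p * ff (n - j) ?p) - (\<Sum>j\<le>n. ff j ?m * ff (n - j) ?m)) / (4 * \<i>)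
      = (\<Sum>j\<le>n. hF (ff j) s * wF (ff (n - j)) s)"
  proof -
    \<comment> \<open>A difference of products polarises into two mixed products of h and w; the
      symmetry under j to n - j then makes both sums equal and removes the half.\<close>
    have e: "(ff j ?p * ff (n - j) ?p - ff j ?m * ff (n - j) ?m) / (4 * \<i>)
        = (hF (ff j) s * wF (ff (n - j)) s + hF (ff (n - j)) s * wF (ff j) s) / 2" for j
      unfolding hF_def wF_def by (simp add: field_simps)
    have "((\<Sum>j\<le>n. ff j ?p * ff (n - j) ?p) - (\<Sum>j\<le>n. ff j ?m * ff (n - j) ?m)) / (4 * \<i>)
       = (\<Sum>j\<le>n. (ff j ?p * ff (n - j) ?p - ff j ?m * ff (n - j) ?m) / (4 * \<i>))"
      by (simp only: sum_subtractf[symmetric] sum_divide_distrib)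
    also have "\<dots> = ((\<Sum>j\<le>n. hF (ff j) s * wF (ff (n - j)) s) + (\<Sum>j\<le>n. hF (ff (n - j)) s * wF (ff j) s)) / 2"
      by (simp only: e sum_divide_distrib[symmetric] sum.distrib)
    also have "(\<Sum>j\<le>n. hF (ff (n - j)) s * wF (ff j) s) = (\<Sum>j\<le>n. hF (ff j) s * wF (ff (n - j)) s)"
      by (rule sum.reindex_bij_witness[of _ "\<lambda>j. n - j" "\<lambda>j. n - j"]) auto
    finally show ?thesis by simp
  qed
  finally show ?thesis by simp
qed


section \<open>Summation of the series and the profile equation\<close>

lemma b_le: "b n \<le> 128 * q ^ n"
proof (cases "n = 0")
  case False
  then have "1 \<le> (real n)\<^sup>2" by simp
  then have "1 * 1 \<le> 10^10 * (real n)\<^sup>2" by (intro mult_mono) auto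
  then have "q ^ n / (10^10 * (real n)\<^sup>2) \<le> q ^ n / 1" using q_pos False by (intro divide_left_mono) auto
  also have "\<dots> \<le> 128 * q ^ n" using q_pos by simp
  finally show ?thesis using False by (simp add: b_def)
qed (simp add: b_def)

lemma summable_b: assumes "\<bar>a\<bar> * q < 1" shows "summable (\<lambda>n. \<bar>a\<bar> ^ n * b n)"
proof (rule summable_comparison_test')
  show "summable (\<lambda>n. 128 * (\<bar>a\<bar> * q) ^ n)"
    using assms q_pos by (intro summable_mult summable_geometric) auto
  show "norm (\<bar>a\<bar> ^ n * b n) \<le> 128 * (\<bar>a\<bar> * q) ^ n" for n
  proof -
    have "\<bar>a\<bar> ^ n * b n \<le> \<bar>a\<bar> ^ n * (128 * q ^ n)" by (intro mult_left_mono b_le) auto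
    then show ?thesis using b_pos[of n] by (simp add: power_mult_distrib mult_ac)
  qed
qed

definition Fa :: "real \<Rightarrow> complex \<Rightarrow> complex" where "Fa a s = (\<Sum>n. of_real a ^ n * ff n s)"
definition Ba :: "real \<Rightarrow> real" where "Ba a = (\<Sum>n. \<bar>a\<bar> ^ n * b n)"

lemma suminf_norm_le:
  fixes f :: "nat \<Rightarrow> complex"
  assumes "f sums S" "summable h" "\<And>n. norm (f n) \<le> h n * e" shows "norm S \<le> (\<Sum>n. h n) * e"
proof -
  have s: "summable (\<lambda>n. h n * e)" using assms(2) by (rule summable_mult2)
  have "norm (suminf f) \<le> (\<Sum>n. h n * e)"
    by (rule norm_suminf_le[OF assms(3) s])
  then show ?thesis using assms(1,2) by (simp add: sums_iff suminf_mult2)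
qed

lemma coeff_le: "norm (z::complex) \<le> b n * e \<Longrightarrow> norm (of_real a ^ n * z) \<le> \<bar>a\<bar> ^ n * b n * e"
  using mult_left_mono[of "norm z" "b n * e" "\<bar>a\<bar> ^ n"] by (simp add: norm_mult norm_power mult_ac)

lemma coeff_le1: "norm (z::complex) \<le> b n \<Longrightarrow> norm (of_real a ^ n * z) \<le> \<bar>a\<bar> ^ n * b n"
  using coeff_le[of z n 1 a] by simp

lemma VF_integrable:
  assumes F: "F holomorphic_on Str" and bd: "\<And>z. z \<in> Str \<Longrightarrow> norm (F z) \<le> M" and z: "z \<in> Inn"
  shows "integrable (restrict_space lborel {0<..1}) (\<lambda>v. hF F (z + of_real (\<beta> * ln v)))"
proof (rule Bochner_Integration.integrable_bound[OF integrable_const_unit[of M]])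
  show "(\<lambda>v. hF F (z + of_real (\<beta> * ln v))) \<in> borel_measurable (restrict_space lborel {0<..1})"
    by (rule VF_measurable[OF F z])
  have "norm (hF F (z + of_real r)) \<le> norm M" for r
  proof -
    have "norm (hF F (z + of_real r)) \<le> M" by (rule hF_le[OF Inn_real[OF z], of F "\<lambda>_. M"]) (rule bd)
    then show ?thesis by simp
  qed
  then show "AE v in restrict_space lborel {0<..1}. norm (hF F (z + of_real (\<beta> * ln v))) \<le> norm M" by (intro AE_I2) blast
qed

context
  fixes a :: real
  assumes a: "\<bar>a\<bar> * q < 1"
begin

lemma Fa_series:
  assumes s: "s \<in> Str"
  shows "(\<lambda>n. of_real a ^ n * ff n s) sums Fa a s"
    and "(\<lambda>n. of_real a ^ n * deriv (ff n) s) sums deriv (Fa a) s"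
    and "(\<lambda>n. of_real a ^ n * deriv (deriv (ff n)) s) sums deriv (deriv (Fa a)) s"
    and "(Fa a has_field_derivative deriv (Fa a) s) (at s)"
    and "(deriv (Fa a) has_field_derivative deriv (deriv (Fa a)) s) (at s)"
proof -
  obtain g g' where g: "\<forall>x\<in>Str. ((\<lambda>n. of_real a ^ n * ff n x) sums g x) \<and> ((\<lambda>n. of_real a ^ n * deriv (ff n) x) sums g' x) \<and> (g has_field_derivative g' x) (at x)"
  proof (rule series_and_derivative_comparison[OF open_Str summable_b[OF a]])
    show "((\<lambda>x. of_real a ^ n * ff n x) has_field_derivative of_real a ^ n * deriv (ff n) x) (at x)" if "x \<in> Str" for n x
      by (intro DERIV_cmult bnd2_deriv[OF ff(2)] that)
    show "eventually (\<lambda>n. \<forall>x\<in>Str. norm (of_real a ^ n * ff n x) \<le> \<bar>a\<bar> ^ n * b n) sequentially"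
      using coeff_le1[OF bnd1_le[OF bnd2_bnd1[OF ff(2)]]] by (intro always_eventually) blast
  qed blast
  \<comment> \<open>The second derivative is reached by applying the same theorem to the series of
    first derivatives, for which \<open>b n\<close> is again a bound.\<close>
  obtain k k' where k: "\<forall>x\<in>Str. ((\<lambda>n. of_real a ^ n * deriv (ff n) x) sums k x) \<and> ((\<lambda>n. of_real a ^ n * deriv (deriv (ff n)) x) sums k' x) \<and> (k has_field_derivative k' x) (at x)"
  proof (rule series_and_derivative_comparison[OF open_Str summable_b[OF a]])
    show "((\<lambda>x. of_real a ^ n * deriv (ff n) x) has_field_derivative of_real a ^ n * deriv (deriv (ff n)) x) (at x)" if "x \<in> Str" for n x
      by (intro DERIV_cmult bnd2_deriv2[OF ff(2)] that)
    show "eventually (\<lambda>n. \<forall>x\<in>Str. norm (of_real a ^ n * deriv (ff n) x) \<le> \<bar>a\<bar> ^ n * b n) sequentially"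
      using coeff_le1[OF bnd1_le'[OF bnd2_bnd1[OF ff(2)]]] by (intro always_eventually) blast
  qed blast
  have Fg: "Fa a x = g x" if "x \<in> Str" for x unfolding Fa_def using g that sums_unique by metis
  have Fd: "(Fa a has_field_derivative g' x) (at x)" if "x \<in> Str" for x
    by (rule has_field_derivative_transform_within_open[of g _ _ Str]) (use g Fg that in auto)
  have dF: "deriv (Fa a) x = g' x" if "x \<in> Str" for x by (rule DERIV_imp_deriv[OF Fd[OF that]])
  have gk: "g' x = k x" if "x \<in> Str" for x using g k that sums_unique2 by blast
  have Fd2: "(deriv (Fa a) has_field_derivative k' x) (at x)" if "x \<in> Str" for x
    by (rule has_field_derivative_transform_within_open[of k _ _ Str]) (use k dF gk that in auto)
  have dF2: "deriv (deriv (Fa a)) x = k' x" if "x \<in> Str" for x by (rule DERIV_imp_deriv[OF Fd2[OF that]])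
  show "(\<lambda>n. of_real a ^ n * ff n s) sums Fa a s" using g Fg s by metis
  show "(\<lambda>n. of_real a ^ n * deriv (ff n) s) sums deriv (Fa a) s" using g dF s by metis
  show "(\<lambda>n. of_real a ^ n * deriv (deriv (ff n)) s) sums deriv (deriv (Fa a)) s" using k dF2 s by metis
  show "(Fa a has_field_derivative deriv (Fa a) s) (at s)" using Fd dF s by metis
  show "(deriv (Fa a) has_field_derivative deriv (deriv (Fa a)) s) (at s)" using Fd2 dF2 s by metis
qed

lemma bnd2_Fa: "bnd2 (Ba a) (Fa a)"
  unfolding bnd2_def bnd1_def
proof (intro conjI ballI)
  show "Fa a holomorphic_on Str"
    using Fa_series(4) by (intro holomorphic_onI) (auto simp: field_differentiable_def intro: has_field_derivative_at_within)
  fix s assume s: "s \<in> Str"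
  have "(\<lambda>n. cnj (of_real a ^ n * ff n s)) sums cnj (Fa a s)" using Fa_series(1)[OF s] by (simp only: sums_cnj)
  moreover have "cnj (of_real a ^ n * ff n s) = of_real a ^ n * ff n (cnj s)" for n
    using bnd1_sym[OF bnd2_bnd1[OF ff(2)] s] by simp
  ultimately have "(\<lambda>n. of_real a ^ n * ff n (cnj s)) sums cnj (Fa a s)" by (simp only:)
  then show "Fa a (cnj s) = cnj (Fa a s)" using Fa_series(1)[OF cnj_Str[OF s]] sums_unique2 by blast
  show "norm (Fa a s) \<le> Ba a * wp (Re s)"
    unfolding Ba_def by (rule suminf_norm_le[OF Fa_series(1)[OF s] summable_b[OF a]]) (rule coeff_le[OF bnd1_bound[OF bnd2_bnd1[OF ff(2)] s]])
  show "norm (deriv (Fa a) s) \<le> Ba a * wt (Re s)"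
    unfolding Ba_def by (rule suminf_norm_le[OF Fa_series(2)[OF s] summable_b[OF a]]) (rule coeff_le[OF bnd1_bound'[OF bnd2_bnd1[OF ff(2)] s]])
  show "norm (deriv (deriv (Fa a)) s) \<le> Ba a * wt (Re s)"
    unfolding Ba_def by (rule suminf_norm_le[OF Fa_series(3)[OF s] summable_b[OF a]]) (rule coeff_le[OF bnd2_bound''[OF ff(2) s]])
qed

lemma hF_series:
  assumes s: "s \<in> Inn" shows "(\<lambda>n. of_real a ^ n * hF (ff n) s) sums hF (Fa a) s"
proof -
  have "(\<lambda>n. (of_real a ^ n * ff n (s + \<i> * \<omega>) + of_real a ^ n * ff n (s - \<i> * \<omega>)) / 2) sums hF (Fa a) s"
    unfolding hF_def by (intro sums_divide sums_add Fa_series(1) Inn_shift s)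
  then show ?thesis by (simp add: hF_def distrib_left)
qed

lemma wF_series:
  assumes s: "s \<in> Inn" shows "(\<lambda>n. of_real a ^ n * wF (ff n) s) sums wF (Fa a) s"
proof -
  have "(\<lambda>n. (of_real a ^ n * ff n (s + \<i> * \<omega>) - of_real a ^ n * ff n (s - \<i> * \<omega>)) / (2 * \<i>)) sums wF (Fa a) s"
    unfolding wF_def by (intro sums_divide sums_diff Fa_series(1) Inn_shift s)
  moreover have "(of_real a ^ n * ff n (s + \<i> * \<omega>) - of_real a ^ n * ff n (s - \<i> * \<omega>)) / (2 * \<i>) = of_real a ^ n * wF (ff n) s" for n
    unfolding wF_def by (simp only: right_diff_distrib[symmetric] times_divide_eq_right)
  ultimately show ?thesis by (simp only:)
qed

lemma wF'_series:
  assumes s: "s \<in> Inn" shows "(\<lambda>n. of_real a ^ n * wF (deriv (ff n)) s) sums wF (deriv (Fa a)) s"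
proof -
  have "(\<lambda>n. (of_real a ^ n * deriv (ff n) (s + \<i> * \<omega>) - of_real a ^ n * deriv (ff n) (s - \<i> * \<omega>)) / (2 * \<i>)) sums wF (deriv (Fa a)) s"
    unfolding wF_def by (intro sums_divide sums_diff Fa_series(2) Inn_shift s)
  moreover have "(of_real a ^ n * deriv (ff n) (s + \<i> * \<omega>) - of_real a ^ n * deriv (ff n) (s - \<i> * \<omega>)) / (2 * \<i>) = of_real a ^ n * wF (deriv (ff n)) s" for n
    unfolding wF_def by (simp only: right_diff_distrib[symmetric] times_divide_eq_right)
  ultimately show ?thesis by (simp only:)
qed

lemma VF_series:
  assumes s: "s \<in> Inn" shows "(\<lambda>n. of_real a ^ n * VF (ff n) s) sums VF (Fa a) s"
proof -
  let ?M = "restrict_space lborel {0<..1::real}"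
  let ?f = "\<lambda>n v. of_real a ^ n * hF (ff n) (s + of_real (\<beta> * ln v))"
  have i: "integrable ?M (\<lambda>v. hF (ff n) (s + of_real (\<beta> * ln v)))" for n
    by (rule VF_integrable[OF bnd2_hol[OF ff(2)] bnd1_le[OF bnd2_bnd1[OF ff(2)]] s])
  have bd: "norm (?f n v) \<le> \<bar>a\<bar> ^ n * b n" for n v
    by (rule coeff_le1, rule hF_le[OF Inn_real[OF s], of "ff n" "\<lambda>_. b n"]) (rule bnd1_le[OF bnd2_bnd1[OF ff(2)]])
  have "(\<lambda>n. \<integral>v. ?f n v \<partial>?M) sums (\<integral>v. (\<Sum>n. ?f n v) \<partial>?M)"
  proof (rule sums_integral)
    show "integrable ?M (?f n)" for n by (intro integrable_mult_right i)
    show "AE v in ?M. summable (\<lambda>n. norm (?f n v))"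
      by (intro AE_I2 summable_comparison_test'[OF summable_b[OF a]]) (use bd in auto)
    show "summable (\<lambda>n. \<integral>v. norm (?f n v) \<partial>?M)"
    proof (rule summable_comparison_test'[OF summable_b[OF a]])
      fix n
      have "(\<integral>v. norm (?f n v) \<partial>?M) \<le> (\<integral>v. \<bar>a\<bar> ^ n * b n \<partial>?M)"
        by (intro integral_mono integrable_norm integrable_mult_right i integrable_const_unit bd)
      then have "(\<integral>v. norm (?f n v) \<partial>?M) \<le> \<bar>a\<bar> ^ n * b n" by (simp only: integral_const_unit)
      then show "norm (\<integral>v. norm (?f n v) \<partial>?M) \<le> \<bar>a\<bar> ^ n * b n" by simp
    qed
  qed
  moreover have "(\<Sum>n. ?f n v) = hF (Fa a) (s + of_real (\<beta> * ln v))" for v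
    using hF_series[OF Inn_real[OF s]] by (metis sums_unique)
  ultimately show ?thesis by (simp add: VF_def)
qed

text \<open>The recursion for the jumps, multiplied by a^n and summed; absolute convergence turns
  the convolutions into products.\<close>

lemma profile_equation:
  assumes s: "s \<in> Inn"
  shows "wF (Fa a) s + wF (deriv (Fa a)) s + of_real (a * \<beta>) * VF (Fa a) s * wF (deriv (Fa a)) s = hF (Fa a) s * wF (Fa a) s"
proof -
  have ab: "summable (\<lambda>n. norm (of_real a ^ n * x n))" if "\<And>n. norm (x n) \<le> b n" for x :: "nat \<Rightarrow> complex"
    by (rule summable_comparison_test'[OF summable_b[OF a]]) (use coeff_le1[OF that] in auto)
  have hb: "norm (hF (ff n) s) \<le> b n" for n by (rule hF_le[OF s, of "ff n" "\<lambda>_. b n"]) (rule bnd1_le[OF bnd2_bnd1[OF ff(2)]])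
  have wb: "norm (wF (ff n) s) \<le> b n" for n by (rule wF_le[OF s, of "ff n" "\<lambda>_. b n"]) (rule bnd1_le[OF bnd2_bnd1[OF ff(2)]])
  have wb': "norm (wF (deriv (ff n)) s) \<le> b n" for n by (rule wF_le[OF s, of "deriv (ff n)" "\<lambda>_. b n"]) (rule bnd1_le'[OF bnd2_bnd1[OF ff(2)]])
  have vb: "norm (VF (ff n) s) \<le> b n" for n
    by (rule VF_le, rule hF_le[where B = "\<lambda>_. b n"]) (use Inn_real[OF s] bnd1_le[OF bnd2_bnd1[OF ff(2)]] in auto)
  let ?A = "of_real a :: complex"
  have conv: "(\<lambda>n. ?A ^ n * (\<Sum>j\<le>n. x j * y (n - j))) sums (X * Y)"
    if xy: "\<And>n. norm (x n) \<le> b n" "\<And>n. norm (y n) \<le> b n" "(\<lambda>n. ?A ^ n * x n) sums X" "(\<lambda>n. ?A ^ n * y n) sums Y"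
    for x y :: "nat \<Rightarrow> complex" and X Y
  proof -
    have "(\<lambda>n. \<Sum>j\<le>n. (?A ^ j * x j) * (?A ^ (n - j) * y (n - j))) sums (X * Y)"
      using Cauchy_product_sums[OF ab[of x, OF xy(1)] ab[of y, OF xy(2)]] xy(3,4) by (simp only: sums_iff)
    moreover have "(\<Sum>j\<le>n. (?A ^ j * x j) * (?A ^ (n - j) * y (n - j))) = ?A ^ n * (\<Sum>j\<le>n. x j * y (n - j))" for n
      unfolding sum_distrib_left
    proof (rule sum.cong[OF refl])
      fix j assume "j \<in> {..n}"
      then have "?A ^ n = ?A ^ j * ?A ^ (n - j)" by (simp flip: power_add)
      then show "(?A ^ j * x j) * (?A ^ (n - j) * y (n - j)) = ?A ^ n * (x j * y (n - j))" by simp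
    qed
    ultimately show ?thesis by simp
  qed
  note c1 = conv[OF hb wb hF_series[OF s] wF_series[OF s]]
    and c2 = conv[OF vb wb' VF_series[OF s] wF'_series[OF s]]
  \<comment> \<open>The transport sum of order n has total index n - 1 and is empty for n = 0;
    shifting the index by one produces the factor a in front of this term.\<close>
  have c3: "(\<lambda>n. ?A ^ n * (\<Sum>j<n. VF (ff j) s * wF (deriv (ff (n - 1 - j))) s)) sums (?A * (VF (Fa a) s * wF (deriv (Fa a)) s))"
  proof -
    have "(\<lambda>n. ?A * (?A ^ n * (\<Sum>j\<le>n. VF (ff j) s * wF (deriv (ff (n - j))) s))) sums (?A * (VF (Fa a) s * wF (deriv (Fa a)) s))"
      using c2 by (rule sums_mult)
    then have "(\<lambda>n. ?A ^ Suc n * (\<Sum>j<Suc n. VF (ff j) s * wF (deriv (ff (Suc n - 1 - j))) s)) sums (?A * (VF (Fa a) s * wF (deriv (Fa a)) s))"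
      by (simp add: lessThan_Suc_atMost mult.assoc)
    from sums_Suc[OF this] show ?thesis by simp
  qed
  have "(\<lambda>n. ?A ^ n * wF (deriv (ff n)) s + ?A ^ n * wF (ff n) s) sums (wF (deriv (Fa a)) s + wF (Fa a) s)"
    by (intro sums_add wF_series wF'_series s)
  moreover have "?A ^ n * wF (deriv (ff n)) s + ?A ^ n * wF (ff n) s = ?A ^ n * (\<Sum>j\<le>n. hF (ff j) s * wF (ff (n - j)) s)
     - of_real \<beta> * (?A ^ n * (\<Sum>j<n. VF (ff j) s * wF (deriv (ff (n - 1 - j))) s))" for n
    using wF_ff_rec[OF s, of n] by (simp only: distrib_left[symmetric]) (simp add: algebra_simps)
  moreover have "(\<lambda>n. ?A ^ n * (\<Sum>j\<le>n. hF (ff j) s * wF (ff (n - j)) s)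
     - of_real \<beta> * (?A ^ n * (\<Sum>j<n. VF (ff j) s * wF (deriv (ff (n - 1 - j))) s))) sums
       (hF (Fa a) s * wF (Fa a) s - of_real \<beta> * (?A * (VF (Fa a) s * wF (deriv (Fa a)) s)))"
    by (intro sums_diff sums_mult c1 c3)
  ultimately have "wF (deriv (Fa a)) s + wF (Fa a) s = hF (Fa a) s * wF (Fa a) s - of_real \<beta> * (?A * (VF (Fa a) s * wF (deriv (Fa a)) s))"
    by (metis (no_types, lifting) sums_cong sums_unique2)
  then show ?thesis by (simp add: algebra_simps)
qed

end

end

section \<open>The profile on the real line\<close>

lemma Re_of_real_has_real_derivative:
  assumes "(f has_field_derivative D) (at (complex_of_real x))"
  shows "((\<lambda>x. Re (f (of_real x))) has_real_derivative Re D) (at x)"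
proof -
  have "((\<lambda>x. f (of_real x)) has_vector_derivative D) (at x)"
    by (rule has_vector_derivative_real_field[OF assms])
  then have "((\<lambda>x. Re (f (of_real x))) has_vector_derivative Re D) (at x)"
    by (rule bounded_linear.has_vector_derivative[OF bounded_linear_Re])
  then show ?thesis by (simp add: has_real_derivative_iff_has_vector_derivative)
qed

lemma exp_neg_abs_ln_le:
  fixes x k :: real
  assumes "x \<noteq> 0" "k \<ge> 0" shows "exp (- k * \<bar>ln \<bar>x\<bar>\<bar>) \<le> \<bar>x\<bar> powr k"
proof -
  have "- k * \<bar>ln \<bar>x\<bar>\<bar> \<le> k * ln \<bar>x\<bar>"
    using assms mult_left_mono[of "- \<bar>ln \<bar>x\<bar>\<bar>" "ln \<bar>x\<bar>" k] by simp
  then show ?thesis using assms by (simp add: powr_def)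
qed

context gdg
begin

lemma th_beta: "3/4 * \<beta> = \<alpha>" by (simp add: \<beta>_def)

lemma real_in_Inn [simp]: "complex_of_real x \<in> Inn" using delta by (simp add: Inn_iff)
lemma real_in_Str [simp]: "complex_of_real x \<in> Str" using delta omega by (simp add: Str_iff)

definition lim0 :: "(complex \<Rightarrow> complex) \<Rightarrow> complex" where
  "lim0 F = lim (\<lambda>n. F (of_real (- real n)))"

text \<open>The function on the upper half plane with boundary values Hw - i w. The point 0
  corresponds to Re s tending to minus infinity, where the logarithm gives no value, so the limit is
  inserted by hand.\<close>

definition Phi :: "(complex \<Rightarrow> complex) \<Rightarrow> complex \<Rightarrow> complex" where
  "Phi F z = (if z = 0 then lim0 F else F (of_real \<beta> * Ln (- \<i> * z)))"

text \<open>The half line x > 0 is the line Im s = -\<omega>, where F = Hw - i w; conjugation gives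
  the opposite sign for x < 0. At x = 0 the factor \<open>sgn\<close> yields 0 whatever default ln 0
  has.\<close>

definition PW :: "(complex \<Rightarrow> complex) \<Rightarrow> real \<Rightarrow> real" where
  "PW F x = sgn x * Re (wF F (of_real (\<beta> * ln \<bar>x\<bar>)))"

text \<open>This is x times the derivative of the profile, extended by 0 to x = 0, where the profile
  need not be differentiable.\<close>

definition PD :: "(complex \<Rightarrow> complex) \<Rightarrow> real \<Rightarrow> real" where
  "PD F x = \<beta> * sgn x * Re (wF (deriv F) (of_real (\<beta> * ln \<bar>x\<bar>)))"

definition PH :: "(complex \<Rightarrow> complex) \<Rightarrow> real \<Rightarrow> real" where
  "PH F x = Re (Phi F (of_real x))"

definition PV :: "(complex \<Rightarrow> complex) \<Rightarrow> real \<Rightarrow> real" where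
  "PV F x = integral {0..1} (\<lambda>v. PH F (x * v))"

text \<open>An open sector around the closed upper half plane without 0. Its half angle 5 pi / 8 is
  (\<omega> + \<delta>) / \<beta>, so nonzero real points become interior points of the domain of
  F.\<close>

definition Sec :: "complex set" where
  "Sec = {z. - \<i> * z \<notin> \<real>\<^sub>\<le>\<^sub>0 \<and> \<bar>Im (Ln (- \<i> * z))\<bar> < 5 * pi / 8}"

lemma open_Sec: "open Sec"
proof -
  have "open {z. - \<i> * z \<in> - \<real>\<^sub>\<le>\<^sub>0}"
  proof -
    have "open ((\<lambda>z. - \<i> * z) -` (- \<real>\<^sub>\<le>\<^sub>0))"
      by (rule open_vimage) (auto intro!: continuous_intros)
    then show ?thesis by (simp add: vimage_def)
  qed
  moreover have "continuous_on {z. - \<i> * z \<in> - \<real>\<^sub>\<le>\<^sub>0} (\<lambda>z. \<bar>Im (Ln (- \<i> * z))\<bar>)"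
    by (intro continuous_intros) auto
  ultimately have "open ({z. - \<i> * z \<in> - \<real>\<^sub>\<le>\<^sub>0} \<inter> (\<lambda>z. \<bar>Im (Ln (- \<i> * z))\<bar>) -` {..< 5 * pi / 8})"
    by - (rule continuous_open_preimage, simp_all)
  moreover have "Sec = {z. - \<i> * z \<in> - \<real>\<^sub>\<le>\<^sub>0} \<inter> (\<lambda>z. \<bar>Im (Ln (- \<i> * z))\<bar>) -` {..< 5 * pi / 8}"
    by (auto simp: Sec_def)
  ultimately show ?thesis by simp
qed

lemma Sec_nz: "z \<in> Sec \<Longrightarrow> z \<noteq> 0" by (auto simp: Sec_def)

lemma upper_in_Sec: assumes "0 \<le> Im z" "z \<noteq> 0" shows "z \<in> Sec"
proof -
  have nz: "- \<i> * z \<noteq> 0" using assms by simp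
  have "\<bar>Im (Ln (- \<i> * z))\<bar> \<le> pi / 2" using Re_Ln_pos_le[OF nz] assms by simp
  then have "\<bar>Im (Ln (- \<i> * z))\<bar> < 5 * pi / 8" using pi_gt_zero by linarith
  moreover have "- \<i> * z \<notin> \<real>\<^sub>\<le>\<^sub>0"
    using assms by (auto simp: complex_nonpos_Reals_iff complex_eq_iff)
  ultimately show ?thesis by (simp add: Sec_def)
qed

lemma Sec_Str: assumes "z \<in> Sec" shows "of_real \<beta> * Ln (- \<i> * z) \<in> Str"
proof -
  have "\<beta> * \<bar>Im (Ln (- \<i> * z))\<bar> < \<beta> * (5 * pi / 8)" using assms beta by (intro mult_strict_left_mono) (auto simp: Sec_def)
  then show ?thesis using beta by (simp add: Str_iff \<omega>_def \<delta>_def abs_mult)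
qed

lemma Re_Sec: "z \<noteq> 0 \<Longrightarrow> Re (of_real \<beta> * Ln (- \<i> * z)) = \<beta> * ln (norm z)"
  by (simp add: Re_Ln norm_mult)

lemma Ln_pos: "x > 0 \<Longrightarrow> of_real \<beta> * Ln (- \<i> * of_real x) = of_real (\<beta> * ln \<bar>x\<bar>) - \<i> * of_real \<omega>"
proof -
  assume x: "x > 0"
  have "Ln (of_real x * (- \<i>)) = of_real (ln x) + Ln (- \<i>)" using Ln_times_of_real[of x "- \<i>"] x by (simp add: Ln_of_real)
  then have "Ln (- \<i> * of_real x) = of_real (ln x) - \<i> * of_real pi / 2" by (simp add: Ln_minus_ii mult.commute)
  then show ?thesis using x by (simp only:) (simp add: \<omega>_def algebra_simps)
qed

lemma Ln_neg: "x < 0 \<Longrightarrow> of_real \<beta> * Ln (- \<i> * of_real x) = of_real (\<beta> * ln \<bar>x\<bar>) + \<i> * of_real \<omega>"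
proof -
  assume x: "x < 0"
  have e: "- \<i> * of_real x = of_real (- x) * \<i>" by simp
  have "Ln (of_real (- x) * \<i>) = of_real (ln (- x)) + Ln \<i>" using Ln_times_of_real[of "- x" \<i>] x by (simp only: Ln_of_real neg_0_less_iff_less) simp
  then have "Ln (- \<i> * of_real x) = of_real (ln (- x)) + \<i> * of_real pi / 2" unfolding e by (simp only: Ln_ii)
  then show ?thesis using x by (simp only:) (simp add: \<omega>_def algebra_simps)
qed

section \<open>Boundary values, Hilbert transform and velocity belonging to a single F\<close>

context
  fixes F :: "complex \<Rightarrow> complex" and M :: real
  assumes F: "bnd2 M F"
begin

lemma M_nonneg: "M \<ge> 0" by (rule bnd2_nonneg[OF F])

lemma real_on_real: "Im (F (of_real x)) = 0"
proof -
  have "F (cnj (of_real x)) = cnj (F (of_real x))" by (rule bnd1_sym[OF bnd2_bnd1[OF F]]) simp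
  then have "F (of_real x) = cnj (F (of_real x))" by simp
  then have "Im (F (of_real x)) = - Im (F (of_real x))" by (metis cnj.simps(2))
  then show ?thesis by simp
qed

lemma hw_real: "Im (hF F (of_real x)) = 0" "Im (wF F (of_real x)) = 0" "Im (wF (deriv F) (of_real x)) = 0" "Im (VF F (of_real x)) = 0"
proof -
  have *: "Im z = 0" if "z = cnj z" for z using that by (metis Im_complex_of_real complex_is_Real_iff Reals_cnj_iff)
  have s: "\<forall>s\<in>Str. F (cnj s) = cnj (F s)" "\<forall>s\<in>Str. deriv F (cnj s) = cnj (deriv F s)"
    using bnd1_sym[OF bnd2_bnd1[OF F]] bnd2_sym'[OF bnd2_bnd1[OF F]] by auto
  show "Im (hF F (of_real x)) = 0" by (rule *) (use hF_sym[OF s(1), of "of_real x"] in simp)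
  show "Im (wF F (of_real x)) = 0" by (rule *) (use wF_sym[OF s(1), of "of_real x"] in simp)
  show "Im (wF (deriv F) (of_real x)) = 0" by (rule *) (use wF_sym[OF s(2), of "of_real x"] in simp)
  show "Im (VF F (of_real x)) = 0" by (rule *) (use VF_sym[OF s(1), of "of_real x"] in simp)
qed

lemma F_real_diff:
  assumes "x \<le> y" "y \<le> 0" shows "norm (F (of_real y) - F (of_real x)) \<le> 4/3 * M * exp (3/4 * y)"
proof -
  have "norm (F (of_real y) - F (of_real x)) \<le> 4/3 * M * exp (3/4 * y) - 4/3 * M * exp (3/4 * x)"
  proof (cases "x = y")
    case False
    have d: "((\<lambda>u. F (of_real u)) has_vector_derivative deriv F (of_real u)) (at u within A)" for u A
      by (rule has_vector_derivative_real_field[OF bnd2_deriv[OF F]]) simp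
    show ?thesis
    proof (rule differentiable_bound_general[where f' = "\<lambda>u. deriv F (of_real u)" and \<phi>' = "\<lambda>u. M * exp (3/4 * u)"])
      show "continuous_on {x..y} (\<lambda>u. F (of_real u))" using d by (intro continuous_on_vector_derivative) auto
      show "((\<lambda>u. F (of_real u)) has_vector_derivative deriv F (of_real u)) (at u)" for u by (rule d)
      show "norm (deriv F (of_real u)) \<le> M * exp (3/4 * u)" if "x < u" "u < y" for u
        using bnd1_bound'[OF bnd2_bnd1[OF F], of "of_real u"] that assms by simp
    qed (use False assms in \<open>auto intro!: continuous_intros derivative_eq_intros simp: has_real_derivative_iff_has_vector_derivative[symmetric]\<close>)
  qed simp
  then show ?thesis using mult_nonneg_nonneg[OF M_nonneg, of "exp (3/4 * x)"] by simp
qed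

lemma lim0: "(\<lambda>n. F (of_real (- real n))) \<longlonglongrightarrow> lim0 F"
proof -
  have "Cauchy (\<lambda>n. F (of_real (- real n)))"
  proof (rule CauchyI)
    fix e :: real assume e: "e > 0"
    have "(\<lambda>n. 4/3 * M * exp (3/4 * (- real n))) \<longlonglongrightarrow> 0" by real_asymp
    then have "eventually (\<lambda>n. 4/3 * M * exp (3/4 * (- real n)) < e) sequentially" using e by (rule order_tendstoD)
    then obtain N where N: "\<And>n. n \<ge> N \<Longrightarrow> 4/3 * M * exp (3/4 * (- real n)) < e" by (auto simp: eventually_sequentially)
    have *: "norm (F (of_real (- real m)) - F (of_real (- real n))) < e" if "m \<ge> N" "n \<ge> m" for m n
      using F_real_diff[of "- real n" "- real m"] N[OF that(1)] that by auto
    show "\<exists>N. \<forall>m\<ge>N. \<forall>n\<ge>N. norm (F (of_real (- real m)) - F (of_real (- real n))) < e"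
    proof (intro exI[of _ N] allI impI)
      fix m n assume "m \<ge> N" "n \<ge> N"
      then show "norm (F (of_real (- real m)) - F (of_real (- real n))) < e"
        using *[of m n] *[of n m] by (cases "n \<ge> m") (auto simp: norm_minus_commute)
    qed
  qed
  then show ?thesis unfolding lim0_def by (simp add: Cauchy_convergent_iff convergent_LIMSEQ_iff)
qed

lemma lim0_real: "Im (lim0 F) = 0"
proof -
  have "(\<lambda>n. Im (F (of_real (- real n)))) \<longlonglongrightarrow> Im (lim0 F)" by (rule tendsto_Im[OF lim0])
  then have "(\<lambda>n. 0) \<longlonglongrightarrow> Im (lim0 F)" by (simp only: real_on_real)
  then show ?thesis by (simp add: LIMSEQ_const_iff)
qed

text \<open>The path runs vertically over a height of at most 3 and then along the real line to
  minus infinity, where integrating the rate 3/4 costs 4/3; in total 3 + 4/3 < 5.\<close>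

lemma F_near_lim0:
  assumes s: "s \<in> Str" "Re s \<le> 0" shows "norm (F s - lim0 F) \<le> 5 * M * exp (3/4 * Re s)"
proof -
  define x where "x = Re s"
  have "norm (F (of_real x) - lim0 F) \<le> 4/3 * M * exp (3/4 * x)"
  proof (rule LIMSEQ_le_const2)
    show "(\<lambda>n. norm (F (of_real x) - F (of_real (- real n)))) \<longlonglongrightarrow> norm (F (of_real x) - lim0 F)"
      by (intro tendsto_intros lim0)
    obtain N :: nat where N: "- x \<le> real N" using real_arch_simple by blast
    then show "\<exists>N. \<forall>n\<ge>N. norm (F (of_real x) - F (of_real (- real n))) \<le> 4/3 * M * exp (3/4 * x)"
      using s by (intro exI[of _ N] allI impI F_real_diff) (auto simp: x_def)
  qed
  moreover have "norm (F s - F (of_real x)) \<le> (M * exp (3/4 * x)) * norm (s - of_real x)"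
  proof (rule field_differentiable_bound[where S = "closed_segment (of_real x) s" and f' = "deriv F"])
    fix z assume z: "z \<in> closed_segment (of_real x) s"
    have zS: "z \<in> Str" using z s real_in_Str convex_Str convex_contains_segment by blast
    obtain u where "z = (1 - u) *\<^sub>R of_real x + u *\<^sub>R s" using z unfolding in_segment by blast
    then have "Re z = (1 - u) * x + u * x" by (simp add: x_def)
    then have rz: "Re z = x" by (simp add: algebra_simps)
    show "(F has_field_derivative deriv F z) (at z within closed_segment (of_real x) s)"
      using bnd2_deriv[OF F zS] by (rule has_field_derivative_at_within)
    show "norm (deriv F z) \<le> M * exp (3/4 * x)" using bnd1_bound'[OF bnd2_bnd1[OF F] zS] s(2) rz by (simp add: x_def)
  qed auto
  moreover have "(M * exp (3/4 * x)) * norm (s - of_real x) \<le> (M * exp (3/4 * x)) * 3"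
  proof -
    have "s - of_real x = \<i> * of_real (Im s)" by (simp add: complex_eq_iff x_def)
    then have "norm (s - of_real x) = \<bar>Im s\<bar>" by (simp add: norm_mult)
    also have "\<dots> \<le> 3" using Str_im[OF s(1)] pi_approx by (simp add: field_simps)
    finally show ?thesis using M_nonneg by (intro mult_left_mono) auto
  qed
  ultimately have "norm (F s - lim0 F) \<le> 4/3 * M * exp (3/4 * x) + (M * exp (3/4 * x)) * 3"
    using norm_triangle_ineq[of "F s - F (of_real x)" "F (of_real x) - lim0 F"] by simp
  moreover have "M * exp (3/4 * x) \<ge> 0" using M_nonneg by simp
  moreover have "4/3 * M * exp (3/4 * x) = 4/3 * (M * exp (3/4 * x))" by simp
  ultimately have "norm (F s - lim0 F) \<le> 5 * (M * exp (3/4 * x))" by linarith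
  then show ?thesis by (simp add: x_def mult.assoc)
qed

lemma Phi_hol: "Phi F holomorphic_on Sec"
proof -
  have "(\<lambda>z. F (of_real \<beta> * Ln (- \<i> * z))) holomorphic_on Sec"
    by (rule holomorphic_on_compose_gen[OF _ bnd2_hol[OF F], unfolded o_def])
       (use Sec_Str in \<open>auto intro!: holomorphic_intros simp: Sec_def\<close>)
  then show ?thesis by (rule holomorphic_transform) (use Sec_nz in \<open>auto simp: Phi_def\<close>)
qed

lemma Phi_bound: assumes "z \<in> Sec" shows "norm (Phi F z) \<le> M * exp (- (3/4) * max 0 (\<beta> * ln (norm z)))"
proof -
  have "Phi F z = F (of_real \<beta> * Ln (- \<i> * z))" using Sec_nz[OF assms] by (simp add: Phi_def)
  then show ?thesis using bnd1_bound[OF bnd2_bnd1[OF F] Sec_Str[OF assms]] unfolding Re_Sec[OF Sec_nz[OF assms]] by (simp only:)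
qed

lemma Phi_decay:
  assumes "\<epsilon> > 0" shows "\<exists>R. \<forall>z. 0 \<le> Im z \<longrightarrow> R \<le> norm z \<longrightarrow> norm (Phi F z) \<le> \<epsilon>"
proof -
  have "((\<lambda>R. M * exp (- (3/4) * (\<beta> * ln R))) \<longlongrightarrow> 0) at_top"
    using beta by real_asymp
  then have "eventually (\<lambda>R. M * exp (- (3/4) * (\<beta> * ln R)) < \<epsilon>) at_top" using assms by (rule order_tendstoD)
  then obtain R0 where R0: "\<And>R. R \<ge> R0 \<Longrightarrow> M * exp (- (3/4) * (\<beta> * ln R)) < \<epsilon>" by (auto simp: eventually_at_top_linorder)
  show ?thesis
  proof (intro exI[of _ "max R0 1"] allI impI)
    fix z assume z: "0 \<le> Im z" "max R0 1 \<le> norm z"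
    then have "z \<noteq> 0" by auto
    have "norm (Phi F z) \<le> M * exp (- (3/4) * max 0 (\<beta> * ln (norm z)))" by (rule Phi_bound[OF upper_in_Sec[OF z(1) \<open>z \<noteq> 0\<close>]])
    also have "max 0 (\<beta> * ln (norm z)) = \<beta> * ln (norm z)" using z beta by (intro max_absorb2 mult_nonneg_nonneg) auto
    also have "M * exp (- (3/4) * (\<beta> * ln (norm z))) \<le> \<epsilon>" using R0[of "norm z"] z by simp
    finally show "norm (Phi F z) \<le> \<epsilon>" .
  qed
qed

lemma Phi_cont: "continuous_on {z. 0 \<le> Im z} (Phi F)"
  unfolding continuous_on_eq_continuous_within
proof
  fix z assume z: "z \<in> {z. 0 \<le> Im z}"
  show "continuous (at z within {z. 0 \<le> Im z}) (Phi F)"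
  proof (cases "z = 0")
    case False
    then have "z \<in> Sec" using upper_in_Sec z by blast
    then have "isCont (Phi F) z"
      using Phi_hol open_Sec holomorphic_on_imp_continuous_on continuous_on_eq_continuous_at by blast
    then show ?thesis by (rule continuous_at_imp_continuous_at_within)
  next
    case True
    have "((\<lambda>w. Phi F w - lim0 F) \<longlongrightarrow> 0) (at 0 within {z. 0 \<le> Im z})"
    proof (rule Lim_null_comparison)
      show "eventually (\<lambda>w. norm (Phi F w - lim0 F) \<le> 5 * M * norm w powr \<alpha>) (at 0 within {z. 0 \<le> Im z})"
        unfolding eventually_at
      proof (intro exI[of _ 1] conjI ballI impI)
        fix w assume w: "w \<in> {z. 0 \<le> Im z}" "w \<noteq> 0 \<and> dist w 0 < 1"
        have wS: "w \<in> Sec" using upper_in_Sec w by blast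
        have r: "Re (of_real \<beta> * Ln (- \<i> * w)) = \<beta> * ln (norm w)" using Re_Sec w by blast
        have "\<beta> * ln (norm w) \<le> 0" using w beta by (intro mult_nonneg_nonpos) auto
        then have "norm (F (of_real \<beta> * Ln (- \<i> * w)) - lim0 F) \<le> 5 * M * exp (3/4 * (\<beta> * ln (norm w)))"
          using F_near_lim0[OF Sec_Str[OF wS]] unfolding r by blast
        also have "exp (3/4 * (\<beta> * ln (norm w))) = norm w powr \<alpha>" using w th_beta by (simp add: powr_def mult.assoc[symmetric])
        finally show "norm (Phi F w - lim0 F) \<le> 5 * M * norm w powr \<alpha>" using w by (simp add: Phi_def)
      qed simp
      have "((\<lambda>w::complex. 5 * M * norm w powr \<alpha>) \<longlongrightarrow> 5 * M * 0) (at 0 within {z. 0 \<le> Im z})"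
        by (intro tendsto_intros tendsto_zero_powrI[where b = \<alpha>]) (use alpha in \<open>auto intro!: tendsto_eq_intros\<close>)
      then show "((\<lambda>w::complex. 5 * M * norm w powr \<alpha>) \<longlongrightarrow> 0) (at 0 within {z. 0 \<le> Im z})" by simp
    qed
    then have "(Phi F \<longlongrightarrow> lim0 F) (at 0 within {z. 0 \<le> Im z})" by (simp add: LIM_zero_iff)
    then show ?thesis unfolding continuous_within True by (simp add: Phi_def)
  qed
qed

lemma PW_Phi: "PW F x = - Im (Phi F (of_real x))"
  and PH_hF: "x \<noteq> 0 \<Longrightarrow> PH F x = Re (hF F (of_real (\<beta> * ln \<bar>x\<bar>)))"
proof -
  define s where "s = complex_of_real (\<beta> * ln \<bar>x\<bar>)"
  have pm: "F (s + \<i> * \<omega>) = hF F s + \<i> * wF F s" "F (s - \<i> * \<omega>) = hF F s - \<i> * wF F s"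
    by (simp_all add: hF_def wF_def field_simps)
  have re: "Im (hF F s) = 0" "Im (wF F s) = 0" unfolding s_def by (rule hw_real)+
  consider "x = 0" | "x > 0" | "x < 0" by linarith
  then have "PW F x = - Im (Phi F (of_real x)) \<and> (x \<noteq> 0 \<longrightarrow> PH F x = Re (hF F s))"
  proof cases
    case 1 then show ?thesis by (simp add: PW_def Phi_def lim0_real)
  next
    case 2
    then have "Phi F (of_real x) = hF F s - \<i> * wF F s" using Ln_pos[OF 2] pm by (simp add: Phi_def s_def)
    then show ?thesis unfolding PW_def PH_def s_def[symmetric] using 2 re by simp
  next
    case 3
    then have "Phi F (of_real x) = hF F s + \<i> * wF F s" using Ln_neg[OF 3] pm by (simp add: Phi_def s_def)
    then show ?thesis unfolding PW_def PH_def s_def[symmetric] using 3 re by simp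
  qed
  then show "PW F x = - Im (Phi F (of_real x))" "x \<noteq> 0 \<Longrightarrow> PH F x = Re (hF F (of_real (\<beta> * ln \<bar>x\<bar>)))"
    by (auto simp: s_def)
qed

text \<open>Stated for scaled and dilated profiles because the time slices of the self-similar
  solution have this form, with k = 1/(1-t) and m a power of 1-t.\<close>

lemma PW_hilbert:
  assumes m: "m > 0"
  shows "has_hilbert (\<lambda>y. k * PW F (y / m)) x (k * PH F (x / m))"
proof -
  define \<Psi> where "\<Psi> = (\<lambda>z. complex_of_real k * Phi F (z / of_real m))"
  define S where "S = (\<lambda>z. z / complex_of_real m) -` Sec"
  have "has_hilbert (\<lambda>y. - Im (\<Psi> (of_real y))) x (Re (\<Psi> (of_real x)))"
  proof (rule has_hilbert_boundary_value)
    show "open S" unfolding S_def using m by (intro open_vimage open_Sec continuous_intros) auto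
    show "{z. 0 \<le> Im z} - {0} \<subseteq> S" unfolding S_def using m by (auto intro!: upper_in_Sec)
    show "\<Psi> holomorphic_on S" unfolding \<Psi>_def
      by (intro holomorphic_intros holomorphic_on_compose_gen[OF _ Phi_hol, unfolded o_def]) (use m in \<open>auto simp: S_def\<close>)
    show "continuous_on {z. 0 \<le> Im z} \<Psi>" unfolding \<Psi>_def
      by (intro continuous_intros continuous_on_compose2[OF Phi_cont]) (use m in auto)
    fix \<epsilon> :: real assume e: "\<epsilon> > 0"
    then have "\<epsilon> / (\<bar>k\<bar> + 1) > 0" by simp
    from Phi_decay[OF this] obtain R where R: "\<And>z. 0 \<le> Im z \<Longrightarrow> R \<le> norm z \<Longrightarrow> norm (Phi F z) \<le> \<epsilon> / (\<bar>k\<bar> + 1)" by blast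
    show "\<exists>R. \<forall>z. 0 \<le> Im z \<longrightarrow> R \<le> norm z \<longrightarrow> norm (\<Psi> z) \<le> \<epsilon>"
    proof (intro exI[of _ "m * R"] allI impI)
      fix z assume z: "0 \<le> Im z" "m * R \<le> norm z"
      have "norm (Phi F (z / of_real m)) \<le> \<epsilon> / (\<bar>k\<bar> + 1)"
        by (rule R) (use z m in \<open>auto simp: norm_divide field_simps\<close>)
      then have "\<bar>k\<bar> * norm (Phi F (z / of_real m)) \<le> (\<bar>k\<bar> + 1) * (\<epsilon> / (\<bar>k\<bar> + 1))"
        using e by (intro mult_mono) auto
      then show "norm (\<Psi> z) \<le> \<epsilon>" by (simp add: \<Psi>_def norm_mult)
    qed
  qed
  moreover have "\<Psi> (of_real y) = of_real k * Phi F (of_real (y / m))" for y by (simp add: \<Psi>_def)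
  ultimately show ?thesis by (simp add: PW_Phi PH_def)
qed

lemma PW_cont: "continuous_on UNIV (PW F)" and PH_cont: "continuous_on UNIV (PH F)"
proof -
  have c: "continuous_on UNIV (\<lambda>x. Phi F (complex_of_real x))"
    by (rule continuous_on_compose2[OF Phi_cont]) (auto intro!: continuous_intros)
  have "PW F = (\<lambda>x. - Im (Phi F (complex_of_real x)))" using PW_Phi by blast
  then show "continuous_on UNIV (PW F)" using c by (simp only:) (intro continuous_intros)
  show "continuous_on UNIV (PH F)" unfolding PH_def using c by (intro continuous_intros)
qed

lemma PV_cont: "continuous_on UNIV (PV F)"
proof -
  have "continuous_on (UNIV \<times> cbox 0 1) (\<lambda>(x, v). PH F (x * v))"
    unfolding case_prod_beta by (rule continuous_on_compose2[OF PH_cont]) (auto intro!: continuous_intros)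
  from integral_continuous_on_param[OF this] show ?thesis unfolding PV_def by simp
qed

text \<open>Connects the mean used in the strip with the one used on the line; the latter also makes
  sense at x = 0 and is continuous there.\<close>

lemma PV_VF: assumes x: "x \<noteq> 0" shows "PV F x = Re (VF F (of_real (\<beta> * ln \<bar>x\<bar>)))"
proof -
  let ?s = "complex_of_real (\<beta> * ln \<bar>x\<bar>)"
  have i: "integrable (restrict_space lborel {0<..1}) (\<lambda>v. hF F (?s + of_real (\<beta> * ln v)))"
    by (rule VF_integrable[OF bnd2_hol[OF F] bnd1_le[OF bnd2_bnd1[OF F]] real_in_Inn])
  have "Re (VF F ?s) = (\<integral>v. Re (hF F (?s + of_real (\<beta> * ln v))) \<partial>restrict_space lborel {0<..1})"
    unfolding VF_def using i by simp
  also have "\<dots> = (\<integral>v. PH F (x * v) \<partial>restrict_space lborel {0<..1})"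
  proof (rule Bochner_Integration.integral_cong[OF refl])
    fix v assume "v \<in> space (restrict_space lborel {0<..1::real})"
    then have v: "0 < v" by (simp add: space_restrict_space)
    have "ln \<bar>x * v\<bar> = ln \<bar>x\<bar> + ln v" using x v by (simp add: abs_mult ln_mult)
    then have e: "?s + of_real (\<beta> * ln v) = of_real (\<beta> * ln \<bar>x * v\<bar>)" by (simp add: distrib_left)
    show "Re (hF F (?s + of_real (\<beta> * ln v))) = PH F (x * v)" unfolding e using PH_hF[of "x * v"] x v by simp
  qed
  also have "\<dots> = (LINT v:{0<..1}|lborel. PH F (x * v))"
    by (subst integral_restrict_space) (auto simp: set_lebesgue_integral_def)
  also have "\<dots> = (LINT v:{0..1}|lborel. PH F (x * v))"
  proof -
    have c: "continuous_on UNIV (\<lambda>v. PH F (x * v))" by (rule continuous_on_compose2[OF PH_cont]) (auto intro!: continuous_intros)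
    show ?thesis unfolding set_lebesgue_integral_def
    proof (rule integral_cong_AE)
      show "AE v in lborel. indicator {0<..1} v *\<^sub>R PH F (x * v) = indicator {0..1} v *\<^sub>R PH F (x * v)"
        using AE_lborel_singleton[of "0::real"] by eventually_elim (auto simp: indicator_def)
    qed (use borel_measurable_continuous_onI[OF c] in measurable)
  qed
  also have "\<dots> = integral {0..1} (\<lambda>v. PH F (x * v))"
    by (rule set_borel_integral_eq_integral) (intro borel_integrable_atLeastAtMost' continuous_on_compose2[OF PH_cont] continuous_intros, auto)
  finally show ?thesis by (simp add: PV_def)
qed

text \<open>x times \<open>PV\<close> is the integral of \<open>PH\<close> from 0 to x. The interval
  integral in \<open>A\<close> is signed, so negative x needs no separate treatment.\<close>

lemma PU_deriv: "((\<lambda>x. x * PV F x) has_real_derivative PH F x) (at x)"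
proof -
  define A where "A = (\<lambda>x::real. LBINT t=ereal 0..ereal x. PH F t)"
  have Ad: "(A has_real_derivative PH F x) (at x)" for x
  proof -
    define c d where "c = min 0 x - 1" and "d = max 0 x + 1"
    have "(A has_vector_derivative PH F x) (at x within {c..d})"
      unfolding A_def by (rule interval_integral_FTC2) (auto simp: c_def d_def intro: continuous_on_subset[OF PH_cont])
    moreover have "at x within {c..d} = at x" by (rule at_within_interior) (auto simp: c_def d_def)
    ultimately show ?thesis by (simp add: has_real_derivative_iff_has_vector_derivative)
  qed
  have "A x = x * PV F x" for x
  proof (cases "x = 0")
    case False
    have "((\<lambda>v. PH F (x * v)) has_integral (A (x * 1) / x - A (x * 0) / x)) {0..1}"
    proof (rule fundamental_theorem_of_calculus)
      fix v :: real
      have "((\<lambda>v. A (x * v) / x) has_real_derivative PH F (x * v) * x / x) (at v within {0..1})"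
        by (intro DERIV_cdivide DERIV_chain2[OF Ad]) (auto intro!: derivative_eq_intros)
      then show "((\<lambda>v. A (x * v) / x) has_vector_derivative PH F (x * v)) (at v within {0..1})"
        using False by (simp add: has_real_derivative_iff_has_vector_derivative)
    qed simp
    moreover have "A 0 = 0" by (simp add: A_def interval_integral_endpoints_same)
    ultimately show ?thesis using False by (simp add: PV_def integral_unique)
  qed (simp add: A_def interval_integral_endpoints_same)
  then have "A = (\<lambda>x. x * PV F x)" by blast
  with Ad show ?thesis by simp
qed

text \<open>Since 3/4 \<beta> = \<alpha>, the weight in s becomes the smaller of |x|^\<alpha> and
  |x|^(-\<alpha>). The factor \<omega> is kept because \<open>PW_nontrivial\<close> compares
  quantities of that size.\<close>

lemma wd_bound:
  assumes "x \<noteq> 0"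
  shows "norm (wF F (of_real (\<beta> * ln \<bar>x\<bar>))) \<le> \<omega> * M * exp (- \<alpha> * \<bar>ln \<bar>x\<bar>\<bar>)"
    and "norm (wF (deriv F) (of_real (\<beta> * ln \<bar>x\<bar>))) \<le> \<omega> * M * exp (- \<alpha> * \<bar>ln \<bar>x\<bar>\<bar>)"
proof -
  have e: "- (3/4) * \<bar>\<beta> * ln \<bar>x\<bar>\<bar> = - \<alpha> * \<bar>ln \<bar>x\<bar>\<bar>" using beta th_beta by (simp add: abs_mult)
  have "norm (wF F (of_real (\<beta> * ln \<bar>x\<bar>))) \<le> \<omega> * (M * exp (- (3/4) * \<bar>Re (of_real (\<beta> * ln \<bar>x\<bar>))\<bar>))"
    by (rule wF_le_deriv[OF real_in_Inn bnd2_hol[OF F], of "\<lambda>x. M * wt x"]) (rule bnd1_bound'[OF bnd2_bnd1[OF F]])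
  then show "norm (wF F (of_real (\<beta> * ln \<bar>x\<bar>))) \<le> \<omega> * M * exp (- \<alpha> * \<bar>ln \<bar>x\<bar>\<bar>)"
    unfolding Re_complex_of_real e by simp
  have "norm (wF (deriv F) (of_real (\<beta> * ln \<bar>x\<bar>))) \<le> \<omega> * (M * exp (- (3/4) * \<bar>Re (of_real (\<beta> * ln \<bar>x\<bar>))\<bar>))"
    by (rule wF_le_deriv[OF real_in_Inn bnd2_hol'[OF F], of "\<lambda>x. M * wt x"]) (rule bnd2_bound''[OF F])
  then show "norm (wF (deriv F) (of_real (\<beta> * ln \<bar>x\<bar>))) \<le> \<omega> * M * exp (- \<alpha> * \<bar>ln \<bar>x\<bar>\<bar>)"
    unfolding Re_complex_of_real e by simp
qed

lemma PW_le: "\<bar>PW F x\<bar> \<le> \<omega> * M" "\<bar>PW F x\<bar> \<le> \<omega> * M * \<bar>x\<bar> powr \<alpha>"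
  and PD_le: "\<bar>PD F x\<bar> \<le> \<beta> * \<omega> * M * \<bar>x\<bar> powr \<alpha>"
proof -
  have "\<bar>PW F x\<bar> \<le> \<omega> * M \<and> \<bar>PW F x\<bar> \<le> \<omega> * M * \<bar>x\<bar> powr \<alpha> \<and> \<bar>PD F x\<bar> \<le> \<beta> * \<omega> * M * \<bar>x\<bar> powr \<alpha>"
  proof (cases "x = 0")
    case True then show ?thesis using omega M_nonneg by (simp add: PW_def PD_def)
  next
    case False
    define E where "E = exp (- \<alpha> * \<bar>ln \<bar>x\<bar>\<bar>)"
    have E: "E \<le> 1" "E \<le> \<bar>x\<bar> powr \<alpha>" using exp_neg_abs_ln_le[OF False, of \<alpha>] alpha by (auto simp: E_def)
    have oM: "0 \<le> \<omega> * M" using omega M_nonneg by simp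
    have e1: "\<omega> * M * E \<le> \<omega> * M * 1" "\<omega> * M * E \<le> \<omega> * M * \<bar>x\<bar> powr \<alpha>" using E oM by (intro mult_left_mono; simp)+
    have w1: "\<bar>PW F x\<bar> \<le> \<omega> * M * E"
      using wd_bound(1)[OF False] abs_Re_le_cmod[of "wF F (of_real (\<beta> * ln \<bar>x\<bar>))"] False unfolding E_def[symmetric] PW_def by (simp add: abs_mult abs_sgn_eq)
    have "\<bar>Re (wF (deriv F) (of_real (\<beta> * ln \<bar>x\<bar>)))\<bar> \<le> \<omega> * M * E"
      using wd_bound(2)[OF False] abs_Re_le_cmod[of "wF (deriv F) (of_real (\<beta> * ln \<bar>x\<bar>))"] unfolding E_def[symmetric] by simp
    then have "\<bar>Re (wF (deriv F) (of_real (\<beta> * ln \<bar>x\<bar>)))\<bar> \<le> \<omega> * M * \<bar>x\<bar> powr \<alpha>" using e1(2) by linarith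
    then have "\<beta> * \<bar>Re (wF (deriv F) (of_real (\<beta> * ln \<bar>x\<bar>)))\<bar> \<le> \<beta> * (\<omega> * M * \<bar>x\<bar> powr \<alpha>)" using beta by (intro mult_left_mono) auto
    then have "\<bar>PD F x\<bar> \<le> \<beta> * \<omega> * M * \<bar>x\<bar> powr \<alpha>"
      using False beta unfolding PD_def by (simp add: abs_mult abs_sgn_eq mult.assoc)
    then show ?thesis using w1 e1 by simp
  qed
  then show "\<bar>PW F x\<bar> \<le> \<omega> * M" "\<bar>PW F x\<bar> \<le> \<omega> * M * \<bar>x\<bar> powr \<alpha>" "\<bar>PD F x\<bar> \<le> \<beta> * \<omega> * M * \<bar>x\<bar> powr \<alpha>" by auto
qed

lemma PW_deriv: assumes x: "x \<noteq> 0" shows "(PW F has_real_derivative PD F x / x) (at x)"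
proof -
  let ?r = "\<lambda>y. Re (wF F (of_real (\<beta> * ln \<bar>y\<bar>)))"
  have dl: "((\<lambda>y. \<beta> * ln \<bar>y\<bar>) has_real_derivative \<beta> / x) (at x)"
  proof (cases "x > 0")
    case True
    have "((\<lambda>y. \<beta> * ln y) has_real_derivative \<beta> / x) (at x)" using True by (auto intro!: derivative_eq_intros)
    then show ?thesis by (rule has_field_derivative_transform_within_open[of _ _ _ "{0<..}"]) (use True in auto)
  next
    case False
    have "((\<lambda>y. \<beta> * ln (- y)) has_real_derivative \<beta> / x) (at x)" using False x by (auto intro!: derivative_eq_intros)
    then show ?thesis by (rule has_field_derivative_transform_within_open[of _ _ _ "{..<0}"]) (use False x in auto)
  qed
  have "((\<lambda>\<sigma>. Re (wF F (of_real \<sigma>))) has_real_derivative Re (wF (deriv F) (of_real (\<beta> * ln \<bar>x\<bar>)))) (at (\<beta> * ln \<bar>x\<bar>))"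
    by (rule Re_of_real_has_real_derivative[OF wF_deriv[OF bnd2_hol[OF F] real_in_Inn]])
  from DERIV_chain2[OF this dl]
  have "(?r has_real_derivative Re (wF (deriv F) (of_real (\<beta> * ln \<bar>x\<bar>))) * (\<beta> / x)) (at x)" .
  then have "((\<lambda>y. sgn x * ?r y) has_real_derivative sgn x * (Re (wF (deriv F) (of_real (\<beta> * ln \<bar>x\<bar>))) * (\<beta> / x))) (at x)"
    by (rule DERIV_cmult)
  then have "(PW F has_real_derivative sgn x * (Re (wF (deriv F) (of_real (\<beta> * ln \<bar>x\<bar>))) * (\<beta> / x))) (at x)"
    by (rule has_field_derivative_transform_within_open[of _ _ _ "if x > 0 then {0<..} else {..<0}"]) (use x in \<open>auto simp: PW_def split: if_splits\<close>)
  then show ?thesis by (simp add: PD_def mult_ac)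
qed

lemma PD_cont: "continuous_on UNIV (PD F)"
  unfolding continuous_on_eq_continuous_at[OF open_UNIV]
proof
  fix x :: real
  show "isCont (PD F) x"
  proof (cases "x = 0")
    case True
    have "((\<lambda>x. PD F x) \<longlongrightarrow> 0) (at 0)"
    proof (rule Lim_null_comparison)
      show "eventually (\<lambda>x. norm (PD F x) \<le> \<beta> * \<omega> * M * \<bar>x\<bar> powr \<alpha>) (at 0)" using PD_le by (intro always_eventually) simp
      have "((\<lambda>x::real. \<beta> * \<omega> * M * \<bar>x\<bar> powr \<alpha>) \<longlongrightarrow> \<beta> * \<omega> * M * 0) (at 0)"
        by (intro tendsto_intros tendsto_zero_powrI[where b = \<alpha>]) (use alpha in \<open>auto intro!: tendsto_eq_intros\<close>)
      then show "((\<lambda>x::real. \<beta> * \<omega> * M * \<bar>x\<bar> powr \<alpha>) \<longlongrightarrow> 0) (at 0)" by simp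
    qed
    moreover have "PD F 0 = 0" by (simp add: PD_def)
    ultimately show ?thesis using True by (simp add: isCont_def)
  next
    case False
    have c: "isCont (\<lambda>\<sigma>. Re (wF (deriv F) (of_real \<sigma>))) \<sigma>" for \<sigma>
      by (rule DERIV_isCont[OF Re_of_real_has_real_derivative[OF wF_deriv[OF bnd2_hol'[OF F] real_in_Inn]]])
    have "isCont (\<lambda>y. \<beta> * ln \<bar>y\<bar>) x" using False by (intro continuous_intros) auto
    then have "isCont (\<lambda>y. Re (wF (deriv F) (of_real (\<beta> * ln \<bar>y\<bar>)))) x"
      using isCont_o2[OF _ c] by blast
    moreover have "isCont sgn x" using False by (rule isCont_sgn[OF continuous_ident])
    ultimately show ?thesis unfolding PD_def by (intro isCont_mult) auto
  qed
qed

end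

text \<open>The profile equation at real s, multiplied by the sign of x. The coefficient 1/\<beta>
  is 1 + \<lambda> and compensates the \<beta> contained in \<open>PD\<close>.\<close>

lemma physical_equation:
  assumes a: "\<bar>a\<bar> * q < 1"
  shows "PW (Fa a) x + (1 / \<beta>) * PD (Fa a) x + a * PV (Fa a) x * PD (Fa a) x = PH (Fa a) x * PW (Fa a) x"
proof (cases "x = 0")
  case True then show ?thesis by (simp add: PW_def PD_def)
next
  case False
  let ?s = "complex_of_real (\<beta> * ln \<bar>x\<bar>)"
  note n = bnd2_Fa[OF a]
  have r: "z = of_real (Re z)" if "Im z = 0" for z using that by (simp add: complex_eq_iff)
  have "of_real (Re (wF (Fa a) ?s)) + of_real (Re (wF (deriv (Fa a)) ?s)) + of_real (a * \<beta>) * of_real (Re (VF (Fa a) ?s)) * of_real (Re (wF (deriv (Fa a)) ?s))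
     = (of_real (Re (hF (Fa a) ?s)) * of_real (Re (wF (Fa a) ?s)) :: complex)"
    using profile_equation[OF a real_in_Inn] r[OF hw_real(1)[OF n]] r[OF hw_real(2)[OF n]] r[OF hw_real(3)[OF n]] r[OF hw_real(4)[OF n]] by metis
  then have e: "Re (wF (Fa a) ?s) + Re (wF (deriv (Fa a)) ?s) + a * \<beta> * Re (VF (Fa a) ?s) * Re (wF (deriv (Fa a)) ?s) = Re (hF (Fa a) ?s) * Re (wF (Fa a) ?s)"
    by (simp only: of_real_add[symmetric] of_real_mult[symmetric] of_real_eq_iff)
  show ?thesis
    unfolding PV_VF[OF n False] PH_hF[OF n False] PW_def PD_def using arg_cong[OF e, of "\<lambda>z. sgn x * z"] beta
    by (simp add: algebra_simps)
qed

end

section \<open>Weak solutions from profiles\<close>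

text \<open>By Fubini and the fundamental theorem in one variable. \<open>A\<close> needs only the
  one partial derivative in question, and nothing is asked of the other one.\<close>

lemma has_integral_divergence:
  fixes P :: "real \<times> real \<Rightarrow> real"
  assumes cont: "continuous_on UNIV P"
    and K: "compact K" "\<And>p. p \<notin> K \<Longrightarrow> P p = 0"
    and prim: "(\<forall>x t. ((\<lambda>t. A (x, t)) has_real_derivative P (x, t)) (at t)) \<or>
               (\<forall>x t. ((\<lambda>x. A (x, t)) has_real_derivative P (x, t)) (at x))"
    and A0: "\<And>p. p \<notin> K \<Longrightarrow> A p = 0"
  shows "(P has_integral 0) UNIV"
proof -
  obtain L0 where L0: "\<And>p. p \<in> K \<Longrightarrow> norm p \<le> L0"
    using compact_imp_bounded[OF K(1)] by (auto simp: bounded_iff)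
  define L where "L = max L0 0 + 1"
  have L: "L > 0" by (simp add: L_def)
  have out: "p \<notin> K" if "L \<le> \<bar>fst p\<bar> \<or> L \<le> \<bar>snd p\<bar>" for p
  proof
    assume "p \<in> K"
    then have "norm p \<le> L0" by (rule L0)
    moreover have "\<bar>fst p\<bar> \<le> norm p" "\<bar>snd p\<bar> \<le> norm p" using norm_fst_le[of "fst p" "snd p"] norm_snd_le[of "snd p" "fst p"] by simp_all
    ultimately show False using that by (auto simp: L_def)
  qed
  let ?C = "cbox (- L, - L) (L, L)"
  have c: "continuous_on ?C P" using cont continuous_on_subset by blast
  have "integral ?C P = 0"
    using prim
  proof
    assume d: "\<forall>x t. ((\<lambda>t. A (x, t)) has_real_derivative P (x, t)) (at t)"
    have "integral (cbox (- L) L) (\<lambda>t. P (x, t)) = 0" for x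
    proof -
      have "((\<lambda>t. P (x, t)) has_integral (A (x, L) - A (x, - L))) {- L..L}"
        by (rule fundamental_theorem_of_calculus)
           (use d L in \<open>auto simp: has_real_derivative_iff_has_vector_derivative[symmetric] intro: has_field_derivative_at_within\<close>)
      moreover have "A (x, L) = 0" "A (x, - L) = 0" using L by (auto intro!: A0 out)
      ultimately show ?thesis by (simp add: integral_unique)
    qed
    then show ?thesis unfolding integral_prod_continuous[OF c] by simp
  next
    assume d: "\<forall>x t. ((\<lambda>x. A (x, t)) has_real_derivative P (x, t)) (at x)"
    have i: "integral (cbox (- L) L) (\<lambda>x. P (x, t)) = 0" for t
    proof -
      have "((\<lambda>x. P (x, t)) has_integral (A (L, t) - A (- L, t))) {- L..L}"
        by (rule fundamental_theorem_of_calculus)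
           (use d L in \<open>auto simp: has_real_derivative_iff_has_vector_derivative[symmetric] intro: has_field_derivative_at_within\<close>)
      moreover have "A (L, t) = 0" "A (- L, t) = 0" using L by (auto intro!: A0 out)
      ultimately show ?thesis by (simp add: integral_unique)
    qed
    have "integral ?C P = integral (cbox (- L) L) (\<lambda>x. integral (cbox (- L) L) (\<lambda>t. P (x, t)))"
      by (rule integral_prod_continuous[OF c])
    also have "\<dots> = integral (cbox (- L) L) (\<lambda>t. integral (cbox (- L) L) (\<lambda>x. P (x, t)))"
      by (rule integral_swap_continuous) (use c in simp)
    also have "\<dots> = 0" unfolding i by simp
    finally show ?thesis .
  qed
  then have "(P has_integral 0) ?C" using integrable_integral[OF integrable_continuous[OF c]] by simp
  then show ?thesis
  proof (rule has_integral_on_superset)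
    fix p :: "real \<times> real" assume "p \<notin> ?C"
    then have "p \<notin> K" by (intro out) (cases p, auto simp: cbox_Pair_eq)
    then show "P p = 0" by (rule K(2))
  qed simp
qed

text \<open>The self-similar formula is meaningful only for t < 1; since a test function lives on a
  compact set inside t < 1, the integrands extend by zero to continuous functions on the
  plane.\<close>

lemma continuous_on_UNIV_of_support:
  fixes P :: "real \<times> real \<Rightarrow> real"
  assumes T: "open T" "continuous_on T P" and K: "compact K" "K \<subseteq> T" "\<And>p. p \<notin> K \<Longrightarrow> P p = 0"
  shows "continuous_on UNIV P"
proof -
  have "continuous_on (- K) P"
    using K(3) by (subst continuous_on_cong[OF refl, of _ _ "\<lambda>_. 0"]) auto
  then have "continuous_on (T \<union> - K) P"
    using T K(1) by (intro continuous_on_open_Un) (auto simp: compact_imp_closed open_Compl)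
  moreover have "T \<union> - K = UNIV" using K(2) by auto
  ultimately show ?thesis by simp
qed

text \<open>Caratheodory's form of the derivative: continuity of g at 0 is enough. It makes u w
  differentiable at x = 0, where w need not be.\<close>

lemma DERIV_x_times:
  fixes g :: "real \<Rightarrow> real"
  assumes "isCont g 0" shows "((\<lambda>x. x * g x) has_real_derivative g 0) (at 0)"
  unfolding CARAT_DERIV using assms by (intro exI[of _ g]) (auto simp: mult.commute)

lemma DERIV_zero_of_locally_zero:
  fixes f :: "real \<Rightarrow> real"
  assumes "open S" "x \<in> S" "\<And>y. y \<in> S \<Longrightarrow> f y = 0" shows "(f has_real_derivative 0) (at x)"
  by (rule has_field_derivative_transform_within_open[of "\<lambda>_. 0" _ _ S]) (use assms in auto)

text \<open>The weak form is the t-derivative of w \<phi> plus a times the x-derivative of u w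
  \<phi>. For t < 1 both derivatives exist everywhere: the first because w vanishes on x = 0, the
  second because u does. The singularity of the profile at 0 therefore needs no cut-off.\<close>

lemma self_similar_solution:
  fixes W HW V DW :: "real \<Rightarrow> real"
  assumes cW: "continuous_on UNIV W" and cH: "continuous_on UNIV HW"
    and cV: "continuous_on UNIV V" and cD: "continuous_on UNIV DW"
    and W0: "W 0 = 0" and D0: "DW 0 = 0"
    and dW: "\<And>x. x \<noteq> 0 \<Longrightarrow> (W has_real_derivative DW x / x) (at x)"
    and dU: "\<And>x. ((\<lambda>x. x * V x) has_real_derivative HW x) (at x)"
    and eq: "\<And>x. W x + B * DW x + a * V x * DW x = HW x * W x"
    and hil: "\<And>m k x. m > 0 \<Longrightarrow> has_hilbert (\<lambda>y. k * W (y / m)) x (k * HW (x / m))"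
  shows "gDG_solution a 1 (\<lambda>x t. (1 / (1 - t)) * W (x / (1 - t) powr B))"
proof -
  define m where "m = (\<lambda>t::real. (1 - t) powr B)"
  have mp: "m t > 0" if "t < 1" for t using that by (simp add: m_def)
  define w h u where "w = (\<lambda>x t. (1 / (1 - t)) * W (x / m t))"
    and "h = (\<lambda>x t. (1 / (1 - t)) * HW (x / m t))"
    and "u = (\<lambda>x t. (1 / (1 - t)) * (x * V (x / m t)))"
  have dmX: "((\<lambda>t. x / m t) has_real_derivative B * (x / m t) / (1 - t)) (at t)" if t: "t < 1" for x t
  proof -
    have "((\<lambda>t. (1 - t) powr B) has_real_derivative (0 - 1) * B * (1 - t) powr (B - 1)) (at t)"
      using t by (auto intro!: derivative_eq_intros simp: powr_diff field_simps)
    then have "((\<lambda>t. x / m t) has_real_derivative (0 * m t - x * ((0 - 1) * B * (1 - t) powr (B - 1))) / (m t * m t)) (at t)"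
      unfolding m_def using t by (intro DERIV_divide DERIV_const) auto
    moreover have "(1 - t) powr (B - 1) = m t / (1 - t)" using t by (simp add: m_def powr_diff)
    ultimately show ?thesis using mp[OF t] by (simp add: mult_ac)
  qed
  have dwt: "((\<lambda>t. w x t) has_real_derivative (1 / (1 - t)\<^sup>2) * (W (x / m t) + B * DW (x / m t))) (at t)" if t: "t < 1" for x t
  proof (cases "x = 0")
    case True then show ?thesis by (simp add: w_def W0 D0)
  next
    case False
    have X: "x / m t \<noteq> 0" using False mp[OF t] by simp
    have i: "((\<lambda>t. 1 / (1 - t)) has_real_derivative 1 / (1 - t)\<^sup>2) (at t)"
      using t by (auto intro!: derivative_eq_intros simp: power2_eq_square)
    have "((\<lambda>t. W (x / m t)) has_real_derivative DW (x / m t) / (x / m t) * (B * (x / m t) / (1 - t))) (at t)"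
      by (rule DERIV_chain2[OF dW[OF X] dmX[OF t]])
    then have "((\<lambda>t. W (x / m t)) has_real_derivative B * DW (x / m t) / (1 - t)) (at t)" using X by (simp add: mult_ac)
    from DERIV_mult'[OF i this] have "((\<lambda>t. w x t) has_real_derivative (1 / (1 - t)) * (B * DW (x / m t) / (1 - t)) + 1 / (1 - t)\<^sup>2 * W (x / m t)) (at t)"
      unfolding w_def .
    then show ?thesis by (simp add: power2_eq_square distrib_left add.commute)
  qed
  have dX: "((\<lambda>x. x / m t) has_real_derivative 1 / m t) (at x)" if "t < 1" for x t
    using mp[OF that] by (auto intro!: derivative_eq_intros)
  have dux: "((\<lambda>x. u x t) has_real_derivative h x t) (at x)" if t: "t < 1" for x t
  proof -
    have "((\<lambda>x. (x / m t) * V (x / m t)) has_real_derivative HW (x / m t) * (1 / m t)) (at x)"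
      by (rule DERIV_chain2[OF dU dX[OF t]])
    then have "((\<lambda>x. (m t / (1 - t)) * ((x / m t) * V (x / m t))) has_real_derivative (m t / (1 - t)) * (HW (x / m t) * (1 / m t))) (at x)"
      by (rule DERIV_cmult)
    then show ?thesis using mp[OF t] by (simp add: u_def h_def)
  qed
  have duw: "((\<lambda>x. u x t * w x t) has_real_derivative (1 / (1 - t)\<^sup>2) * (HW (x / m t) * W (x / m t) + V (x / m t) * DW (x / m t))) (at x)"
    if t: "t < 1" for x t
  proof (cases "x = 0")
    case True
    \<comment> \<open>Here u w = x g with g continuous, so no derivative of the profile at 0 is
      required; g vanishes at 0 because \<open>W\<close> does.\<close>
    define g where "g = (\<lambda>x. (1 / (1 - t)\<^sup>2) * (V (x / m t) * W (x / m t)))"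
    have "continuous_on UNIV g" unfolding g_def using mp[OF t]
      by (intro continuous_intros continuous_on_compose2[OF cV] continuous_on_compose2[OF cW]) auto
    then have "isCont g 0" by (simp add: continuous_on_eq_continuous_at)
    from DERIV_x_times[OF this] have "((\<lambda>x. x * g x) has_real_derivative 0) (at 0)" by (simp add: g_def W0)
    moreover have "(\<lambda>x. u x t * w x t) = (\<lambda>x. x * g x)" by (simp add: fun_eq_iff u_def w_def g_def power2_eq_square)
    ultimately show ?thesis using True by (simp add: W0 D0)
  next
    case False
    have X: "x / m t \<noteq> 0" using False mp[OF t] by simp
    have "((\<lambda>x. (1 / (1 - t)) * W (x / m t)) has_real_derivative (1 / (1 - t)) * (DW (x / m t) / (x / m t) * (1 / m t))) (at x)"
      by (intro DERIV_cmult DERIV_chain2[OF dW[OF X] dX[OF t]])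
    then have "((\<lambda>x. w x t) has_real_derivative (1 / (1 - t)) * (DW (x / m t) / x)) (at x)"
      using mp[OF t] by (simp add: w_def)
    from DERIV_mult'[OF dux[OF t] this]
    have "((\<lambda>x. u x t * w x t) has_real_derivative u x t * ((1 / (1 - t)) * (DW (x / m t) / x)) + h x t * w x t) (at x)" .
    moreover have "u x t * ((1 / (1 - t)) * (DW (x / m t) / x)) + h x t * w x t = (1 / (1 - t)\<^sup>2) * (HW (x / m t) * W (x / m t) + V (x / m t) * DW (x / m t))"
      using False by (simp add: u_def h_def w_def power2_eq_square distrib_left)
    ultimately show ?thesis by simp
  qed
  have weak: "((\<lambda>(x, t). w x t * \<phi>t x t + a * u x t * w x t * \<phi>x x t + (1 + a) * h x t * w x t * \<phi> x t) has_integral 0) UNIV"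
    if tf: "test_fun 1 \<phi> \<phi>x \<phi>t" for \<phi> \<phi>x \<phi>t
  proof -
    have px: "((\<lambda>y. \<phi> y t) has_real_derivative \<phi>x x t) (at x)" and pt: "((\<lambda>s. \<phi> x s) has_real_derivative \<phi>t x t) (at t)" for x t
      using tf by (auto simp: test_fun_def)
    have c0: "continuous_on UNIV (\<lambda>p. \<phi> (fst p) (snd p))" and cx: "continuous_on UNIV (\<lambda>p. \<phi>x (fst p) (snd p))" and ct: "continuous_on UNIV (\<lambda>p. \<phi>t (fst p) (snd p))"
      using tf by (auto simp: test_fun_def case_prod_beta)
    obtain K where K: "compact K" "K \<subseteq> {p. snd p < 1}" "\<And>x t. (x, t) \<notin> K \<Longrightarrow> \<phi> x t = 0"
      using tf unfolding test_fun_def by blast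
    have oK: "open (- K)" using K(1) by (simp add: compact_imp_closed open_Compl)
    have slx: "open {y. (y, t) \<notin> K}" for t
    proof -
      have "open ((\<lambda>y. (y, t)) -` (- K))" by (rule open_vimage[OF oK]) (intro continuous_intros)
      then show ?thesis by (simp add: vimage_def)
    qed
    have slt: "open {s. (x, s) \<notin> K}" for x
    proof -
      have "open ((\<lambda>s. (x, s)) -` (- K))" by (rule open_vimage[OF oK]) (intro continuous_intros)
      then show ?thesis by (simp add: vimage_def)
    qed
    have px0: "\<phi>x x t = 0" if "(x, t) \<notin> K" for x t
      using DERIV_unique[OF px[of t x] DERIV_zero_of_locally_zero[OF slx[of t], of x]] that K(3) by auto
    have pt0: "\<phi>t x t = 0" if "(x, t) \<notin> K" for x t
      using DERIV_unique[OF pt[of x t] DERIV_zero_of_locally_zero[OF slt[of x], of t]] that K(3) by auto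
    define P where "P = (\<lambda>p. w (fst p) (snd p) * \<phi>t (fst p) (snd p) + (1 / (1 - snd p)\<^sup>2) * (W (fst p / m (snd p)) + B * DW (fst p / m (snd p))) * \<phi> (fst p) (snd p))"
    define Q where "Q = (\<lambda>p. u (fst p) (snd p) * w (fst p) (snd p) * \<phi>x (fst p) (snd p) + (1 / (1 - snd p)\<^sup>2) * (HW (fst p / m (snd p)) * W (fst p / m (snd p)) + V (fst p / m (snd p)) * DW (fst p / m (snd p))) * \<phi> (fst p) (snd p))"
    have P0: "P p = 0" and Q0: "Q p = 0" if "p \<notin> K" for p
      using that px0[of "fst p" "snd p"] pt0[of "fst p" "snd p"] K(3)[of "fst p" "snd p"] by (auto simp: P_def Q_def)
    let ?T = "{p :: real \<times> real. snd p < 1}"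
    have oT: "open ?T"
      by (intro open_Collect_less continuous_intros)
    have cm: "continuous_on ?T (\<lambda>p. fst p / m (snd p))"
      unfolding m_def by (intro continuous_intros) auto
    note cc = continuous_on_compose2[OF cW cm] continuous_on_compose2[OF cH cm] continuous_on_compose2[OF cV cm] continuous_on_compose2[OF cD cm]
       continuous_on_subset[OF c0] continuous_on_subset[OF cx] continuous_on_subset[OF ct]
    have cP: "continuous_on ?T P" unfolding P_def w_def by (intro continuous_intros cc) auto
    have cQ: "continuous_on ?T Q" unfolding Q_def w_def u_def by (intro continuous_intros cc) auto
    have out: "(x, t) \<notin> K" if "\<not> t < 1" for x t using K(2) that by auto
    have "(P has_integral 0) UNIV"
    proof (rule has_integral_divergence[OF continuous_on_UNIV_of_support[OF oT cP K(1,2) P0] K(1) P0])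
      show "(\<forall>x t. ((\<lambda>t. (\<lambda>p. w (fst p) (snd p) * \<phi> (fst p) (snd p)) (x, t)) has_real_derivative P (x, t)) (at t)) \<or>
         (\<forall>x t. ((\<lambda>x. (\<lambda>p. w (fst p) (snd p) * \<phi> (fst p) (snd p)) (x, t)) has_real_derivative P (x, t)) (at x))"
      proof (intro disjI1 allI)
        fix x t
        show "((\<lambda>t. (\<lambda>p. w (fst p) (snd p) * \<phi> (fst p) (snd p)) (x, t)) has_real_derivative P (x, t)) (at t)"
        proof (cases "t < 1")
          case True
          from DERIV_mult'[OF dwt[OF True] pt[of x t]] show ?thesis by (simp add: P_def)
        next
          case False
          have "((\<lambda>t. w x t * \<phi> x t) has_real_derivative 0) (at t)"
            by (rule DERIV_zero_of_locally_zero[OF slt[of x]]) (use out[OF False] K(3) in auto)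
          then show ?thesis using P0[OF out[OF False]] by simp
        qed
      qed
    qed (use K(3) in auto)
    moreover have "(Q has_integral 0) UNIV"
    proof (rule has_integral_divergence[OF continuous_on_UNIV_of_support[OF oT cQ K(1,2) Q0] K(1) Q0])
      show "(\<forall>x t. ((\<lambda>t. (\<lambda>p. u (fst p) (snd p) * w (fst p) (snd p) * \<phi> (fst p) (snd p)) (x, t)) has_real_derivative Q (x, t)) (at t)) \<or>
         (\<forall>x t. ((\<lambda>x. (\<lambda>p. u (fst p) (snd p) * w (fst p) (snd p) * \<phi> (fst p) (snd p)) (x, t)) has_real_derivative Q (x, t)) (at x))"
      proof (intro disjI2 allI)
        fix x t
        show "((\<lambda>x. (\<lambda>p. u (fst p) (snd p) * w (fst p) (snd p) * \<phi> (fst p) (snd p)) (x, t)) has_real_derivative Q (x, t)) (at x)"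
        proof (cases "t < 1")
          case True
          from DERIV_mult'[OF duw[OF True] px[of t x]] show ?thesis by (simp add: Q_def)
        next
          case False
          have "((\<lambda>x. u x t * w x t * \<phi> x t) has_real_derivative 0) (at x)"
            by (rule DERIV_zero_of_locally_zero[OF slx[of t]]) (use out[OF False] K(3) in auto)
          then show ?thesis using Q0[OF out[OF False]] by simp
        qed
      qed
    qed (use K(3) in auto)
    ultimately have "((\<lambda>p. P p + a * Q p) has_integral 0 + a * 0) UNIV"
      by (intro has_integral_add has_integral_mult_right)
    moreover have "P p + a * Q p = (case p of (x, t) \<Rightarrow> w x t * \<phi>t x t + a * u x t * w x t * \<phi>x x t + (1 + a) * h x t * w x t * \<phi> x t)" for p
    proof -
      obtain x t where p: "p = (x, t)" by (metis surj_pair)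
      define X where "X = x / m t"
      define c where "c = 1 / (1 - t)\<^sup>2"
      have hw: "h x t * w x t = c * (HW X * W X)" by (simp add: h_def w_def X_def c_def power2_eq_square)
      \<comment> \<open>The pointwise profile equation with a u_x w added on both sides, which
        produces the coefficient 1 + a of the weak form.\<close>
      have "(W X + B * DW X) + a * (HW X * W X + V X * DW X) = (1 + a) * (HW X * W X)"
        using eq[of X] by (simp add: algebra_simps)
      then have "c * \<phi> x t * ((W X + B * DW X) + a * (HW X * W X + V X * DW X)) = c * \<phi> x t * ((1 + a) * (HW X * W X))"
        by simp
      then have "c * (W X + B * DW X) * \<phi> x t + a * (c * (HW X * W X + V X * DW X) * \<phi> x t) = (1 + a) * (h x t * w x t) * \<phi> x t"
        unfolding hw by (simp add: algebra_simps)
      then show ?thesis unfolding p P_def Q_def fst_conv snd_conv case_prod_conv X_def[symmetric] c_def[symmetric]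
        by (simp add: distrib_left mult.assoc)
    qed
    ultimately show ?thesis by simp
  qed
  have "gDG_solution a 1 w"
    unfolding gDG_solution_def
  proof (rule exI[of _ h], rule exI[of _ u], intro conjI allI impI)
    show "has_hilbert (\<lambda>y. w y t) x (h x t)" if "t < 1" for t x
      unfolding w_def h_def by (rule hil[OF mp[OF that]])
    show "u 0 t = 0" for t by (simp add: u_def)
    show "((\<lambda>y. u y t) has_real_derivative h x t) (at x)" if "t < 1" for t x by (rule dux[OF that])
  qed (rule weak)
  then show ?thesis by (simp add: w_def m_def)
qed

section \<open>Hoelder-valued power series\<close>

text \<open>The hypotheses make both suprema range over bounded nonempty sets, so they are genuine.
  The lower bound is there to squeeze the norm to 0.\<close>

lemma holder_norm_bounds:
  assumes "\<And>x. \<bar>f x\<bar> \<le> e" "\<And>x y. \<bar>f x - f y\<bar> \<le> e * \<bar>x - y\<bar> powr \<alpha>"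
  shows "0 \<le> holder_norm \<alpha> f" "holder_norm \<alpha> f \<le> 2 * e"
proof -
  let ?q = "\<lambda>p :: real \<times> real. \<bar>f (fst p) - f (snd p)\<bar> / \<bar>fst p - snd p\<bar> powr \<alpha>"
  let ?S = "{(x, y). x \<noteq> (y::real)}"
  have q: "?q p \<le> e" if "p \<in> ?S" for p
  proof -
    have "\<bar>fst p - snd p\<bar> powr \<alpha> > 0" using that by auto
    then show ?thesis using assms(2)[of "fst p" "snd p"] by (simp add: divide_le_eq)
  qed
  have p01: "(0, 1) \<in> ?S" by simp
  then have ne: "?S \<noteq> {}" by blast
  have "0 \<le> ?q (0, 1)" by simp
  also have "\<dots> \<le> (SUP p \<in> ?S. ?q p)" using q p01 by (intro cSUP_upper bdd_aboveI2) auto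
  finally have a: "0 \<le> (SUP p \<in> ?S. ?q p)" .
  have b: "(SUP p \<in> ?S. ?q p) \<le> e" using q ne by (intro cSUP_least) auto
  have "0 \<le> \<bar>f 0\<bar>" by simp
  also have "\<dots> \<le> (SUP x. \<bar>f x\<bar>)" using assms(1) by (intro cSUP_upper bdd_aboveI2) auto
  finally have c: "0 \<le> (SUP x. \<bar>f x\<bar>)" .
  have d: "(SUP x. \<bar>f x\<bar>) \<le> e" using assms(1) by (intro cSUP_least) auto
  show "0 \<le> holder_norm \<alpha> f" "holder_norm \<alpha> f \<le> 2 * e" using a b c d by (auto simp: holder_norm_def)
qed

text \<open>The part of the binomial expansion of (A + D)^k that has order at least N in D; it
  dominates the remainder after N terms when a^k is re-expanded about a0.\<close>

definition taylor_tail :: "real \<Rightarrow> real \<Rightarrow> nat \<Rightarrow> nat \<Rightarrow> real" where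
  "taylor_tail A D k N = (\<Sum>n\<in>{N..k}. real (k choose n) * A ^ (k - n) * D ^ n)"

lemma taylor_tail_le: assumes "A \<ge> 0" "D \<ge> 0" shows "0 \<le> taylor_tail A D k N" "taylor_tail A D k N \<le> (A + D) ^ k"
proof -
  show "0 \<le> taylor_tail A D k N" unfolding taylor_tail_def using assms by (intro sum_nonneg) auto
  have "taylor_tail A D k N \<le> (\<Sum>n\<le>k. real (k choose n) * A ^ (k - n) * D ^ n)"
    unfolding taylor_tail_def using assms by (intro sum_mono2) auto
  also have "\<dots> = (A + D) ^ k"
    using binomial_ring[of D A k] by (simp add: add.commute mult_ac)
  finally show "taylor_tail A D k N \<le> (A + D) ^ k" .
qed

text \<open>Analyticity is required at every a0, not only at 0, so the series is re-expanded with
  the binomial theorem. \<open>sup\<close> and \<open>hol\<close> share the constants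
  \<open>B n\<close>, which lets one scalar estimate serve both parts of the norm.\<close>

lemma holder_analytic_power_series:
  fixes g :: "nat \<Rightarrow> real \<Rightarrow> real" and B :: "nat \<Rightarrow> real"
  assumes sup: "\<And>n x. \<bar>g n x\<bar> \<le> B n"
    and hol: "\<And>n x y. \<bar>g n x - g n y\<bar> \<le> B n * \<bar>x - y\<bar> powr \<alpha>"
    and summ: "\<And>r. 0 \<le> r \<Longrightarrow> r < R \<Longrightarrow> summable (\<lambda>n. r ^ n * B n)"
    and W: "\<And>a x. \<bar>a\<bar> < R \<Longrightarrow> (\<lambda>n. a ^ n * g n x) sums W a x"
  shows "holder_analytic_on \<alpha> W {a. \<bar>a\<bar> < R}"
  unfolding holder_analytic_on_def
proof
  fix a0 assume "a0 \<in> {a. \<bar>a\<bar> < R}"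
  then have a0: "\<bar>a0\<bar> < R" by simp
  have B0: "B n \<ge> 0" for n using sup[of n 0] by simp
  define r where "r = R - \<bar>a0\<bar>"
  have r: "r > 0" using a0 by (simp add: r_def)
  \<comment> \<open>For n > k the binomial coefficient is 0, so the truncated exponent k - n does no
    harm.\<close>
  define \<gamma> where "\<gamma> = (\<lambda>k n. real (k choose n) * a0 ^ (k - n))"
  define G where "G = (\<lambda>n x. \<Sum>k. \<gamma> k n * g k x)"
  \<comment> \<open>A Cauchy estimate for the new coefficients: one term is at most the whole
    binomial expansion. The radius r/2 could be any radius below r.\<close>
  have gam: "\<bar>\<gamma> k n\<bar> * (r / 2) ^ n \<le> (\<bar>a0\<bar> + r / 2) ^ k" for k n
  proof (cases "n \<le> k")
    case True
    have "\<bar>\<gamma> k n\<bar> * (r / 2) ^ n = real (k choose n) * \<bar>a0\<bar> ^ (k - n) * (r / 2) ^ n" by (simp add: \<gamma>_def abs_mult power_abs)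
    also have "\<dots> \<le> taylor_tail \<bar>a0\<bar> (r / 2) k 0"
      unfolding taylor_tail_def using True r by (intro member_le_sum[of n "{0..k}" "\<lambda>n. real (k choose n) * \<bar>a0\<bar> ^ (k - n) * (r / 2) ^ n"]) auto
    also have "\<dots> \<le> (\<bar>a0\<bar> + r / 2) ^ k" using r by (intro taylor_tail_le) auto
    finally show ?thesis .
  qed (use r in \<open>simp add: \<gamma>_def binomial_eq_0\<close>)
  define b where "b = (\<lambda>n. (\<Sum>k. ((\<bar>a0\<bar> + r / 2) ^ k * B k)) / (r / 2) ^ n)"
  have sm: "summable (\<lambda>k. (\<bar>a0\<bar> + r / 2) ^ k * B k)" 
  proof (rule summ)
    have "r / 2 < r" using r by simp
    then have "\<bar>a0\<bar> + r / 2 < \<bar>a0\<bar> + r" by simp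
    also have "\<dots> = R" by (simp add: r_def)
    finally show "\<bar>a0\<bar> + r / 2 < R" .
  qed (use r in auto)
  have gB: "\<bar>\<gamma> k n\<bar> * B k \<le> ((\<bar>a0\<bar> + r / 2) ^ k * B k) / (r / 2) ^ n" for k n
  proof -
    have "\<bar>\<gamma> k n\<bar> * (r / 2) ^ n * B k \<le> (\<bar>a0\<bar> + r / 2) ^ k * B k" by (intro mult_right_mono gam B0)
    then show ?thesis using r by (simp add: field_simps)
  qed
  \<comment> \<open>\<xi> will be either the sequence of values at a point, with c = 1, or the
    sequence of differences at two points, with c = |x - y|^\<alpha>. The estimate
    \<open>rem\<close> below has the same form for the same reason.\<close>
  have lin: "summable (\<lambda>k. \<gamma> k n * \<xi> k) \<and> \<bar>\<Sum>k. \<gamma> k n * \<xi> k\<bar> \<le> b n * c"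
    if "\<And>k. \<bar>\<xi> k\<bar> \<le> B k * c" "c \<ge> 0" for \<xi> c n
  proof -
    have bd: "norm (\<gamma> k n * \<xi> k) \<le> ((\<bar>a0\<bar> + r / 2) ^ k * B k) / (r / 2) ^ n * c" for k
    proof -
      have "\<bar>\<gamma> k n\<bar> * \<bar>\<xi> k\<bar> \<le> \<bar>\<gamma> k n\<bar> * (B k * c)" by (intro mult_left_mono that) auto
      also have "\<dots> = \<bar>\<gamma> k n\<bar> * B k * c" by simp
      also have "\<dots> \<le> ((\<bar>a0\<bar> + r / 2) ^ k * B k) / (r / 2) ^ n * c" by (intro mult_right_mono gB that)
      finally show ?thesis by (simp add: abs_mult)
    qed
    have s: "summable (\<lambda>k. ((\<bar>a0\<bar> + r / 2) ^ k * B k) / (r / 2) ^ n * c)" using sm by (intro summable_mult2 summable_divide)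
    have "norm (\<Sum>k. \<gamma> k n * \<xi> k) \<le> (\<Sum>k. ((\<bar>a0\<bar> + r / 2) ^ k * B k) / (r / 2) ^ n * c)"
      by (rule norm_suminf_le[OF bd s])
    also have "\<dots> = b n * c" by (simp only: b_def suminf_divide[OF sm] suminf_mult2[OF summable_divide[OF sm], symmetric])
    finally show ?thesis using summable_comparison_test'[OF s bd] by simp
  qed
  have gs: "summable (\<lambda>k. \<gamma> k n * g k x)" for n x using lin[of "\<lambda>k. g k x" 1 n] sup by simp
  show "\<exists>r>0. \<exists>G. (\<forall>n. holder \<alpha> (G n)) \<and> (\<forall>a. \<bar>a - a0\<bar> < r \<longrightarrow>
           (\<lambda>N. holder_norm \<alpha> (\<lambda>x. W a x - (\<Sum>n<N. G n x * (a - a0) ^ n))) \<longlonglongrightarrow> 0)"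
  proof (intro exI[of _ r] conjI exI[of _ G] allI impI)
    fix n
    have s1: "\<bar>G n x\<bar> \<le> b n" for x unfolding G_def using lin[of "\<lambda>k. g k x" 1 n] sup by simp
    have "\<bar>G n x - G n y\<bar> \<le> b n * \<bar>x - y\<bar> powr \<alpha>" for x y
    proof -
      have "G n x - G n y = (\<Sum>k. \<gamma> k n * (g k x - g k y))"
        unfolding G_def using gs by (simp add: suminf_diff right_diff_distrib)
      then show ?thesis using lin[of "\<lambda>k. g k x - g k y" "\<bar>x - y\<bar> powr \<alpha>" n] hol by simp
    qed
    then show "holder \<alpha> (G n)" unfolding holder_def bounded_iff using s1 by (auto intro!: exI[of _ "b n"])
  next
    fix a assume a: "\<bar>a - a0\<bar> < r"
    define d where "d = a - a0"
    define T where "T = (\<lambda>k N. taylor_tail \<bar>a0\<bar> \<bar>d\<bar> k N)"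
    have aR: "\<bar>a\<bar> < R" "\<bar>a0\<bar> + \<bar>d\<bar> < R" using a by (auto simp: d_def r_def)
    have sM: "summable (\<lambda>k. (\<bar>a0\<bar> + \<bar>d\<bar>) ^ k * B k)" using aR by (intro summ) auto
    have TM: "norm (B k * T k N) \<le> (\<bar>a0\<bar> + \<bar>d\<bar>) ^ k * B k" for k N
      using taylor_tail_le[of "\<bar>a0\<bar>" "\<bar>d\<bar>" k N] B0[of k] by (simp add: T_def mult_left_mono mult.commute)
    define \<epsilon> where "\<epsilon> = (\<lambda>N. \<Sum>k. B k * T k N)"
    have sT: "summable (\<lambda>k. B k * T k N)" for N by (rule summable_comparison_test'[OF sM TM])
    \<comment> \<open>For fixed k the tail is an empty sum once N > k; Tannery's theorem carries
      this pointwise limit over to the sum.\<close>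
    have eps: "\<epsilon> \<longlonglongrightarrow> 0"
    proof -
      have "((\<lambda>N. \<Sum>k. B k * T k N) \<longlongrightarrow> (\<Sum>k. 0)) sequentially"
      proof (rule tannerys_theorem[where M = "\<lambda>k. (\<bar>a0\<bar> + \<bar>d\<bar>) ^ k * B k", THEN conjunct2, THEN conjunct2])
        show "((\<lambda>N. B k * T k N) \<longlongrightarrow> 0) sequentially" for k
        proof (rule tendsto_eventually)
          show "eventually (\<lambda>N. B k * T k N = 0) sequentially"
            using eventually_gt_at_top[of k] by eventually_elim (simp add: T_def taylor_tail_def)
        qed
        show "eventually (\<lambda>(k, N). norm (B k * T k N) \<le> (\<bar>a0\<bar> + \<bar>d\<bar>) ^ k * B k) (at_top \<times>\<^sub>F sequentially)"
          using TM by (intro always_eventually) auto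
      qed (use sM in auto)
      then show ?thesis by (simp add: \<epsilon>_def)
    qed
    have rem: "\<bar>(\<Sum>k. a ^ k * \<xi> k) - (\<Sum>n<N. (\<Sum>k. \<gamma> k n * \<xi> k) * d ^ n)\<bar> \<le> \<epsilon> N * c"
      if xi: "\<And>k. \<bar>\<xi> k\<bar> \<le> B k * c" "c \<ge> 0" for \<xi> N c
    proof -
      have sa: "summable (\<lambda>k. a ^ k * \<xi> k)"
      proof (rule summable_comparison_test'[where g = "\<lambda>k. \<bar>a\<bar> ^ k * B k * c"])
        show "summable (\<lambda>k. \<bar>a\<bar> ^ k * B k * c)" using aR by (intro summable_mult2 summ) auto
        show "norm (a ^ k * \<xi> k) \<le> \<bar>a\<bar> ^ k * B k * c" for k
          using mult_left_mono[OF xi(1)[of k], of "\<bar>a\<bar> ^ k"] by (simp add: abs_mult power_abs mult.assoc)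
      qed
      have sg: "summable (\<lambda>k. \<gamma> k n * \<xi> k)" for n using lin[OF xi] by blast
      have "(\<Sum>n<N. (\<Sum>k. \<gamma> k n * \<xi> k) * d ^ n) = (\<Sum>n<N. \<Sum>k. \<gamma> k n * \<xi> k * d ^ n)"
        using sg by (simp add: suminf_mult2)
      also have "\<dots> = (\<Sum>k. \<Sum>n<N. \<gamma> k n * \<xi> k * d ^ n)"
        by (intro suminf_sum[symmetric] summable_mult2 sg)
      finally have e1: "(\<Sum>n<N. (\<Sum>k. \<gamma> k n * \<xi> k) * d ^ n) = (\<Sum>k. \<Sum>n<N. \<gamma> k n * \<xi> k * d ^ n)" .
      have s2: "summable (\<lambda>k. \<Sum>n<N. \<gamma> k n * \<xi> k * d ^ n)" by (intro summable_sum summable_mult2 sg)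
      have "(\<Sum>k. a ^ k * \<xi> k) - (\<Sum>n<N. (\<Sum>k. \<gamma> k n * \<xi> k) * d ^ n) = (\<Sum>k. a ^ k * \<xi> k - (\<Sum>n<N. \<gamma> k n * \<xi> k * d ^ n))"
        unfolding e1 by (rule suminf_diff[OF sa s2])
      also have "\<bar>\<dots>\<bar> \<le> (\<Sum>k. B k * T k N * c)"
      proof -
        have "norm (a ^ k * \<xi> k - (\<Sum>n<N. \<gamma> k n * \<xi> k * d ^ n)) \<le> B k * T k N * c" for k
        proof -
          have "a ^ k = (\<Sum>n\<le>k. \<gamma> k n * d ^ n)"
            using binomial_ring[of d a0 k] by (simp add: d_def \<gamma>_def mult_ac)
          also have "\<dots> = (\<Sum>n<N. \<gamma> k n * d ^ n) + (\<Sum>n\<in>{N..k}. \<gamma> k n * d ^ n)"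
          proof -
            have "(\<Sum>n\<le>k. \<gamma> k n * d ^ n) = (\<Sum>n\<in>{..<N} \<union> {N..k}. \<gamma> k n * d ^ n)"
              by (rule sum.mono_neutral_left) (auto simp: \<gamma>_def not_le binomial_eq_0)
            also have "\<dots> = (\<Sum>n<N. \<gamma> k n * d ^ n) + (\<Sum>n\<in>{N..k}. \<gamma> k n * d ^ n)"
              by (rule sum.union_disjoint) auto
            finally show ?thesis .
          qed
          finally have "a ^ k - (\<Sum>n<N. \<gamma> k n * d ^ n) = (\<Sum>n\<in>{N..k}. \<gamma> k n * d ^ n)" by simp
          moreover have "a ^ k * \<xi> k - (\<Sum>n<N. \<gamma> k n * \<xi> k * d ^ n) = (a ^ k - (\<Sum>n<N. \<gamma> k n * d ^ n)) * \<xi> k"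
            by (simp add: algebra_simps sum_distrib_left)
          moreover have "\<bar>\<Sum>n\<in>{N..k}. \<gamma> k n * d ^ n\<bar> \<le> T k N"
            unfolding T_def taylor_tail_def by (rule order_trans[OF sum_abs]) (simp add: \<gamma>_def abs_mult power_abs)
          ultimately have "norm (a ^ k * \<xi> k - (\<Sum>n<N. \<gamma> k n * \<xi> k * d ^ n)) \<le> T k N * (B k * c)"
            using xi B0[of k] taylor_tail_le(1)[of "\<bar>a0\<bar>" "\<bar>d\<bar>" k N] by (simp add: abs_mult T_def) (intro mult_mono, auto)
          then show ?thesis by (simp add: mult_ac)
        qed
        from norm_suminf_le[OF this summable_mult2[OF sT]] show ?thesis by simp
      qed
      also have "\<dots> = \<epsilon> N * c" unfolding \<epsilon>_def by (rule suminf_mult2[OF sT, symmetric])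
      finally show ?thesis .
    qed
    let ?f = "\<lambda>N x. W a x - (\<Sum>n<N. G n x * (a - a0) ^ n)"
    have Wa: "W a x = (\<Sum>k. a ^ k * g k x)" for x using W[OF aR(1)] by (simp add: sums_iff)
    have f1: "\<bar>?f N x\<bar> \<le> \<epsilon> N" for N x
      using rem[of "\<lambda>k. g k x" 1 N] sup unfolding Wa G_def d_def[symmetric] by simp
    have f2: "\<bar>?f N x - ?f N y\<bar> \<le> \<epsilon> N * \<bar>x - y\<bar> powr \<alpha>" for N x y
    proof -
      have "W a x - W a y = (\<Sum>k. a ^ k * (g k x - g k y))"
      proof -
        have su: "summable (\<lambda>n. a ^ n * g n x)" for x using W[OF aR(1)] by (rule sums_summable)
        show ?thesis by (simp only: Wa right_diff_distrib suminf_diff[OF su su])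
      qed
      moreover have "G n x - G n y = (\<Sum>k. \<gamma> k n * (g k x - g k y))" for n
        unfolding G_def using gs by (simp add: suminf_diff right_diff_distrib)
      moreover have "?f N x - ?f N y = (W a x - W a y) - (\<Sum>n<N. (G n x - G n y) * d ^ n)"
        by (simp add: d_def left_diff_distrib sum_subtractf)
      ultimately show ?thesis using rem[of "\<lambda>k. g k x - g k y" "\<bar>x - y\<bar> powr \<alpha>" N] hol by simp
    qed
    show "(\<lambda>N. holder_norm \<alpha> (?f N)) \<longlonglongrightarrow> 0"
    proof (rule tendsto_sandwich)
      show "eventually (\<lambda>N. 0 \<le> holder_norm \<alpha> (?f N)) sequentially"
        using holder_norm_bounds(1)[OF f1 f2] by (intro always_eventually) blast
      show "eventually (\<lambda>N. holder_norm \<alpha> (?f N) \<le> 2 * \<epsilon> N) sequentially"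
        using holder_norm_bounds(2)[OF f1 f2] by (intro always_eventually) blast
      show "(\<lambda>N. 2 * \<epsilon> N) \<longlonglongrightarrow> 0" using tendsto_mult_right_zero[OF eps, of 2] by simp
    qed simp
  qed (rule r)
qed

text \<open>For z = x and z = y the ratio z / (x + y) is at most 1, hence at most its own
  \<alpha>-th power; the two inequalities are added.\<close>

lemma powr_subadditive:
  fixes x y \<alpha> :: real
  assumes "0 \<le> x" "0 \<le> y" "0 < \<alpha>" "\<alpha> \<le> 1" shows "(x + y) powr \<alpha> \<le> x powr \<alpha> + y powr \<alpha>"
proof (cases "x + y = 0")
  case False
  then have s: "x + y > 0" using assms by simp
  have *: "z / (x + y) * (x + y) powr \<alpha> \<le> z powr \<alpha>" if "0 \<le> z" "z \<le> x + y" for z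
  proof (cases "z = 0")
    case False
    then have z: "z > 0" using that by simp
    have "(z / (x + y)) powr 1 \<le> (z / (x + y)) powr \<alpha>"
      using z s that assms by (intro powr_mono') auto
    then have "z / (x + y) \<le> z powr \<alpha> / (x + y) powr \<alpha>" using z s by (simp add: powr_divide)
    then show ?thesis using s by (simp add: pos_le_divide_eq)
  qed simp
  have "(x + y) powr \<alpha> = x / (x + y) * (x + y) powr \<alpha> + y / (x + y) * (x + y) powr \<alpha>"
    using s by (simp add: distrib_right[symmetric] add_divide_distrib[symmetric])
  then show ?thesis using *[of x] *[of y] assms by simp
qed (use assms in auto)

section \<open>Regularity and nontriviality of the profiles\<close>

context gdg
begin

lemma PW_minus: "PW F (- x) = - PW F x" by (simp add: PW_def)

text \<open>The derivative at u is at most \<beta> \<omega> M u^(\<alpha> - 1). The factor \<beta> =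
  4 \<alpha> / 3 cancels the 1/\<alpha> from integration, and subadditivity of the power turns the
  difference of powers into a power of the difference.\<close>

lemma PW_holder_pos:
  assumes F: "bnd2 M F" and xy: "0 < y" "y < x"
  shows "\<bar>PW F x - PW F y\<bar> \<le> 2 * \<omega> * M * (x - y) powr \<alpha>"
proof -
  note M = bnd2_nonneg[OF F]
  have "norm (PW F x - PW F y) \<le> (4/3 * \<omega> * M) * x powr \<alpha> - (4/3 * \<omega> * M) * y powr \<alpha>"
  proof (rule differentiable_bound_general[where f' = "\<lambda>u. PD F u / u" and \<phi>' = "\<lambda>u. (4/3 * \<omega> * M) * (\<alpha> * u powr (\<alpha> - 1))"])
    show "continuous_on {y..x} (PW F)" by (rule continuous_on_subset[OF PW_cont[OF F]]) simp
    show "continuous_on {y..x} (\<lambda>u. (4/3 * \<omega> * M) * u powr \<alpha>)" using xy by (intro continuous_intros) auto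
    fix u assume u: "y < u" "u < x"
    then have u0: "u > 0" using xy by simp
    show "(PW F has_vector_derivative PD F u / u) (at u)"
      using PW_deriv[OF F, of u] u0 by (simp add: has_real_derivative_iff_has_vector_derivative)
    have "((\<lambda>u. (4/3 * \<omega> * M) * u powr \<alpha>) has_real_derivative (4/3 * \<omega> * M) * (\<alpha> * u powr (\<alpha> - 1))) (at u)"
      by (intro DERIV_cmult has_real_derivative_powr u0)
    then show "((\<lambda>u. (4/3 * \<omega> * M) * u powr \<alpha>) has_vector_derivative (4/3 * \<omega> * M) * (\<alpha> * u powr (\<alpha> - 1))) (at u)"
      by (simp only: has_real_derivative_iff_has_vector_derivative)
    have "\<bar>PD F u\<bar> / u \<le> \<beta> * \<omega> * M * u powr \<alpha> / u"
      using PD_le[OF F, of u] u0 by (intro divide_right_mono) auto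
    also have "\<dots> = (4/3 * \<omega> * M) * (\<alpha> * u powr (\<alpha> - 1))" using u0 by (simp add: \<beta>_def powr_diff)
    finally show "norm (PD F u / u) \<le> (4/3 * \<omega> * M) * (\<alpha> * u powr (\<alpha> - 1))" using u0 by (simp add: abs_mult)
  qed (use xy in auto)
  also have "\<dots> = (4/3 * \<omega> * M) * (x powr \<alpha> - y powr \<alpha>)" by (simp add: algebra_simps)
  also have "\<dots> \<le> (4/3 * \<omega> * M) * (x - y) powr \<alpha>"
    using powr_subadditive[of y "x - y" \<alpha>] xy alpha omega M by (intro mult_left_mono) auto
  also have "\<dots> \<le> 2 * \<omega> * M * (x - y) powr \<alpha>"
    using omega M by (intro mult_right_mono) auto
  finally show ?thesis by simp
qed

lemma PW_holder:
  assumes F: "bnd2 M F"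
  shows "\<bar>PW F x - PW F y\<bar> \<le> 2 * \<omega> * M * \<bar>x - y\<bar> powr \<alpha>"
proof -
  note M = bnd2_nonneg[OF F]
  have oM: "0 \<le> \<omega> * M" using omega M by simp
  have nn: "\<bar>PW F x - PW F y\<bar> \<le> 2 * \<omega> * M * \<bar>x - y\<bar> powr \<alpha>" if xy: "0 \<le> y" "y \<le> x" for x y
  proof -
    consider "x = y" | "y = 0" "0 < x" | "0 < y" "y < x" using xy by linarith
    then show ?thesis
    proof cases
      case 2
      have "\<bar>PW F x\<bar> \<le> \<omega> * M * \<bar>x\<bar> powr \<alpha>" by (rule PW_le(2)[OF F])
      also have "\<dots> \<le> 2 * \<omega> * M * \<bar>x\<bar> powr \<alpha>" using omega M by (intro mult_right_mono) auto
      finally show ?thesis using 2 by (simp add: PW_def)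
    next
      case 3 then show ?thesis using PW_holder_pos[OF F 3] by simp
    qed simp
  qed
  \<comment> \<open>Across 0 both values are estimated separately by |x|^\<alpha> and |y|^\<alpha>,
    which avoids integrating through the singular point.\<close>
  have op: "\<bar>PW F x - PW F y\<bar> \<le> 2 * \<omega> * M * \<bar>x - y\<bar> powr \<alpha>" if xy: "y \<le> 0" "0 \<le> x" for x y
  proof -
    have "\<bar>PW F x\<bar> \<le> \<omega> * M * \<bar>x - y\<bar> powr \<alpha>"
      using PW_le(2)[OF F, of x] mult_left_mono[OF powr_mono2[of \<alpha> "\<bar>x\<bar>" "\<bar>x - y\<bar>"] oM] alpha xy by simp
    moreover have "\<bar>PW F y\<bar> \<le> \<omega> * M * \<bar>x - y\<bar> powr \<alpha>"
      using PW_le(2)[OF F, of y] mult_left_mono[OF powr_mono2[of \<alpha> "\<bar>y\<bar>" "\<bar>x - y\<bar>"] oM] alpha xy by simp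
    moreover have "2 * \<omega> * M * \<bar>x - y\<bar> powr \<alpha> = \<omega> * M * \<bar>x - y\<bar> powr \<alpha> + \<omega> * M * \<bar>x - y\<bar> powr \<alpha>" by simp
    ultimately show ?thesis using abs_triangle_ineq4[of "PW F x" "PW F y"] by linarith
  qed
  consider "0 \<le> y" "y \<le> x" | "0 \<le> x" "x \<le> y" | "y \<le> 0" "0 \<le> x" | "x \<le> 0" "0 \<le> y" | "x \<le> 0" "y \<le> x" | "y \<le> 0" "x \<le> y" by linarith
  then show ?thesis
  proof cases
    case 1 then show ?thesis by (rule nn)
  next
    case 2 then show ?thesis using nn[of x y] by (simp add: abs_minus_commute)
  next
    case 3 then show ?thesis by (rule op)
  next
    case 4 then show ?thesis using op[of x y] by (simp add: abs_minus_commute)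
  next
    case 5 then show ?thesis using nn[of "- x" "- y"] by (simp add: PW_minus abs_minus_commute)
  next
    case 6 then show ?thesis using nn[of "- y" "- x"] by (simp add: PW_minus abs_minus_commute)
  qed
qed

lemma PW_Fa_series:
  assumes a: "\<bar>a\<bar> * q < 1"
  shows "(\<lambda>n. a ^ n * PW (ff n) x) sums PW (Fa a) x"
proof -
  have "(\<lambda>n. Re (of_real a ^ n * wF (ff n) (of_real (\<beta> * ln \<bar>x\<bar>)))) sums Re (wF (Fa a) (of_real (\<beta> * ln \<bar>x\<bar>)))"
    by (rule sums_Re[OF wF_series[OF a real_in_Inn]])
  then have "(\<lambda>n. sgn x * Re (of_real a ^ n * wF (ff n) (of_real (\<beta> * ln \<bar>x\<bar>)))) sums PW (Fa a) x"
    unfolding PW_def by (rule sums_mult)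
  moreover have "sgn x * Re (of_real a ^ n * z) = a ^ n * (sgn x * Re z)" for n z
    by (simp flip: of_real_power)
  ultimately show ?thesis by (simp only: PW_def)
qed

section \<open>Nontriviality\<close>

text \<open>At x = 1, that is s = 0, the value is -2 sin \<omega> divided by the square of |1 + exp
  (i \<omega>)|. Since \<omega> \<le> 2 pi / 3 stays away from pi, sin \<omega> is at least \<omega>
  / 4, uniformly in \<alpha>.\<close>

lemma PW_Z0_one: "\<bar>PW Z0 1\<bar> \<ge> \<omega> / 8"
proof -
  define c where "c = 1 + cos \<omega>"
  have om: "\<omega> \<le> 2 * pi / 3" using beta mult_left_mono[of \<beta> "4/3" pi] by (simp add: \<omega>_def)
  have e: "1 + exp (\<i> * \<omega>) = Complex c (sin \<omega>)" "1 + exp (- (\<i> * \<omega>)) = Complex c (- sin \<omega>)"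
    by (simp_all add: complex_eq_iff Re_exp Im_exp c_def)
  have nrm: "(cmod (Complex c (sin \<omega>)))\<^sup>2 = c\<^sup>2 + (sin \<omega>)\<^sup>2" by (simp add: cmod_power2)
  have le4: "c\<^sup>2 + (sin \<omega>)\<^sup>2 \<le> 4"
  proof -
    have "c\<^sup>2 + (sin \<omega>)\<^sup>2 = 2 + 2 * cos \<omega>" using sin_squared_eq[of \<omega>] by (simp add: c_def power2_eq_square algebra_simps)
    then show ?thesis using cos_le_one[of \<omega>] by linarith
  qed
  have sinom: "sin \<omega> \<ge> \<omega> / 4"
  proof -
    define x where "x = \<omega> / 2"
    have x: "0 < x" "x \<le> pi / 3" using omega om by (auto simp: x_def)
    have cosge: "1 / 2 \<le> cos z" if "0 \<le> z" "z \<le> pi / 3" for z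
      using cos_monotone_0_pi_le[of z "pi / 3"] that cos_60 pi_gt_zero by auto
    obtain z where z: "0 < z" "z < x" "sin x - sin 0 = (x - 0) * cos z"
      using MVT2[of 0 x sin cos] x by (auto intro: DERIV_sin)
    have "x * (1 / 2) \<le> x * cos z" using x z by (intro mult_left_mono cosge) auto
    then have sx: "x / 2 \<le> sin x" using z by simp
    have "sin \<omega> = 2 * sin x * cos x" using sin_double[of x] by (simp add: x_def)
    moreover have "2 * sin x * (1 / 2) \<le> 2 * sin x * cos x" using sx x by (intro mult_left_mono cosge) auto
    ultimately show ?thesis using sx by (simp add: x_def)
  qed
  have s0: "sin \<omega> > 0" using sinom omega by linarith
  define D where "D = c\<^sup>2 + (sin \<omega>)\<^sup>2"
  have D: "0 < D" "D \<le> 4" using s0 le4 by (auto simp: D_def add_nonneg_pos)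
  have "wF Z0 0 = (2 / Complex c (sin \<omega>) - 2 / Complex c (- sin \<omega>)) / (2 * \<i>)"
    by (simp add: wF_def Z0_def e)
  also have "\<dots> = of_real (- 2 * sin \<omega> / D)"
  proof -
    have "2 / Complex c (sin \<omega>) = Complex (2 * c / D) (- 2 * sin \<omega> / D)" "2 / Complex c (- sin \<omega>) = Complex (2 * c / D) (2 * sin \<omega> / D)"
      by (simp_all add: complex_eq_iff Re_divide Im_divide D_def)
    then have "2 / Complex c (sin \<omega>) - 2 / Complex c (- sin \<omega>) = of_real (- 2 * sin \<omega> / D) * (2 * \<i>)"
      by (simp add: complex_eq_iff)
    then show ?thesis by simp
  qed
  finally have "PW Z0 1 = - 2 * sin \<omega> / D" by (simp add: PW_def)
  then have "\<bar>PW Z0 1\<bar> = 2 * sin \<omega> / D" using s0 D by (simp add: abs_mult)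
  moreover have "2 * sin \<omega> / 4 \<le> 2 * sin \<omega> / D" using D s0 by (intro divide_left_mono) auto
  ultimately show ?thesis using sinom by linarith
qed

text \<open>Every term of the series at x = 1 scales with \<omega>: the zeroth is at least \<omega>
  / 8 in modulus, all the others together at most 2 \<omega> / 10^10, so they cannot cancel
  it.\<close>

lemma PW_nontrivial: assumes a: "\<bar>a\<bar> * q < 1" shows "PW (Fa a) 1 \<noteq> 0"
proof -
  define S where "S = (\<lambda>n. a ^ n * PW (ff n) 1)"
  have S: "S sums PW (Fa a) 1" unfolding S_def by (rule PW_Fa_series[OF a])
  have bd: "norm (S (Suc n)) \<le> \<omega> / 10^10 * (1 / (real (Suc n))\<^sup>2)" for n
  proof -
    have "\<bar>PW (ff (Suc n)) 1\<bar> \<le> \<omega> * b (Suc n)" by (rule PW_le(1)[OF ff(2)])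
    then have "\<bar>a\<bar> ^ Suc n * \<bar>PW (ff (Suc n)) 1\<bar> \<le> \<bar>a\<bar> ^ Suc n * (\<omega> * b (Suc n))" by (intro mult_left_mono) auto
    also have "\<dots> = (\<bar>a\<bar> * q) ^ Suc n * (\<omega> / 10^10 * (1 / (real (Suc n))\<^sup>2))"
      by (simp add: b_def power_mult_distrib)
    also have "\<dots> \<le> 1 * (\<omega> / 10^10 * (1 / (real (Suc n))\<^sup>2))"
      using a q_pos omega by (intro mult_right_mono power_le_one) auto
    finally show ?thesis by (simp add: S_def abs_mult power_abs)
  qed
  have part: "(\<Sum>n<N. \<omega> / 10^10 * (1 / (real (Suc n))\<^sup>2)) \<le> \<omega> / 10^10 * 2" for N
  proof -
    have "(\<Sum>n<N. 1 / (real (Suc n))\<^sup>2) = (\<Sum>j=1..<Suc N. 1 / (real j)\<^sup>2)"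
      by (rule sum.reindex_bij_witness[of _ "\<lambda>j. j - 1" Suc]) auto
    then have "(\<Sum>n<N. 1 / (real (Suc n))\<^sup>2) \<le> 2" using sum_inverse_squares_le[of "Suc N"] by simp
    then have "\<omega> / 10^10 * (\<Sum>n<N. 1 / (real (Suc n))\<^sup>2) \<le> \<omega> / 10^10 * 2" using omega by (intro mult_left_mono) auto
    then show ?thesis by (simp only: sum_distrib_left)
  qed
  have tail: "norm (\<Sum>n<N. S (Suc n)) \<le> \<omega> / 10^10 * 2" for N
    using order_trans[OF order_trans[OF norm_sum sum_mono[OF bd]] part[of N]] by simp
  have "(\<lambda>n. S (Suc n)) sums (PW (Fa a) 1 - S 0)" using S by (simp add: sums_Suc_iff)
  then have "(\<lambda>N. \<Sum>n<N. S (Suc n)) \<longlonglongrightarrow> PW (Fa a) 1 - S 0" by (simp add: sums_def)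
  then have "(\<lambda>N. norm (\<Sum>n<N. S (Suc n))) \<longlonglongrightarrow> norm (PW (Fa a) 1 - S 0)" by (rule tendsto_norm)
  then have "norm (PW (Fa a) 1 - S 0) \<le> \<omega> / 10^10 * 2" by (rule LIMSEQ_le_const2) (use tail in auto)
  moreover have "S 0 = PW Z0 1" by (simp add: S_def ff(1))
  ultimately have "\<bar>PW (Fa a) 1 - PW Z0 1\<bar> \<le> \<omega> / 10^10 * 2" by simp
  moreover have "\<omega> / 10^10 * 2 < \<omega> / 8" using omega by simp
  ultimately show ?thesis using PW_Z0_one by auto
qed

text \<open>\<lambda> is the constant 1/\<beta> - 1, so its power series about any point has a
  single term; all dependence on a sits in the profile.\<close>

lemma profile_family:
  "\<exists>(W :: real \<Rightarrow> real \<Rightarrow> real) (lam :: real \<Rightarrow> real).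
        (\<forall>a. \<bar>a * \<alpha>\<bar> < 3 / (4 * 10^25) \<longrightarrow>
           holder \<alpha> (W a) \<and> (\<exists>x. W a x \<noteq> 0) \<and>
           gDG_solution a 1 (\<lambda>x t. (1 / (1 - t)) * W a (x / (1 - t) powr (1 + lam a)))) \<and>
        holder_analytic_on \<alpha> W {a. \<bar>a * \<alpha>\<bar> < 3 / (4 * 10^25)} \<and>
        real_analytic_on lam {a. \<bar>a * \<alpha>\<bar> < 3 / (4 * 10^25)}"
proof (intro exI[of _ "\<lambda>a. PW (Fa a)"] exI[of _ "\<lambda>_. 1 / \<beta> - 1"] conjI allI impI)
  \<comment> \<open>The origin of the absolute constant: q = 10^25 times 4 \<alpha> / 3, so
    convergence of the series in a is a condition on the product of a and \<alpha> alone.\<close>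
  have small: "\<bar>a * \<alpha>\<bar> < 3 / (4 * 10^25) \<longleftrightarrow> \<bar>a\<bar> * q < 1" for a
    using alpha by (simp add: q_def \<beta>_def abs_mult field_simps)
  have small': "{a. \<bar>a * \<alpha>\<bar> < 3 / (4 * 10^25)} = {a. \<bar>a\<bar> < 1 / q}"
    unfolding small using q_pos by (auto simp: field_simps)
  {
    fix a assume "\<bar>a * \<alpha>\<bar> < 3 / (4 * 10^25)"
    then have a: "\<bar>a\<bar> * q < 1" using small by blast
    note n = bnd2_Fa[OF a]
    show "holder \<alpha> (PW (Fa a))"
      unfolding holder_def bounded_iff using PW_le(1)[OF n] PW_holder[OF n] by (auto intro!: exI)
    show "\<exists>x. PW (Fa a) x \<noteq> 0" using PW_nontrivial[OF a] by blast
    show "gDG_solution a 1 (\<lambda>x t. (1 / (1 - t)) * PW (Fa a) (x / (1 - t) powr (1 + (1 / \<beta> - 1))))"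
      unfolding add_diff_cancel_left[of 1] add_diff_eq[of 1]
      by (rule self_similar_solution[where HW = "PH (Fa a)" and V = "PV (Fa a)" and DW = "PD (Fa a)"])
         (use PW_cont[OF n] PH_cont[OF n] PV_cont[OF n] PD_cont[OF n] PW_deriv[OF n] PU_deriv[OF n] PW_hilbert[OF n] physical_equation[OF a] in \<open>auto simp: PW_def[of _ 0] PD_def[of _ 0]\<close>)
  }
  show "holder_analytic_on \<alpha> (\<lambda>a. PW (Fa a)) {a. \<bar>a * \<alpha>\<bar> < 3 / (4 * 10^25)}"
    unfolding small'
  proof (rule holder_analytic_power_series[where g = "\<lambda>n. PW (ff n)" and B = "\<lambda>n. 2 * \<omega> * b n"])
    show "\<bar>PW (ff n) x\<bar> \<le> 2 * \<omega> * b n" for n x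
      using PW_le(1)[OF ff(2), of n x] omega b_pos[of n] mult_pos_pos[OF omega(1) b_pos[of n]] by simp
    show "\<bar>PW (ff n) x - PW (ff n) y\<bar> \<le> 2 * \<omega> * b n * \<bar>x - y\<bar> powr \<alpha>" for n x y
      by (rule PW_holder[OF ff(2)])
    show "summable (\<lambda>n. r ^ n * (2 * \<omega> * b n))" if "0 \<le> r" "r < 1 / q" for r
    proof -
      have "\<bar>r\<bar> * q < 1" using that q_pos by (simp add: field_simps)
      from summable_mult[OF summable_b[OF this], of "2 * \<omega>"] show ?thesis using that by (simp add: mult_ac)
    qed
    show "(\<lambda>n. a ^ n * PW (ff n) x) sums PW (Fa a) x" if "\<bar>a\<bar> < 1 / q" for a x
      by (rule PW_Fa_series) (use that q_pos in \<open>simp add: field_simps\<close>)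
  qed
  show "real_analytic_on (\<lambda>_. 1 / \<beta> - 1) {a. \<bar>a * \<alpha>\<bar> < 3 / (4 * 10^25)}"
    unfolding real_analytic_on_def
  proof (intro ballI exI[of _ 1] conjI exI[of _ "\<lambda>n. if n = 0 then 1 / \<beta> - 1 else 0"] allI impI)
    fix a a0 :: real
    show "(\<lambda>n. (if n = 0 then 1 / \<beta> - 1 else 0) * (a - a0) ^ n) sums (1 / \<beta> - 1)"
      using sums_finite[of "{0}" "\<lambda>n. (if n = 0 then 1 / \<beta> - 1 else 0) * (a - a0) ^ n"] by simp
  qed simp
qed

end

theorem theorem1p1:
  shows "\<exists>c > 0. \<forall>\<alpha> :: real. 0 < \<alpha> \<and> \<alpha> < 1 \<longrightarrow>
     (\<exists>(W :: real \<Rightarrow> real \<Rightarrow> real) (lam :: real \<Rightarrow> real).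
        (\<forall>a. \<bar>a * \<alpha>\<bar> < c \<longrightarrow>
           holder \<alpha> (W a) \<and> (\<exists>x. W a x \<noteq> 0) \<and>
           gDG_solution a 1 (\<lambda>x t. (1 / (1 - t)) * W a (x / (1 - t) powr (1 + lam a)))) \<and>
        holder_analytic_on \<alpha> W {a. \<bar>a * \<alpha>\<bar> < c} \<and>
        real_analytic_on lam {a. \<bar>a * \<alpha>\<bar> < c})"
proof (intro exI[of _ "3 / (4 * 10^25)"] conjI allI impI)
  fix \<alpha> :: real assume "0 < \<alpha> \<and> \<alpha> < 1"
  then interpret gdg \<alpha> by unfold_locales auto
  show "\<exists>(W :: real \<Rightarrow> real \<Rightarrow> real) (lam :: real \<Rightarrow> real).
        (\<forall>a. \<bar>a * \<alpha>\<bar> < 3 / (4 * 10^25) \<longrightarrow>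
           holder \<alpha> (W a) \<and> (\<exists>x. W a x \<noteq> 0) \<and>
           gDG_solution a 1 (\<lambda>x t. (1 / (1 - t)) * W a (x / (1 - t) powr (1 + lam a)))) \<and>
        holder_analytic_on \<alpha> W {a. \<bar>a * \<alpha>\<bar> < 3 / (4 * 10^25)} \<and>
        real_analytic_on lam {a. \<bar>a * \<alpha>\<bar> < 3 / (4 * 10^25)}"
    by (rule profile_family)
qed simp

end
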